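(* Let $0\le p<1$, $\delta\in(0,1)$, and let $X$ be a real random variable with finite second moment and $P(X\ne0)=\epsilon$. For each noise variance $\sigma_w^2$ let $\sigma_\ell$ denote the lowest fixed point of $\Psi_{\lambda_*,p}(\sigma^2)$, i.e. the smallest $\sigma\geq 0$ with $\Psi_{\lambda_*,p}(\sigma^2)=\sigma^2$. If $\epsilon<\delta$, then there exists $\sigma_0^2>0$ such that for $\sigma_w^2<\sigma_0^2$, $\sigma_\ell^2$ is a continuous function of $\sigma_w^2$. Furthermore, $$\lim_{\sigma_w^2\to0}\frac{\sigma_\ell^2}{\sigma_w^2}=\frac{1}{1-\frac{\epsilon}{\delta}}.$$
   Context: For $0\le p\le1$, $\lambda\ge0$, $u\in\mathbb{R}$: $\eta_p(u;\lambda)=\arg\min_{x\in\mathbb{R}}\frac12(u-x)^2+\lambda|x|^p$ (with $|x|^0=\mathbb{I}(x\neq0)$), the value $0$ being chosen when the minimizer is not unique. State evolution map with optimal thresholding policy $\lambda_*(\sigma)\in\arg\min_{\lambda\ge0}\mathbb{E}|\eta_p(X+\sigma Z;\lambda)-X|^2$: for $\sigma\ge0$, $$\Psi_{\lambda_*,p}(\sigma^2)=\sigma_w^2+\frac1\delta\inf_{\lambda\ge0}\mathbb{E}\left|\eta_p(X+\sigma Z;\lambda)-X\right|^2,$$ with $X$ and $Z\sim N(0,1)$ independent. The law of $X$, $p$ and $\delta$ are fixed while $\sigma_w^2$ varies. *)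

theory Defs
  imports "HOL-Probability.Probability"
begin

text \<open>
  Since \<open>0 powr p = 0\<close> for every \<open>p\<close> (including \<open>p = 0\<close>), the term \<open>\<bar>x\<bar> powr p\<close> agrees
  with \<open>\<bar>x\<bar>\<^sup>p\<close> under the convention that \<open>\<bar>x\<bar>\<^sup>0\<close> is the indicator of \<open>x \<noteq> 0\<close>.
\<close>

definition lp_objective :: "real \<Rightarrow> real \<Rightarrow> real \<Rightarrow> real \<Rightarrow> real" where
  "lp_objective p l u x = (u - x)\<^sup>2 / 2 + l * \<bar>x\<bar> powr p"

text \<open>
  For \<open>0 \<le> p \<le> 1\<close> and \<open>l \<ge> 0\<close> a minimizer always exists, so the \<open>else\<close> branch
  is exactly the case of several minimizers.
\<close>

definition eta :: "real \<Rightarrow> real \<Rightarrow> real \<Rightarrow> real" where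
  "eta p u l =
     (if \<exists>!x. is_arg_min (lp_objective p l u) (\<lambda>_. True) x
      then THE x. is_arg_min (lp_objective p l u) (\<lambda>_. True) x
      else 0)"

definition eta_risk ::
  "'a measure \<Rightarrow> ('a \<Rightarrow> real) \<Rightarrow> ('a \<Rightarrow> real) \<Rightarrow> real \<Rightarrow> real \<Rightarrow> real \<Rightarrow> real" where
  "eta_risk M X Z p \<sigma> l =
     prob_space.expectation M (\<lambda>\<omega>. \<bar>eta p (X \<omega> + \<sigma> * Z \<omega>) l - X \<omega>\<bar>\<^sup>2)"

text \<open>
  The arguments \<open>w\<close> and \<open>v\<close> are the variances \<open>\<sigma>\<^sub>w\<^sup>2\<close> and \<open>\<sigma>\<^sup>2\<close>.
\<close>

definition Psi_opt ::
  "'a measure \<Rightarrow> ('a \<Rightarrow> real) \<Rightarrow> ('a \<Rightarrow> real) \<Rightarrow> real \<Rightarrow> real \<Rightarrow> real \<Rightarrow> real \<Rightarrow> real" where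
  "Psi_opt M X Z p \<delta> w v = w + 1 / \<delta> * (INF l\<in>{0..}. eta_risk M X Z p (sqrt v) l)"

definition is_lowest_fixed_point :: "(real \<Rightarrow> real) \<Rightarrow> real \<Rightarrow> bool" where
  "is_lowest_fixed_point \<Psi> \<sigma> \<longleftrightarrow>
     \<sigma> \<ge> 0 \<and> \<Psi> (\<sigma>\<^sup>2) = \<sigma>\<^sup>2 \<and> (\<forall>\<tau>\<ge>0. \<Psi> (\<tau>\<^sup>2) = \<tau>\<^sup>2 \<longrightarrow> \<sigma> \<le> \<tau>)"

definition sigma_low ::
  "'a measure \<Rightarrow> ('a \<Rightarrow> real) \<Rightarrow> ('a \<Rightarrow> real) \<Rightarrow> real \<Rightarrow> real \<Rightarrow> real \<Rightarrow> real" where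
  "sigma_low M X Z p \<delta> w = (THE \<sigma>. is_lowest_fixed_point (Psi_opt M X Z p \<delta> w) \<sigma>)"

end

theory Submission
  imports Defs
begin

text \<open>
  Let \<open>R v\<close> be the optimal risk at noise variance \<open>v\<close>. A fixed point is a root of
  \<open>v - R v / \<delta> = w\<close>. Existence of a lowest one needs only that \<open>R\<close> is continuous and bounded;
  the limit follows from \<open>R v / v \<longlonglongrightarrow> \<epsilon>\<close>, and continuity from the one-sided bound
  \<open>R v' - R v \<le> D (v' - v)\<close> for small \<open>v < v'\<close> with some \<open>D < \<delta>\<close>, which makes
  \<open>v - R v / \<delta>\<close> strictly increasing near \<open>0\<close>.

  For the one-sided bound, compare the optimal penalty \<open>\<lambda>\<close> at noise level \<open>\<sigma>\<close> with the penalty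
  at \<open>\<sigma>' > \<sigma>\<close> for which \<open>\<lambda> \<sigma>\<^sup>k\<close> is unchanged. Adding the optimality inequalities of the two
  minimisation problems gives, for the errors \<open>e\<close>, \<open>e'\<close> and the noise \<open>z\<close>,
  \<open>e'\<^sup>2 - e\<^sup>2 \<le> 2 c z (e' - e)\<close> with \<open>c\<close> close to \<open>\<sigma> (k + 1) / k\<close>, whatever the jumps of the thresholding
  function. The expectation of \<open>z e\<close> is differentiable in \<open>\<sigma>\<close> by Gaussian smoothing, and its
  derivative is at most \<open>\<epsilon> + o(1)\<close>: at the optimal penalty the risk is \<open>\<sigma>\<^sup>2 (\<epsilon> + o(1))\<close>,
  which forces the shrinkage to be small in mean square, and the only term not controlled by this
  has the right sign by convexity of the shrinkage above the threshold.
  Taking \<open>k\<close> large makes \<open>(k + 1) / k \<epsilon> < \<delta>\<close>.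
\<close>

section \<open>The thresholding function\<close>

text \<open>The optimal penalty is never computed, and neither uniqueness nor continuity in the
  noise level is available for it, so the estimates must hold for all penalties at once. After
  division by the noise level a penalty becomes a rescaled \<open>shrinkage\<close> with threshold
  \<open>T / c\<close>. All constants therefore depend on the ratio \<open>\<nu>\<close>, which
  rescaling preserves, and not on the threshold. Closeness of the risk to its limit then yields
  information on the scale: a lower bound for the risk contains the risk at signal 0 and the mean of
  \<open>defect\<close>, so both are small at an optimal scale, and the slope bound is written in
  terms of these two quantities. The minimal risk itself may fail to be differentiable, because the
  optimal scale may jump. What is obtained is a bound for increments to the right whose admissible
  length depends on the noise level; a closedness argument joins these steps into a bound on an
  interval.\<close>

lemma powr_bernoulli:
  fixes t q :: real
  assumes "0 < t" "q \<le> 0"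
  shows "1 + q * (t - 1) \<le> t powr q"
proof -
  have "q * (t - 1) \<le> q * ln t"
    using assms ln_le_minus_one[of t] by (intro mult_left_mono_neg) auto
  also have "1 + \<dots> \<le> exp (q * ln t)" by (rule exp_ge_add_one_self)
  finally show ?thesis using assms by (simp add: powr_def)
qed

text \<open>Tangent-line form of convexity. Together with the Bernoulli inequality above it replaces
  second-derivative arguments about the objective.\<close>

lemma powr_tangent:
  fixes y y' q :: real
  assumes "0 < y" "0 < y'" "q \<le> 0"
  shows "y powr q + q * y powr (q - 1) * (y' - y) \<le> y' powr q"
proof -
  have "y powr q * (1 + q * (y' / y - 1)) \<le> y powr q * (y' / y) powr q"
    using assms by (intro mult_left_mono powr_bernoulli) auto
  also have "\<dots> = y' powr q" using assms by (simp add: powr_divide)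
  also have "y powr q * (1 + q * (y' / y - 1)) = y powr q + q * (y powr q / y) * (y' - y)"
    using assms by (simp add: field_simps)
  also have "y powr q / y = y powr (q - 1)" using assms by (simp add: powr_diff)
  finally show ?thesis .
qed

text \<open>The limit of \<^term>\<open>eta p u 1\<close> as \<open>u\<close> decreases to the threshold.\<close>

definition kink :: "real \<Rightarrow> real" where
  "kink p = (2 * (1 - p)) powr (1 / (2 - p))"

text \<open>At \<open>y = kink p\<close> the stationarity equation
  \<open>u = y + p * y powr (p - 1)\<close> and the tie \<open>u = y / 2 + y powr (p - 1)\<close>
  between the values at \<open>y\<close> and at \<open>0\<close> hold for the same \<open>u\<close>,
  which is the threshold.\<close>

definition threshold :: "real \<Rightarrow> real" where
  "threshold p = kink p + p * kink p powr (p - 1)"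

text \<open>The part removed is tracked instead of the part kept: it is bounded, it vanishes at
  infinity, and the estimation error is the noise minus this part.\<close>

definition shrink :: "real \<Rightarrow> real \<Rightarrow> real" where
  "shrink p u = u - eta p u 1"

section \<open>Symmetry and scaling of the minimisation problem\<close>

lemma is_arg_min_iff_le: "is_arg_min f (\<lambda>_. True) x \<longleftrightarrow> (\<forall>y. f x \<le> f y)"
  for f :: "real \<Rightarrow> real"
  by (auto simp: is_arg_min_linorder)

lemma objective_expand: "lp_objective q l u x = u * u / 2 - u * x + x * x / 2 + l * \<bar>x\<bar> powr q"
  by (simp add: lp_objective_def power2_eq_square field_simps)

lemma objective_neg_le:
  assumes "0 \<le> u"
  shows "lp_objective q l u \<bar>y\<bar> \<le> lp_objective q l u y"
proof -
  have "u * y \<le> u * \<bar>y\<bar>" using assms by (intro mult_left_mono) auto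
  then show ?thesis by (simp add: objective_expand)
qed

lemma objective_uminus: "lp_objective q l (- u) (- x) = lp_objective q l u x"
  by (simp add: lp_objective_def power2_eq_square algebra_simps)

lemma arg_min_uminus:
  "is_arg_min (lp_objective q l (- u)) (\<lambda>_. True) x \<longleftrightarrow> is_arg_min (lp_objective q l u) (\<lambda>_. True) (- x)"
  unfolding is_arg_min_iff_le by (metis objective_uminus minus_minus)

text \<open>Scaling the variables by \<open>s\<close> multiplies the quadratic term by
  \<open>s^2\<close>; the penalty \<open>s powr (2 - q)\<close> is the one for which the other term
  scales alike. This reduces every positive penalty to penalty 1.\<close>

lemma objective_scale:
  assumes "0 < s"
  shows "lp_objective q (s powr (2 - q)) u (s * x) = s\<^sup>2 * lp_objective q 1 (u / s) x"
proof -
  have "s powr (2 - q) * s powr q = s\<^sup>2" using assms by (simp add: powr_add[symmetric])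
  then have *: "s powr (2 - q) * \<bar>s * x\<bar> powr q = s\<^sup>2 * \<bar>x\<bar> powr q"
    using assms by (simp add: abs_mult powr_mult)
  have "(u - s * x)\<^sup>2 = s\<^sup>2 * (u / s - x)\<^sup>2"
    using assms by (simp add: power2_eq_square field_simps)
  then show ?thesis unfolding lp_objective_def * by (simp add: algebra_simps)
qed

lemma arg_min_scale:
  assumes "0 < s"
  shows "is_arg_min (lp_objective q (s powr (2 - q)) u) (\<lambda>_. True) (s * x)
    \<longleftrightarrow> is_arg_min (lp_objective q 1 (u / s)) (\<lambda>_. True) x"
proof -
  have s2: "0 < s\<^sup>2" using assms by simp
  have "(\<forall>y. lp_objective q (s powr (2 - q)) u (s * x) \<le> lp_objective q (s powr (2 - q)) u y)
    \<longleftrightarrow> (\<forall>y. lp_objective q (s powr (2 - q)) u (s * x) \<le> lp_objective q (s powr (2 - q)) u (s * y))"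
    using assms by (metis less_irrefl nonzero_mult_div_cancel_left times_divide_eq_right)
  then show ?thesis
    unfolding is_arg_min_iff_le using s2 by (simp add: objective_scale[OF assms])
qed

lemma eta_unique:
  assumes 1: "is_arg_min (lp_objective q l u) (\<lambda>_. True) y"
    and 2: "\<And>z. is_arg_min (lp_objective q l u) (\<lambda>_. True) z \<Longrightarrow> z = y"
  shows "eta q u l = y"
proof -
  have "\<exists>!x. is_arg_min (lp_objective q l u) (\<lambda>_. True) x" using assms by (rule ex1I)
  moreover have "(THE x. is_arg_min (lp_objective q l u) (\<lambda>_. True) x) = y"
    using assms by (rule the_equality)
  ultimately show ?thesis unfolding eta_def by (simp only: if_True)
qed

lemma eta_not_unique:
  "\<not> (\<exists>!x. is_arg_min (lp_objective q l u) (\<lambda>_. True) x) \<Longrightarrow> eta q u l = 0"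
  unfolding eta_def by (simp only: if_False)

lemma eta_eq_zero_if_arg_min:
  assumes "is_arg_min (lp_objective q l u) (\<lambda>_. True) 0"
  shows "eta q u l = 0"
proof (cases "\<exists>!x. is_arg_min (lp_objective q l u) (\<lambda>_. True) x")
  case True
  then show ?thesis by (intro eta_unique[OF assms]) (blast intro: assms)
qed (rule eta_not_unique)

lemma eta_eq_if_arg_min:
  assumes "\<And>z. z \<noteq> y \<Longrightarrow> lp_objective q l u y < lp_objective q l u z"
  shows "eta q u l = y"
proof -
  have 1: "is_arg_min (lp_objective q l u) (\<lambda>_. True) y"
    unfolding is_arg_min_iff_le using assms by (metis less_eq_real_def)
  have 2: "z = y" if "is_arg_min (lp_objective q l u) (\<lambda>_. True) z" for z
    using that assms unfolding is_arg_min_iff_le by (metis not_le)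
  show ?thesis by (rule eta_unique[OF 1 2])
qed

text \<open>Serves the sign change and the rescaling alike. Non-uniqueness has to be transferred
  too, because \<open>eta\<close> then takes its default 0, which multiplication by \<open>a\<close>
  preserves.\<close>

lemma eta_transfer:
  assumes "\<And>x. is_arg_min (lp_objective q l u) (\<lambda>_. True) (a * x) \<longleftrightarrow> is_arg_min (lp_objective q l' u') (\<lambda>_. True) x"
    and "a \<noteq> 0"
  shows "eta q u l = a * eta q u' l'"
proof (cases "\<exists>!x. is_arg_min (lp_objective q l' u') (\<lambda>_. True) x")
  case True
  then obtain x where x: "is_arg_min (lp_objective q l' u') (\<lambda>_. True) x"
    and xu: "\<And>y. is_arg_min (lp_objective q l' u') (\<lambda>_. True) y \<Longrightarrow> y = x" by blast
  have 1: "is_arg_min (lp_objective q l u) (\<lambda>_. True) (a * x)" using x assms by blast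
  have 2: "y = a * x" if "is_arg_min (lp_objective q l u) (\<lambda>_. True) y" for y
    using xu[of "y / a"] assms(1)[of "y / a"] that assms(2) by (auto simp: field_simps)
  have "eta q u l = a * x" by (rule eta_unique[OF 1 2])
  moreover have "eta q u' l' = x" by (rule eta_unique[OF x xu])
  ultimately show ?thesis by simp
next
  case False
  have "\<not> (\<exists>!x. is_arg_min (lp_objective q l u) (\<lambda>_. True) x)"
  proof
    assume "\<exists>!x. is_arg_min (lp_objective q l u) (\<lambda>_. True) x"
    then obtain x where x: "is_arg_min (lp_objective q l u) (\<lambda>_. True) x"
      and xu: "\<And>y. is_arg_min (lp_objective q l u) (\<lambda>_. True) y \<Longrightarrow> y = x" by blast
    have "is_arg_min (lp_objective q l' u') (\<lambda>_. True) (x / a)" using assms(1)[of "x / a"] assms(2) x by simp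
    moreover have "y = x / a" if "is_arg_min (lp_objective q l' u') (\<lambda>_. True) y" for y
      using xu[of "a * y"] assms(1)[of y] assms(2) that by (simp add: field_simps)
    ultimately show False using False by blast
  qed
  then show ?thesis using eta_not_unique[OF False] eta_not_unique by simp
qed

lemma eta_uminus: "eta q (- u) l = - eta q u l"
  using eta_transfer[of q l "- u" "- 1" l u] by (simp add: arg_min_uminus)

lemma shrink_uminus: "shrink q (- u) = - shrink q u"
  by (simp add: shrink_def eta_uminus)

lemma eta_no_penalty: "eta q u 0 = u"
  by (intro eta_eq_if_arg_min) (simp add: lp_objective_def)

section \<open>The explicit threshold for exponents below one\<close>

context
  fixes p :: real
  assumes p0: "0 \<le> p" and p1: "p < 1"
begin

lemma kink_pos: "0 < kink p"
  using p1 by (simp add: kink_def)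

lemma kink_powr: "kink p powr (2 - p) = 2 * (1 - p)"
  using p1 by (simp add: kink_def powr_powr)

lemma kink_slope: "(1 - p) * kink p powr (p - 2) = 1 / 2"
proof -
  have "kink p powr (p - 2) = inverse (kink p powr (2 - p))"
    by (simp add: powr_minus[symmetric])
  then show ?thesis using p1 by (simp add: kink_powr field_simps)
qed

lemma kink_powr': "kink p powr (p - 1) = kink p / (2 * (1 - p))"
proof -
  have "kink p powr (p - 1) = kink p powr (p - 2) * kink p powr 1"
    by (subst powr_add[symmetric]) simp
  moreover have "kink p powr (p - 2) = 1 / (2 * (1 - p))"
    using kink_slope p1 by (simp add: field_simps)
  ultimately show ?thesis using kink_pos by simp
qed

lemma threshold_pos: "0 < threshold p"
  using kink_pos p0 by (simp add: threshold_def add_pos_nonneg)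

text \<open>The left side is the right limit of the shrinkage at the threshold. The ratio
  \<open>p / (2 - p)\<close> is the \<open>\<nu>\<close> of the locale
  \<open>shrinkage\<close>.\<close>

lemma shrink_at_threshold: "p * kink p powr (p - 1) = p / (2 - p) * threshold p"
  using p1 by (simp add: threshold_def kink_powr' divide_simps) (simp add: algebra_simps)

lemma slope_bound:
  assumes "kink p \<le> y"
  shows "(1 - p) * y powr (p - 2) \<le> 1 / 2"
proof -
  have "y powr (p - 2) \<le> kink p powr (p - 2)"
    using assms kink_pos p1 by (intro powr_mono2') auto
  then have "(1 - p) * y powr (p - 2) \<le> (1 - p) * kink p powr (p - 2)"
    using p1 by (intro mult_left_mono) auto
  then show ?thesis by (simp add: kink_slope)
qed

lemma objective_diff_zero:
  assumes "0 < y"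
  shows "lp_objective p 1 u y - lp_objective p 1 u 0 = y * (y / 2 + y powr (p - 1) - u)"
proof -
  have "y powr p = y * y powr (p - 1)" using assms by (simp add: powr_diff)
  then show ?thesis using assms by (simp add: objective_expand algebra_simps)
qed

text \<open>The right side is convex in \<open>y\<close> with a stationary point at
  \<open>kink p\<close>, so its tangent there is the constant \<open>threshold p\<close>.\<close>

lemma threshold_le:
  assumes "0 < y"
  shows "threshold p \<le> y / 2 + y powr (p - 1)"
proof -
  have "kink p powr (p - 1) + (p - 1) * kink p powr (p - 1 - 1) * (y - kink p) \<le> y powr (p - 1)"
    using assms kink_pos p1 by (intro powr_tangent) auto
  moreover have "(p - 1) * kink p powr (p - 1 - 1) = - (1 / 2)"
    using kink_slope by (simp add: left_diff_distrib)
  moreover have "threshold p = kink p / 2 + kink p powr (p - 1)"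
    using p1 by (simp add: threshold_def kink_powr' field_simps)
  ultimately show ?thesis by (simp add: diff_divide_distrib)
qed

lemma arg_min_zero:
  assumes "0 \<le> u" "u \<le> threshold p"
  shows "is_arg_min (lp_objective p 1 u) (\<lambda>_. True) 0"
proof -
  have *: "lp_objective p 1 u 0 \<le> lp_objective p 1 u y" if "0 < y" for y
  proof -
    have "0 \<le> y * (y / 2 + y powr (p - 1) - u)"
      using threshold_le[OF that] assms that by (intro mult_nonneg_nonneg) auto
    then show ?thesis using objective_diff_zero[OF that, of u] by linarith
  qed
  have "lp_objective p 1 u 0 \<le> lp_objective p 1 u y" for y
  proof (cases "y = 0")
    case False
    then have "lp_objective p 1 u 0 \<le> lp_objective p 1 u \<bar>y\<bar>" by (intro *) auto
    also have "\<dots> \<le> lp_objective p 1 u y" by (rule objective_neg_le[OF assms(1)])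
    finally show ?thesis .
  qed simp
  then show ?thesis by (simp add: is_arg_min_iff_le)
qed

lemma arg_min_active:
  assumes y: "kink p < y" and z: "z \<noteq> y" and u: "u = y + p * y powr (p - 1)"
  shows "lp_objective p 1 u y < lp_objective p 1 u z"
proof -
  have y0: "0 < y" using y kink_pos by simp
  have u0: "0 < u" using y0 p0 by (simp add: u add_pos_nonneg)
  have yp: "y powr p = y * y powr (p - 1)" using y0 by (simp add: powr_diff)
  have nonneg: "lp_objective p 1 u y < lp_objective p 1 u z" if z: "0 \<le> z" "z \<noteq> y" for z
  proof -
    define t where "t = z / y"
    have t: "z = t * y" "0 \<le> t" "t \<noteq> 1" using z y0 by (auto simp: t_def)
    \<comment> \<open>The Bernoulli inequality with exponent \<open>p - 1\<close>, multiplied by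
      \<open>t\<close>, leaves a remainder that is quadratic in \<open>t - 1\<close>, like the data
      term. The comparison of the two coefficients is then exactly
      \<open>kink p < y\<close>.\<close>
    have A: "1 + p * (t - 1) - t powr p \<le> (1 - p) * (t - 1)\<^sup>2"
    proof (cases "t = 0")
      case False
      then have tp: "0 < t" using t by simp
      have "t * (1 + (p - 1) * (t - 1)) \<le> t * t powr (p - 1)"
        using p1 tp by (intro mult_left_mono powr_bernoulli) auto
      also have "\<dots> = t powr p" using tp by (simp add: powr_diff)
      finally show ?thesis by (simp add: power2_eq_square algebra_simps)
    qed simp
    have "y powr (2 - p) > kink p powr (2 - p)"
      using y kink_pos p1 by (intro powr_less_mono2) auto
    then have B: "y powr (2 - p) > 2 * (1 - p)" by (simp add: kink_powr)
    have zp: "\<bar>z\<bar> powr p = y powr p * t powr p"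
      using t y0 by (simp add: abs_mult powr_mult)
    have uy: "u * y = y * y + p * y powr p" by (simp add: u yp algebra_simps)
    have "lp_objective p 1 u z - lp_objective p 1 u y
        = u * y * (1 - t) + (t * t - 1) * (y * y) / 2 + y powr p * (t powr p - 1)"
      unfolding objective_expand zp using y0 by (simp add: t(1) field_simps)
    also have "\<dots> = y\<^sup>2 * (t - 1)\<^sup>2 / 2 - y powr p * (1 + p * (t - 1) - t powr p)"
      unfolding uy by (simp add: power2_eq_square field_simps)
    also have "\<dots> \<ge> y\<^sup>2 * (t - 1)\<^sup>2 / 2 - y powr p * ((1 - p) * (t - 1)\<^sup>2)"
      using A by (intro diff_left_mono mult_left_mono) auto
    also have y2: "y\<^sup>2 = y powr p * y powr (2 - p)"
      using y0 by (simp add: powr_add[symmetric])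
    finally have "lp_objective p 1 u z - lp_objective p 1 u y
        \<ge> y powr p * (t - 1)\<^sup>2 * (y powr (2 - p) - 2 * (1 - p)) / 2"
      by (simp add: field_simps)
    moreover have "y powr p * (t - 1)\<^sup>2 * (y powr (2 - p) - 2 * (1 - p)) > 0"
      using B t y0 by (intro mult_pos_pos) auto
    ultimately show ?thesis by linarith
  qed
  show ?thesis
  proof (cases "0 \<le> z")
    case True
    then show ?thesis using nonneg z by blast
  next
    case False
    show ?thesis
    proof (cases "- z = y")
      case True
      have "u * z < u * y" using u0 y0 False by (intro mult_strict_left_mono) auto
      moreover have "\<bar>z\<bar> = y" "z * z = y * y" using True False by auto
      ultimately show ?thesis using y0 by (simp add: objective_expand)
    next
      case neq: False
      have "lp_objective p 1 u y < lp_objective p 1 u \<bar>z\<bar>" using False neq by (intro nonneg) auto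
      also have "\<dots> \<le> lp_objective p 1 u z" using u0 by (intro objective_neg_le) auto
      finally show ?thesis .
    qed
  qed
qed

lemma eta_small: "0 \<le> u \<Longrightarrow> u \<le> threshold p \<Longrightarrow> eta p u 1 = 0"
  by (intro eta_eq_zero_if_arg_min arg_min_zero)

lemma eta_active: "kink p < y \<Longrightarrow> eta p (y + p * y powr (p - 1)) 1 = y"
  by (intro eta_eq_if_arg_min arg_min_active) auto

text \<open>Inputs above the threshold are parametrised by their minimiser \<open>y\<close>: the
  shrinkage is explicit in \<open>y\<close>, while in \<open>u\<close> it is given only
  implicitly.\<close>

lemma active_obtain:
  assumes "threshold p < u"
  obtains y where "kink p < y" "u = y + p * y powr (p - 1)" "eta p u 1 = y" "shrink p u = p * y powr (p - 1)"
proof -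
  have "\<exists>y. kink p \<le> y \<and> y \<le> kink p + u \<and> y + p * y powr (p - 1) = u"
  proof (rule IVT)
    show "kink p + p * kink p powr (p - 1) \<le> u" using assms by (simp add: threshold_def)
    show "u \<le> kink p + u + p * (kink p + u) powr (p - 1)" using kink_pos p0 by (simp add: add_nonneg_nonneg)
    show "kink p \<le> kink p + u" using assms threshold_pos by simp
    show "\<forall>x. kink p \<le> x \<and> x \<le> kink p + u \<longrightarrow> isCont (\<lambda>y. y + p * y powr (p - 1)) x"
      using kink_pos by (auto intro!: continuous_intros)
  qed
  then obtain y where y: "kink p \<le> y" "y + p * y powr (p - 1) = u" by blast
  with assms have "kink p < y" by (auto simp: threshold_def less_le)
  with eta_active[OF this] y that[of y] show ?thesis by (simp add: shrink_def algebra_simps)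
qed

lemma eta_arg_min: "is_arg_min (lp_objective p 1 u) (\<lambda>_. True) (eta p u 1)"
proof -
  have *: "is_arg_min (lp_objective p 1 u) (\<lambda>_. True) (eta p u 1)" if "0 \<le> u" for u
  proof (cases "u \<le> threshold p")
    case True
    then show ?thesis using that arg_min_zero eta_small by simp
  next
    case False
    then have "threshold p < u" by simp
    from active_obtain[OF this] obtain y where y: "kink p < y" "u = y + p * y powr (p - 1)" "eta p u 1 = y"
      by metis
    then show ?thesis unfolding is_arg_min_iff_le using arg_min_active[OF y(1) _ y(2)] by (metis less_eq_real_def)
  qed
  show ?thesis
  proof (cases "0 \<le> u")
    case False
    then show ?thesis using *[of "- u"] by (simp add: arg_min_uminus eta_uminus)
  qed (rule *)
qed

lemma eta_shrink_powr: "0 < s \<Longrightarrow> eta p u (s powr (2 - p)) = u - s * shrink p (u / s)"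
  using eta_transfer[OF arg_min_scale, of s p u] by (simp add: shrink_def algebra_simps)

lemma eta_powr_arg_min: "0 < s \<Longrightarrow> is_arg_min (lp_objective p (s powr (2 - p)) u) (\<lambda>_. True) (u - s * shrink p (u / s))"
  using arg_min_scale[of s p u "eta p (u / s) 1"] eta_arg_min by (simp add: shrink_def algebra_simps)

lemma eta_shrink:
  assumes "0 \<le> l"
  shows "eta p u l = u - l powr (1 / (2 - p)) * shrink p (u / l powr (1 / (2 - p)))"
\<comment> \<open>For \<open>l = 0\<close> the factor \<open>l powr (1 / (2 - p))\<close> is 0, so
  the division by zero inside \<open>shrink\<close> does no harm.\<close>
proof (cases "l = 0")
  case False
  then have "l = (l powr (1 / (2 - p))) powr (2 - p)" "0 < l powr (1 / (2 - p))"
    using p1 assms by (auto simp: powr_powr)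
  then show ?thesis using eta_shrink_powr by metis
qed (simp add: eta_no_penalty)

text \<open>Adding the two optimality inequalities cancels squares and penalties and leaves
  \<open>0 \<le> (u' - u) * (y' - y)\<close>. Monotonicity later supplies measurability.\<close>

lemma mono_eta: "mono (\<lambda>u. eta p u 1)"
proof
  fix u u' :: real assume le: "u \<le> u'"
  let ?y = "eta p u 1" and ?y' = "eta p u' 1"
  have "lp_objective p 1 u ?y \<le> lp_objective p 1 u ?y'" "lp_objective p 1 u' ?y' \<le> lp_objective p 1 u' ?y"
    using eta_arg_min unfolding is_arg_min_iff_le by auto
  then have "0 \<le> (u' - u) * (?y' - ?y)"
    by (simp add: objective_expand algebra_simps)
  then show "?y \<le> ?y'" using le by (cases "u = u'") (auto simp: zero_le_mult_iff)
qed

lemma shrink_small: "0 \<le> u \<Longrightarrow> u \<le> threshold p \<Longrightarrow> shrink p u = u"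
  by (simp add: shrink_def eta_small)

lemma shrink_nonneg: assumes "0 \<le> u" shows "0 \<le> shrink p u"
proof (cases "u \<le> threshold p")
  case False
  then have "threshold p < u" by simp
  from active_obtain[OF this] show ?thesis using p0 by (metis mult_nonneg_nonneg powr_ge_zero)
qed (use assms shrink_small in simp)

text \<open>Convexity above the threshold, proved in the parameter \<open>y\<close>: slope
  \<open>M\<close> of \<open>p * y powr (p - 1)\<close> becomes slope \<open>M / (1 + M)\<close> in
  \<open>u = y + p * y powr (p - 1)\<close>. The last conjunct extends the tangent inequality to the
  threshold itself. There the right limit has to be used, because the value of
  \<open>shrink p\<close> at the threshold is larger.\<close>

lemma shrink_subgradient:
  assumes u: "threshold p < u"
  shows "\<exists>m. - (p / (2 - p)) \<le> m \<and> m \<le> 0 \<and> (\<forall>v>threshold p. shrink p u + m * (v - u) \<le> shrink p v)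
    \<and> shrink p u + m * (threshold p - u) \<le> p / (2 - p) * threshold p"
proof -
  obtain y where y: "kink p < y" "u = y + p * y powr (p - 1)" "shrink p u = p * y powr (p - 1)"
    using active_obtain[OF u] by metis
  have y0: "0 < y" using y kink_pos by simp
  define M where "M = - (p * ((1 - p) * y powr (p - 2)))"
  have "p * ((1 - p) * y powr (p - 2)) \<le> p * (1 / 2)"
    using slope_bound[of y] y p0 by (intro mult_left_mono) auto
  then have M: "- (p / 2) \<le> M" "M \<le> 0" using p0 p1 by (auto simp: M_def)
  have M1: "0 < 1 + M" using M p1 by linarith
  have tangent: "p * y powr (p - 1) + M / (1 + M) * (x + p * x powr (p - 1) - u) \<le> p * x powr (p - 1)"
    if "kink p \<le> x" for x
  proof -
    let ?D = "p * x powr (p - 1) - p * y powr (p - 1)"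
    have "y powr (p - 1) + (p - 1) * y powr (p - 1 - 1) * (x - y) \<le> x powr (p - 1)"
      using that kink_pos y0 p1 by (intro powr_tangent) auto
    from mult_left_mono[OF this p0] have "M * (x - y) \<le> ?D"
      by (simp add: M_def algebra_simps)
    then have "M * (x + p * x powr (p - 1) - u) \<le> (1 + M) * ?D"
      by (simp add: y(2) algebra_simps)
    then have "M / (1 + M) * (x + p * x powr (p - 1) - u) \<le> ?D"
      using M1 by (simp add: divide_simps mult.commute)
    then show ?thesis by simp
  qed
  have "M / (1 + M) \<le> 0" using M M1 by (simp add: divide_nonpos_pos)
  moreover have "- (p / (2 - p)) \<le> M / (1 + M)"
    using M M1 p1 by (simp add: divide_simps) (simp add: algebra_simps)
  moreover have "shrink p u + M / (1 + M) * (v - u) \<le> shrink p v" if v: "threshold p < v" for v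
  proof -
    obtain x where "kink p < x" "v = x + p * x powr (p - 1)" "shrink p v = p * x powr (p - 1)"
      using active_obtain[OF v] by metis
    then show ?thesis using tangent[of x] y by simp
  qed
  moreover have "shrink p u + M / (1 + M) * (threshold p - u) \<le> p / (2 - p) * threshold p"
    using tangent[of "kink p", OF order_refl] y(3) unfolding threshold_def[symmetric] unfolding shrink_at_threshold by linarith
  ultimately show ?thesis by blast
qed

text \<open>Above the threshold the minimiser grows at least linearly in \<open>u\<close>, and the
  shrinkage is a negative power of it (times \<open>p\<close>).\<close>

lemma shrink_tendsto: "(shrink p \<longlongrightarrow> 0) at_top"
proof -
  have y_large: "u * (2 - 2 * p) / (2 - p) \<le> eta p u 1" if u: "threshold p < u" for u
  proof -
    obtain m where m: "m \<le> 0" "shrink p u + m * (threshold p - u) \<le> p / (2 - p) * threshold p"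
      using shrink_subgradient[OF u] by blast
    have "m * (threshold p - u) \<ge> 0" using m(1) u by (simp add: mult_nonpos_nonpos)
    then have "shrink p u \<le> p / (2 - p) * threshold p" using m by linarith
    also have "\<dots> \<le> p / (2 - p) * u" using u p0 p1 by (intro mult_left_mono) auto
    finally show ?thesis using p1 by (simp add: shrink_def field_simps)
  qed
  have lim: "filterlim (\<lambda>u. eta p u 1) at_top at_top"
  proof (rule filterlim_at_top_mono)
    have "filterlim (\<lambda>u. (2 - 2 * p) / (2 - p) * u) at_top at_top"
      using p1 by (intro filterlim_tendsto_pos_mult_at_top[OF tendsto_const] filterlim_ident) auto
    then show "filterlim (\<lambda>u. u * (2 - 2 * p) / (2 - p)) at_top at_top" by (simp add: mult.commute)
    show "\<forall>\<^sub>F u in at_top. u * (2 - 2 * p) / (2 - p) \<le> eta p u 1"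
      using eventually_gt_at_top[of "threshold p"] by eventually_elim (rule y_large)
  qed
  have "((\<lambda>u. p * (eta p u 1) powr (p - 1)) \<longlongrightarrow> p * 0) at_top"
    using p1 by (intro tendsto_mult tendsto_const tendsto_neg_powr lim) auto
  moreover have "\<forall>\<^sub>F u in at_top. p * (eta p u 1) powr (p - 1) = shrink p u"
    using eventually_gt_at_top[of "threshold p"]
    by eventually_elim (metis active_obtain)
  ultimately show ?thesis by (simp add: filterlim_cong[OF refl refl])
qed

end

text \<open>The risk estimates rest on these properties alone. They are stable under
  \<open>S (c * u) / c\<close> with the same \<open>\<nu>\<close>, so bounds that do not mention
  \<open>T\<close> hold uniformly in the penalty. The parameter \<open>\<nu>\<close> bounds the
  steepness above \<open>T\<close> and also the right limit of \<open>S\<close> at \<open>T\<close>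
  relative to \<open>T\<close>; thus \<open>\<nu> < 1\<close> makes \<open>S\<close> drop at
  \<open>T\<close>.\<close>

locale shrinkage =
  fixes S :: "real \<Rightarrow> real" and T \<nu> :: real
  assumes T_pos: "0 < T" and nu0: "0 \<le> \<nu>" and nu1: "\<nu> < 1"
    and S_uminus: "S (- u) = - S u"
    and S_small: "0 \<le> u \<Longrightarrow> u \<le> T \<Longrightarrow> S u = u"
    and S_nonneg: "0 \<le> u \<Longrightarrow> 0 \<le> S u"
    and S_subgradient: "T < u \<Longrightarrow> \<exists>m. - \<nu> \<le> m \<and> m \<le> 0
      \<and> (\<forall>v>T. S u + m * (v - u) \<le> S v) \<and> S u + m * (T - u) \<le> \<nu> * T"
    and S_tendsto: "(S \<longlongrightarrow> 0) at_top"
    and S_measurable [measurable]: "S \<in> borel_measurable borel"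

lemma shrinkage_shrink:
  assumes "0 \<le> p" "p < 1"
  shows "shrinkage (shrink p) (threshold p) (p / (2 - p))"
proof
  have "(\<lambda>u. eta p u 1) \<in> borel_measurable borel"
    using borel_measurable_mono[OF mono_eta[OF assms]] .
  then show "shrink p \<in> borel_measurable borel" by (simp add: shrink_def[abs_def])
qed (use assms threshold_pos[OF assms] shrink_uminus shrink_small[OF assms]
    shrink_nonneg[OF assms] shrink_subgradient[OF assms] shrink_tendsto[OF assms] in auto)

section \<open>Gaussian averages of a shrinkage function\<close>

definition gauss :: "real measure" where
  "gauss = density lborel std_normal_density"

lemma prob_space_gauss: "prob_space gauss"
  unfolding gauss_def by (rule prob_space_normal_density) simp

interpretation gauss: prob_space gauss by (rule prob_space_gauss)

lemma sets_gauss [measurable_cong, simp]: "sets gauss = sets borel"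
  and space_gauss [simp]: "space gauss = UNIV"
  by (simp_all add: gauss_def)

lemma measurable_gauss [simp]: "measurable gauss N = measurable borel N"
  by (intro measurable_cong_sets) simp_all

lemma integral_gauss:
  fixes f :: "real \<Rightarrow> real"
  assumes "f \<in> borel_measurable borel"
  shows "integral\<^sup>L gauss f = (\<integral>z. std_normal_density z * f z \<partial>lborel)"
    and "integrable gauss f \<longleftrightarrow> integrable lborel (\<lambda>z. std_normal_density z * f z)"
  unfolding gauss_def using assms
  by (simp_all add: integral_real_density integrable_real_density del: normal_density_def)

lemma measure_gauss_UNIV [simp]: "measure gauss UNIV = 1"
  using gauss.prob_space by simp

lemma integrable_gauss_indicator [simp]: "A \<in> sets borel \<Longrightarrow> integrable gauss (indicat_real A)"
  by (simp add: gauss.emeasure_eq_measure)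

lemma integrable_gauss_power [simp]: "integrable gauss (\<lambda>z. z ^ n)"
  and integrable_gauss_abs_power [simp]: "integrable gauss (\<lambda>z. \<bar>z\<bar> ^ n)"
  by (simp_all add: integral_gauss integrable_std_normal_moment integrable_std_normal_moment_abs)

lemma integrable_gauss_id [simp]: "integrable gauss (\<lambda>z. z)"
  using integrable_gauss_power[of 1] by simp

lemma gauss_moments [simp]:
  "(\<integral>z. z \<partial>gauss) = 0" "(\<integral>z. z\<^sup>2 \<partial>gauss) = 1" "(\<integral>z. z ^ 3 \<partial>gauss) = 0"
  "(\<integral>z. z ^ 4 \<partial>gauss) = 3" "(\<integral>z. z ^ 6 \<partial>gauss) = 15"
  using integral_std_normal_moment_odd[of 0] integral_std_normal_moment_odd[of 1]
    integral_std_normal_moment_even[of 1] integral_std_normal_moment_even[of 2]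
    integral_std_normal_moment_even[of 3]
  by (simp_all add: integral_gauss fact_numeral)

lemma integral_gauss_uminus:
  fixes f :: "real \<Rightarrow> real"
  assumes [measurable]: "f \<in> borel_measurable borel"
  shows "(\<integral>z. f (- z) \<partial>gauss) = (\<integral>z. f z \<partial>gauss)"
proof -
  have "(\<integral>z. std_normal_density z * f z \<partial>lborel) = (\<integral>z. std_normal_density (- z) * f (- z) \<partial>lborel)"
    using lborel_integral_real_affine[of "-1" "\<lambda>z. std_normal_density z * f z" 0] by simp
  then show ?thesis by (simp add: integral_gauss std_normal_density_def)
qed

lemma integrable_gauss_bounded_mult:
  fixes f g :: "real \<Rightarrow> real"
  assumes [measurable]: "f \<in> borel_measurable borel" and "\<And>z. \<bar>f z\<bar> \<le> B" and g: "integrable gauss g"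
  shows "integrable gauss (\<lambda>z. f z * g z)"
proof (rule Bochner_Integration.integrable_bound)
  show "integrable gauss (\<lambda>z. B * g z)" using g by simp
  have [measurable]: "g \<in> borel_measurable borel" using g borel_measurable_integrable by fastforce
  show "(\<lambda>z. f z * g z) \<in> borel_measurable gauss" by simp
  have "\<bar>f z\<bar> \<le> \<bar>B\<bar>" for z using assms(2)[of z] by simp
  then show "AE z in gauss. norm (f z * g z) \<le> norm (B * g z)"
    by (auto simp: abs_mult intro!: mult_right_mono)
qed

lemma gauss_interval_pos:
  assumes "a < b"
  shows "0 < measure gauss {a..b}"
proof (rule ccontr)
  assume "\<not> 0 < measure gauss {a..b}"
  then have "measure gauss {a..b} = 0" using measure_nonneg[of gauss "{a..b}"] by linarith
  then have "emeasure gauss {a..b} = 0" by (simp add: gauss.emeasure_eq_measure)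
  then have "AE z in lborel. z \<notin> {a..b}"
    unfolding gauss_def using null_sets_density_iff[of "\<lambda>z. ennreal (std_normal_density z)" lborel "{a..b}"]
    by (auto simp: null_sets_def normal_density_pos less_imp_neq[THEN not_sym])
  then have "{a..b} \<in> null_sets lborel" by (simp add: AE_iff_null_sets)
  then show False using assms by (auto simp: null_sets_def)
qed

text \<open>A Chebyshev-type device: on the event \<open>z < - (\<zeta> * b)\<close> a weight is
  paid for by a polynomial in \<open>z\<close> at rate \<open>1 / (1 + b^2)\<close>. Exceptional
  events thus contribute at a rate whose mean over the signal tends to 0 with the noise.\<close>

lemma tail_weight:
  fixes z b \<zeta> w :: real
  assumes "0 < \<zeta>" "0 \<le> b" "z < - (\<zeta> * b)" "0 \<le> w"
  shows "w \<le> w * (1 + z\<^sup>2 / \<zeta>\<^sup>2) / (1 + b\<^sup>2)"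
proof -
  have "\<bar>\<zeta> * b\<bar> \<le> \<bar>z\<bar>" using assms by simp
  then have "(\<zeta> * b)\<^sup>2 \<le> z\<^sup>2" by (simp only: abs_le_square_iff)
  then have "b\<^sup>2 \<le> z\<^sup>2 / \<zeta>\<^sup>2" using assms by (simp add: field_simps power_mult_distrib)
  then have "w * (1 + b\<^sup>2) \<le> w * (1 + z\<^sup>2 / \<zeta>\<^sup>2)" using assms by (intro mult_left_mono) auto
  moreover have "0 < 1 + b\<^sup>2" by (simp add: add_pos_nonneg)
  ultimately show ?thesis by (simp add: pos_le_divide_eq)
qed

section \<open>Risk and shrinkage at a fixed ratio of signal to noise\<close>

context shrinkage
begin

lemma S_le_nuT: assumes "T < u" shows "S u \<le> \<nu> * T"
proof -
  obtain m where m: "m \<le> 0" "S u + m * (T - u) \<le> \<nu> * T" using S_subgradient[OF assms] by blast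
  have "m * (T - u) \<ge> 0" using m(1) assms by (simp add: mult_nonpos_nonpos)
  with m show ?thesis by linarith
qed

lemma nuT_less: "\<nu> * T < T" using nu1 T_pos by simp

lemma S_le: "0 \<le> u \<Longrightarrow> S u \<le> u"
  using S_small[of u] S_le_nuT[of u] nuT_less by (cases "u \<le> T") auto

lemma S_le_T: "0 \<le> u \<Longrightarrow> S u \<le> T"
  using S_small[of u] S_le_nuT[of u] nuT_less by (cases "u \<le> T") auto

lemma abs_S_abs: "\<bar>S u\<bar> = S \<bar>u\<bar>"
  using S_nonneg[of "\<bar>u\<bar>"] S_uminus[of u] by (cases "0 \<le> u") auto

lemma abs_S_le: "\<bar>S u\<bar> \<le> \<bar>u\<bar>"
  using S_le[of "\<bar>u\<bar>"] by (simp add: abs_S_abs)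

lemma abs_S_le_T: "\<bar>S u\<bar> \<le> T"
  using S_le_T[of "\<bar>u\<bar>"] by (simp add: abs_S_abs)

lemma S_small_abs: "\<bar>u\<bar> \<le> T \<Longrightarrow> S u = u"
  using S_small[of u] S_small[of "- u"] S_uminus[of u] by (cases "0 \<le> u") auto

lemma S_antimono: assumes "T < u" "u \<le> v" shows "S v \<le> S u"
proof -
  obtain m where m: "m \<le> 0" "\<forall>w>T. S v + m * (w - v) \<le> S w" using S_subgradient[of v] assms by auto
  have "m * (u - v) \<ge> 0" using m(1) assms by (simp add: mult_nonpos_nonpos)
  with m assms show ?thesis by fastforce
qed

lemma S_Lipschitz: assumes "T < u" "u \<le> v" shows "S u - S v \<le> \<nu> * (v - u)"
proof -
  obtain m where m: "- \<nu> \<le> m" "\<forall>w>T. S u + m * (w - u) \<le> S w" using S_subgradient[of u] assms by auto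
  have "- \<nu> * (v - u) \<le> m * (v - u)" using m(1) assms by (intro mult_right_mono) auto
  moreover have "S u + m * (v - u) \<le> S v" using m(2) assms by auto
  ultimately show ?thesis by (simp add: algebra_simps)
qed

lemma shrinkage_scale:
  assumes c: "0 < c"
  shows "shrinkage (\<lambda>u. S (c * u) / c) (T / c) \<nu>"
proof
  fix u assume "T / c < u"
  then have u: "T < c * u" using c by (simp add: field_simps)
  obtain m where m: "- \<nu> \<le> m" "m \<le> 0" "\<forall>v>T. S (c * u) + m * (v - c * u) \<le> S v"
    "S (c * u) + m * (T - c * u) \<le> \<nu> * T"
    using S_subgradient[OF u] by blast
  have "S (c * u) / c + m * (v - u) \<le> S (c * v) / c" if "T / c < v" for v
  proof -
    have "T < c * v" using c that by (simp add: field_simps)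
    then have "S (c * u) + m * (c * v - c * u) \<le> S (c * v)" using m by blast
    then have "(S (c * u) + m * (c * v - c * u)) / c \<le> S (c * v) / c" using c by (intro divide_right_mono) auto
    moreover have "(S (c * u) + m * (c * v - c * u)) / c = S (c * u) / c + m * (v - u)"
      using c by (simp add: field_simps)
    ultimately show ?thesis by simp
  qed
  moreover have "S (c * u) / c + m * (T / c - u) \<le> \<nu> * (T / c)"
  proof -
    have "(S (c * u) + m * (T - c * u)) / c \<le> \<nu> * T / c" using m(4) c by (intro divide_right_mono) auto
    moreover have "(S (c * u) + m * (T - c * u)) / c = S (c * u) / c + m * (T / c - u)"
      using c by (simp add: field_simps)
    ultimately show ?thesis by simp
  qed
  ultimately show "\<exists>m\<ge>- \<nu>. m \<le> 0 \<and> (\<forall>v>T / c. S (c * u) / c + m * (v - u) \<le> S (c * v) / c)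
      \<and> S (c * u) / c + m * (T / c - u) \<le> \<nu> * (T / c)"
    using m by blast
next
  have "filterlim (\<lambda>u. c * u) at_top at_top"
    using c by (intro filterlim_tendsto_pos_mult_at_top[OF tendsto_const] filterlim_ident)
  from tendsto_divide[OF filterlim_compose[OF S_tendsto this] tendsto_const[of c]] c
  show "((\<lambda>u. S (c * u) / c) \<longlongrightarrow> 0) at_top" by simp
qed (use c T_pos nu0 nu1 S_uminus S_small S_nonneg in \<open>auto simp: field_simps\<close>)

text \<open>The mean square error in units of the noise variance, for a signal \<open>b\<close> in
  units of the noise level.\<close>

definition noise_risk :: "real \<Rightarrow> real" where
  "noise_risk b = (\<integral>z. (z - S (b + z))\<^sup>2 \<partial>gauss)"

definition shrink_energy :: "real \<Rightarrow> real" where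
  "shrink_energy b = (\<integral>z. (S (b + z))\<^sup>2 \<partial>gauss)"

text \<open>The derivative at \<open>0\<close> of the expectation of noise times error along the same curve of
  noise levels and scales as in \<open>smooth\<close> below.\<close>

definition risk_slope :: "real \<Rightarrow> real \<Rightarrow> real" where
  "risk_slope a b = 1 - (\<integral>z. S (b + z) * ((1 + a) * (z ^ 3 - 2 * z) - a * z + a * b * (z\<^sup>2 - 1)) \<partial>gauss)"

lemma integrable_S_power [simp]: "integrable gauss (\<lambda>z. S (b + z) * z ^ n)"
  using abs_S_le_T by (intro integrable_gauss_bounded_mult) auto

lemma integrable_S_id [simp]: "integrable gauss (\<lambda>z. S (b + z) * z)"
  using integrable_S_power[of b 1] by simp

lemma integrable_S [simp]: "integrable gauss (\<lambda>z. S (b + z))"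
  using integrable_S_power[of b 0] by simp

lemma integrable_S_sq [simp]: "integrable gauss (\<lambda>z. (S (b + z))\<^sup>2)"
  using integrable_gauss_bounded_mult[of "\<lambda>z. S (b + z)" T "\<lambda>z. S (b + z)"] abs_S_le_T
  by (simp add: power2_eq_square)

lemma err_sq: "(z - S u)\<^sup>2 = z\<^sup>2 - 2 * (S u * z) + (S u)\<^sup>2"
  by (simp add: power2_eq_square algebra_simps)

lemma integrable_err_sq [simp]: "integrable gauss (\<lambda>z. (z - S (b + z))\<^sup>2)"
  unfolding err_sq by simp

lemma noise_risk_eq: "noise_risk b = 1 - 2 * (\<integral>z. S (b + z) * z \<partial>gauss) + shrink_energy b"
  unfolding noise_risk_def err_sq shrink_energy_def by simp

lemma noise_risk_nonneg: "0 \<le> noise_risk b" unfolding noise_risk_def by simp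

lemma shrink_energy_nonneg: "0 \<le> shrink_energy b" unfolding shrink_energy_def by simp

lemma noise_risk_uminus: "noise_risk (- b) = noise_risk b"
proof -
  have "noise_risk b = (\<integral>z. (- z - S (b + - z))\<^sup>2 \<partial>gauss)"
    unfolding noise_risk_def by (subst integral_gauss_uminus) auto
  also have "(\<lambda>z. (- z - S (b + - z))\<^sup>2) = (\<lambda>z. (z - S (- b + z))\<^sup>2)"
    using S_uminus[of "b - z" for z] by (auto simp: power2_eq_square algebra_simps)
  finally show ?thesis by (simp add: noise_risk_def)
qed

lemma shrink_energy_uminus: "shrink_energy (- b) = shrink_energy b"
proof -
  have "shrink_energy b = (\<integral>z. (S (b + - z))\<^sup>2 \<partial>gauss)"
    unfolding shrink_energy_def by (subst integral_gauss_uminus) auto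
  also have "(\<lambda>z. (S (b + - z))\<^sup>2) = (\<lambda>z. (S (- b + z))\<^sup>2)"
    using S_uminus[of "b - z" for z] by (auto simp: power2_eq_square)
  finally show ?thesis by (simp add: shrink_energy_def)
qed

lemma shrink_energy_le: "shrink_energy b \<le> b\<^sup>2 + 1"
proof -
  have "shrink_energy b \<le> (\<integral>z. b\<^sup>2 + 2 * b * z + z\<^sup>2 \<partial>gauss)"
    unfolding shrink_energy_def
  proof (rule integral_mono)
    fix z show "(S (b + z))\<^sup>2 \<le> b\<^sup>2 + 2 * b * z + z\<^sup>2"
      using abs_S_le[of "b + z"] unfolding abs_le_square_iff by (simp add: power2_eq_square algebra_simps)
  qed simp_all
  then show ?thesis by simp
qed

text \<open>For \<open>1 \<le> b\<close> and noise in \<open>[-1, 0]\<close> the observation lies in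
  \<open>[0, T]\<close> and is removed entirely, so the error is exactly \<open>- b\<close>. For
  \<open>b < 1\<close> the left side is not positive.\<close>

lemma noise_risk_below:
  assumes "0 \<le> b" "b \<le> T"
  shows "measure gauss {-1..0} * (b\<^sup>2 - 1) \<le> noise_risk b"
proof (cases "1 \<le> b")
  case True
  have "measure gauss {-1..0} * b\<^sup>2 = (\<integral>z. b\<^sup>2 * indicator {-1..0} z \<partial>gauss)" by simp
  also have "\<dots> \<le> noise_risk b" unfolding noise_risk_def
  proof (rule integral_mono)
    fix z show "b\<^sup>2 * indicator {-1..0} z \<le> (z - S (b + z))\<^sup>2"
    proof (cases "z \<in> {-1..0}")
      case z: True
      then have "S (b + z) = b + z" using True assms by (intro S_small) auto
      then show ?thesis using z by simp
    qed simp
  qed simp_all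
  finally show ?thesis by (simp add: algebra_simps) (use measure_nonneg[of gauss "{-1..0}"] in linarith)
next
  case False
  then have "measure gauss {-1..0} * (b\<^sup>2 - 1) \<le> 0"
    using assms by (intro mult_nonneg_nonpos) (auto simp: abs_square_le_1)
  then show ?thesis using noise_risk_nonneg[of b] by linarith
qed

text \<open>After expanding the square, only the correlation of \<open>S (b + z)\<close> with
  \<open>z\<close> has to be bounded above. Subtracting the centred term \<open>S b * z\<close>
  gives \<open>(S (b + z) - S b) * z\<close>. This is nonpositive as long as
  \<open>b + z \<ge> \<nu> * T\<close>: \<open>S\<close> is antitone above \<open>T\<close>, and
  between \<open>\<nu> * T\<close> and \<open>T\<close> it is the identity and so at least
  \<open>\<nu> * T \<ge> S b\<close>. The rest lies in the tail
  \<open>z < - ((1 - \<nu>) * b)\<close>.\<close>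

lemma noise_risk_above:
  assumes b: "T < b"
  shows "1 + shrink_energy b - 2 * (1 + 3 / (1 - \<nu>)\<^sup>2) / (1 + b\<^sup>2) \<le> noise_risk b"
proof -
  have z1: "0 < 1 - \<nu>" "0 < b" using nu1 b T_pos by auto
  have "(\<integral>z. S (b + z) * z \<partial>gauss) = (\<integral>z. S (b + z) * z - S b * z \<partial>gauss)" by simp
  also have "\<dots> \<le> (\<integral>z. (z\<^sup>2 + z ^ 4 / (1 - \<nu>)\<^sup>2) / (1 + b\<^sup>2) \<partial>gauss)"
  proof (rule integral_mono)
    fix z
    have pos: "0 \<le> (z\<^sup>2 + z ^ 4 / (1 - \<nu>)\<^sup>2) / (1 + b\<^sup>2)" by simp
    have zz: "S (b + z) * z - S b * z \<le> 0" if "0 \<le> z"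
      using S_antimono[of b "b + z"] b that by (simp add: mult_right_mono)
    have nn: "S (b + z) * z - S b * z \<le> 0" if "z < 0" "S b \<le> S (b + z)"
      using that by (simp add: mult_right_mono_neg)
    have Sb: "S b \<le> \<nu> * T" by (rule S_le_nuT[OF b])
    show "S (b + z) * z - S b * z \<le> (z\<^sup>2 + z ^ 4 / (1 - \<nu>)\<^sup>2) / (1 + b\<^sup>2)"
    proof (cases "0 \<le> z")
      case True then show ?thesis using zz pos by linarith
    next
      case neg: False
      consider "T < b + z" | "\<nu> * T \<le> b + z" "b + z \<le> T" | "b + z < \<nu> * T" by linarith
      then show ?thesis
      proof cases
        case 1
        then have "S b \<le> S (b + z)" using neg by (intro S_antimono) auto
        then show ?thesis using nn pos neg by linarith
      next
        case 2
        then have "S (b + z) = b + z" using nu0 T_pos by (intro S_small) (auto intro: order_trans[rotated])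
        then have "S b \<le> S (b + z)" using 2 Sb by linarith
        then show ?thesis using nn pos neg by linarith
      next
        case 3
        have "\<nu> * T \<le> \<nu> * b" using nu0 b by (intro mult_left_mono) auto
        then have zb: "z < - ((1 - \<nu>) * b)" using 3 by (simp add: algebra_simps)
        have "b + z \<le> S (b + z)"
        proof (cases "0 \<le> b + z")
          case True
          then show ?thesis using 3 nuT_less S_small[of "b + z"] by auto
        next
          case False
          then show ?thesis using abs_S_le[of "b + z"] by auto
        qed
        then have "S b - S (b + z) \<le> - z" using S_le[of b] z1 by linarith
        then have "(S b - S (b + z)) * (- z) \<le> (- z) * (- z)" using neg by (intro mult_right_mono) auto
        then have "S (b + z) * z - S b * z \<le> z\<^sup>2" by (simp add: power2_eq_square algebra_simps)
        also have "\<dots> \<le> z\<^sup>2 * (1 + z\<^sup>2 / (1 - \<nu>)\<^sup>2) / (1 + b\<^sup>2)"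
          using z1 zb by (intro tail_weight) auto
        also have "z\<^sup>2 * (1 + z\<^sup>2 / (1 - \<nu>)\<^sup>2) = z\<^sup>2 + z ^ 4 / (1 - \<nu>)\<^sup>2"
          by (simp add: power2_eq_square power4_eq_xxxx algebra_simps)
        finally show ?thesis .
      qed
    qed
  qed simp_all
  also have "\<dots> = (1 + 3 / (1 - \<nu>)\<^sup>2) / (1 + b\<^sup>2)" by simp
  finally have "2 * (\<integral>z. S (b + z) * z \<partial>gauss) \<le> 2 * ((1 + 3 / (1 - \<nu>)\<^sup>2) / (1 + b\<^sup>2))" by linarith
  then show ?thesis unfolding noise_risk_eq times_divide_eq_right by linarith
qed

text \<open>In the unit layer above the threshold the signal is controlled by the shrinkage energy:
  for \<open>6 \<le> b\<close> and \<open>z\<close> in \<open>[-3, -1]\<close> the observation falls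
  into \<open>[b / 2, T]\<close>, where \<open>S\<close> is the identity. For \<open>b < 6\<close>
  the constant is \<open>1332 = 36 * 37\<close>.\<close>

lemma shrink_energy_near:
  assumes b: "T < b" "b \<le> T + 1"
  shows "b\<^sup>2 \<le> 4 / measure gauss {-3..-1} * shrink_energy b + 1332 / (1 + b\<^sup>2)"
proof (cases "6 \<le> b")
  case True
  have "measure gauss {-3..-1} * (b / 2)\<^sup>2 = (\<integral>z. (b / 2)\<^sup>2 * indicator {-3..-1} z \<partial>gauss)" by simp
  also have "\<dots> \<le> shrink_energy b" unfolding shrink_energy_def
  proof (rule integral_mono)
    fix z show "(b / 2)\<^sup>2 * indicator {-3..-1} z \<le> (S (b + z))\<^sup>2"
    proof (cases "z \<in> {-3..-1}")
      case z: True
      then have "S (b + z) = b + z" using True b by (intro S_small) auto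
      moreover have "(b / 2)\<^sup>2 \<le> (b + z)\<^sup>2" using z True by (intro power_mono) auto
      ultimately show ?thesis using z by simp
    qed simp
  qed simp_all
  finally have "b\<^sup>2 \<le> 4 / measure gauss {-3..-1} * shrink_energy b"
    using gauss_interval_pos[of "-3" "-1"] by (simp add: field_simps power2_eq_square)
  moreover have "0 \<le> 1332 / (1 + b\<^sup>2)" by simp
  ultimately show ?thesis by linarith
next
  case False
  then have "b * b \<le> 6 * 6" using b T_pos by (intro mult_mono) auto
  then have "b\<^sup>2 \<le> 36" by (simp add: power2_eq_square)
  then have "b\<^sup>2 * (1 + b\<^sup>2) \<le> 36 * 37" by (intro mult_mono) auto
  then have "b\<^sup>2 \<le> 1332 / (1 + b\<^sup>2)" by (subst pos_le_divide_eq) (auto simp: add_pos_nonneg)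
  moreover have "0 \<le> 4 / measure gauss {-3..-1} * shrink_energy b" using shrink_energy_nonneg by simp
  ultimately show ?thesis by linarith
qed

end

text \<open>The two events are those of \<open>noise_risk_below\<close> and
  \<open>shrink_energy_near\<close>; the factor 8 leaves room to absorb the error terms in
  \<open>noise_risk_lower\<close>.\<close>

definition risk_const :: real where
  "risk_const = min (measure gauss {-1..0}) (measure gauss {-3..-1}) / 8"

lemma risk_const: "0 < risk_const" "8 * risk_const \<le> measure gauss {-1..0}"
  "8 * risk_const \<le> measure gauss {-3..-1}" "8 * risk_const \<le> 1"
  using gauss_interval_pos[of "-1" 0] gauss_interval_pos[of "-3" "-1"] gauss.prob_le_1[of "{-1..0}"]
  by (auto simp: risk_const_def min_def)

text \<open>With the Gaussian density \<phi>, the product \<open>(z ^ 3 - 2 * z)\<close> times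
  \<phi> is minus the derivative of \<open>z^2\<close> times \<phi>; it arises from changing the
  scale of the noise. The term \<open>- a * z\<close> comes from the prefactor of
  \<open>smooth\<close>.\<close>

definition slope_weight :: "real \<Rightarrow> real \<Rightarrow> real" where
  "slope_weight a z = (1 + a) * (z ^ 3 - 2 * z) - a * z"

lemma slope_weight_eq: "slope_weight a z = (1 + a) * z ^ 3 - (2 + 3 * a) * z"
  by (simp add: slope_weight_def algebra_simps)

lemma measurable_slope_weight [measurable]: "slope_weight a \<in> borel_measurable borel"
  unfolding slope_weight_eq[abs_def] by measurable

lemma slope_sq: "(slope_weight a z)\<^sup>2 = (1 + a)\<^sup>2 * z ^ 6 - 2 * (1 + a) * (2 + 3 * a) * z ^ 4 + (2 + 3 * a)\<^sup>2 * z\<^sup>2"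
  by (simp add: slope_weight_eq power2_eq_square algebra_simps flip: power_Suc power_Suc2 power_add)

lemma integrable_slope_sq [simp]: "integrable gauss (\<lambda>z. (slope_weight a z)\<^sup>2)"
  unfolding slope_sq by simp

lemma amgm:
  fixes x y \<eta> :: real
  assumes "0 < \<eta>"
  shows "x * y \<le> \<eta> * y\<^sup>2 + x\<^sup>2 / (4 * \<eta>)"
proof -
  have "0 \<le> (2 * \<eta> * y - x)\<^sup>2" by simp
  then have "4 * \<eta> * (x * y) \<le> 4 * \<eta> * (\<eta> * y\<^sup>2) + x\<^sup>2" by (simp add: power2_eq_square algebra_simps)
  then show ?thesis using assms by (simp add: field_simps)
qed

context shrinkage
begin

text \<open>Up to constants a lower bound for the excess of the risk over \<open>1\<close>, hence small in mean at the
  optimal scale.\<close>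

definition defect :: "real \<Rightarrow> real" where
  "defect b = shrink_energy b + b\<^sup>2 * indicator {- (T + 1)..T + 1} b"

lemma defect_nonneg: "0 \<le> defect b"
  unfolding defect_def using shrink_energy_nonneg by simp

text \<open>Below the threshold the lost signal pays for the defect, in the layer above it the
  shrinkage energy does, and further out the defect is that energy. The negative term decays in
  \<open>b\<close>, so it disappears on average when a nonzero signal is measured in ever smaller
  noise units. The constants involve \<open>\<nu>\<close> only.\<close>

lemma noise_risk_lower:
  "1 + risk_const * defect b - (1 / risk_const + 1332 + 2 * (1 + 3 / (1 - \<nu>)\<^sup>2)) / (1 + b\<^sup>2) \<le> noise_risk b"
proof -
  let ?k = risk_const and ?K = "2 * (1 + 3 / (1 - \<nu>)\<^sup>2)"
  let ?C = "1 / risk_const + 1332 + ?K"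
  note rc = risk_const
  have K0: "0 \<le> ?K" by simp
  have main: "1 + ?k * defect b - ?C / (1 + b\<^sup>2) \<le> noise_risk b" if b0: "0 \<le> b" for b
  proof -
    have t: "0 < 1 + b\<^sup>2" by (simp add: add_pos_nonneg)
    have split: "?C / (1 + b\<^sup>2) = 1 / risk_const / (1 + b\<^sup>2) + 1332 / (1 + b\<^sup>2) + ?K / (1 + b\<^sup>2)"
      by (simp add: add_divide_distrib)
    have nn: "0 \<le> 1 / risk_const / (1 + b\<^sup>2)" "0 \<le> 1332 / (1 + b\<^sup>2)" "0 \<le> ?K / (1 + b\<^sup>2)"
      using rc K0 t by (auto intro!: divide_nonneg_pos)
    consider "b \<le> T" | "T < b" "b \<le> T + 1" | "T + 1 < b" by linarith
    then show ?thesis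
    proof cases
      case 1
      have "defect b \<le> 2 * b\<^sup>2 + 1" using shrink_energy_le[of b] 1 b0 T_pos by (simp add: defect_def)
      then have d: "?k * defect b \<le> ?k * (2 * b\<^sup>2 + 1)" using rc by (intro mult_left_mono) auto
      have n: "8 * ?k * b\<^sup>2 - 1 \<le> noise_risk b"
      proof -
        have "measure gauss {-1..0} * (b\<^sup>2 - 1) = measure gauss {-1..0} * b\<^sup>2 - measure gauss {-1..0}"
          by (simp add: algebra_simps)
        moreover have "8 * ?k * b\<^sup>2 \<le> measure gauss {-1..0} * b\<^sup>2" using rc by (intro mult_right_mono) auto
        ultimately show ?thesis using noise_risk_below[OF b0 1] gauss.prob_le_1[of "{-1..0}"] by linarith
      qed
      \<comment> \<open>For small \<open>b\<close> the bound \<open>8 * ?k * b^2 - 1\<close> is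
        below 1. The difference is covered by \<open>1 / x\<close>, through the arithmetic-geometric
        inequality \<open>4 \<le> 4 * x + 1 / x\<close>.\<close>
      define x where "x = ?k * (1 + b\<^sup>2)"
      have x: "0 < x" using rc t by (simp add: x_def)
      have "0 \<le> (2 * x - 1)\<^sup>2" by simp
      then have "4 * x \<le> 4 * x * x + 1" by (simp add: power2_eq_square algebra_simps)
      then have "4 \<le> 4 * x + 1 / x" using x by (simp add: field_simps)
      moreover have "1 / x = 1 / ?k / (1 + b\<^sup>2)" by (simp add: x_def)
      moreover have "x = ?k + ?k * b\<^sup>2" by (simp add: x_def algebra_simps)
      moreover have "?k * (2 * b\<^sup>2 + 1) = 2 * (?k * b\<^sup>2) + ?k" by (simp add: algebra_simps)
      moreover have "0 \<le> ?k * b\<^sup>2" using rc by simp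
      ultimately have "1 + ?k * (2 * b\<^sup>2 + 1) - 1 / ?k / (1 + b\<^sup>2) \<le> 8 * ?k * b\<^sup>2 - 1"
        using rc by linarith
      with d n nn split show ?thesis by linarith
    next
      case 2
      let ?m = "measure gauss {-3..-1}"
      have m: "0 < ?m" by (rule gauss_interval_pos) simp
      have "?k * b\<^sup>2 \<le> ?k * (4 / ?m * shrink_energy b + 1332 / (1 + b\<^sup>2))"
        using shrink_energy_near[OF 2] rc by (intro mult_left_mono) auto
      also have "\<dots> = (4 * ?k / ?m) * shrink_energy b + ?k * (1332 / (1 + b\<^sup>2))"
        by (simp add: algebra_simps)
      also have "\<dots> \<le> 1 / 2 * shrink_energy b + 1 * (1332 / (1 + b\<^sup>2))"
        using rc m shrink_energy_nonneg by (intro add_mono mult_right_mono) (auto simp: field_simps)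
      finally have "?k * b\<^sup>2 \<le> 1 / 2 * shrink_energy b + 1332 / (1 + b\<^sup>2)" by simp
      moreover have "?k * shrink_energy b \<le> 1 / 2 * shrink_energy b"
        using rc shrink_energy_nonneg by (intro mult_right_mono) auto
      moreover have "?k * defect b = ?k * shrink_energy b + ?k * b\<^sup>2"
        using 2 b0 T_pos by (simp add: defect_def algebra_simps)
      ultimately show ?thesis using noise_risk_above[OF 2(1)] nn split by linarith
    next
      case 3
      then have "?k * defect b = ?k * shrink_energy b" by (simp add: defect_def)
      moreover have "?k * shrink_energy b \<le> 1 * shrink_energy b"
        using rc shrink_energy_nonneg by (intro mult_right_mono) auto
      ultimately show ?thesis using noise_risk_above[of b] 3 nn split by linarith
    qed
  qed
  have "defect (- b) = defect b"
    using T_pos by (auto simp: defect_def shrink_energy_uminus indicator_def)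
  then show ?thesis using main[of b] main[of "- b"] by (cases "0 \<le> b") (auto simp: noise_risk_uminus)
qed

text \<open>By convexity, \<open>S\<close> minus its chord over \<open>b \<plusminus> 1\<close> has the sign of \<open>z\<^sup>2 - 1\<close> above the threshold,
  and subtracting a chord does not change the Gaussian integral against \<open>z\<^sup>2 - 1\<close>. Below the
  threshold \<open>S u = u\<close> still exceeds the extended chord, except far in the Gaussian tail.\<close>

lemma chord_bound:
  assumes b: "T + 1 < b" and \<zeta>: "\<zeta> = (1 - \<nu>) / (1 + \<nu>)"
  defines "d \<equiv> (S (b + 1) - S (b - 1)) / 2" and "e \<equiv> (S (b + 1) + S (b - 1)) / 2"
  shows "- ((4 / \<zeta> + 2) / \<zeta> * ((z ^ 4 + z ^ 6 / \<zeta>\<^sup>2) / (1 + b\<^sup>2)))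
    \<le> b * ((S (b + z) - (e + d * z)) * (z\<^sup>2 - 1))" (is "- ?R \<le> _")
proof -
  have b0: "0 < b" and \<zeta>0: "0 < \<zeta>" using b T_pos nu0 nu1 by (auto simp: \<zeta>)
  have R: "0 \<le> ?R" using \<zeta>0 by (intro mult_nonneg_nonneg divide_nonneg_nonneg add_nonneg_nonneg) auto
  have active: "0 \<le> (S (b + z) - (e + d * z)) * (z\<^sup>2 - 1)" if active: "T < b + z"
  proof -
    consider "z < -1" | "\<bar>z\<bar> \<le> 1" | "1 < z" by linarith
    then show ?thesis
    proof cases
      case 1
      obtain m where m: "\<forall>v>T. S (b - 1) + m * (v - (b - 1)) \<le> S v"
        using S_subgradient[of "b - 1"] b by auto
      have "S (b - 1) + m * 2 \<le> S (b + 1)" using m[rule_format, of "b + 1"] b by simp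
      then have "m \<le> d" by (simp add: d_def)
      then have "d * (z + 1) \<le> m * (z + 1)" using 1 by (intro mult_right_mono_neg) auto
      moreover have "S (b - 1) + m * (z + 1) \<le> S (b + z)" using m that by fastforce
      moreover have "e + d * z = S (b - 1) + d * (z + 1)" by (simp add: e_def d_def field_simps)
      ultimately have "0 \<le> S (b + z) - (e + d * z)" by linarith
      moreover have "0 \<le> z\<^sup>2 - 1" using 1 abs_le_square_iff[of 1 z] by simp
      ultimately show ?thesis by (rule mult_nonneg_nonneg)
    next
      case 2
      obtain m where m: "\<forall>v>T. S (b + z) + m * (v - (b + z)) \<le> S v"
        using S_subgradient[OF active] by auto
      have 1: "S (b + z) + m * (1 - z) \<le> S (b + 1)" using m[rule_format, of "b + 1"] b by simp
      have 2: "S (b + z) + m * (- 1 - z) \<le> S (b - 1)" using m[rule_format, of "b - 1"] b by (simp add: algebra_simps)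
      have "(1 + z) / 2 * (S (b + z) + m * (1 - z)) + (1 - z) / 2 * (S (b + z) + m * (- 1 - z))
          \<le> (1 + z) / 2 * S (b + 1) + (1 - z) / 2 * S (b - 1)"
        using 1 2 \<open>\<bar>z\<bar> \<le> 1\<close> by (intro add_mono mult_left_mono) auto
      moreover have "(1 + z) / 2 * (S (b + z) + m * (1 - z)) + (1 - z) / 2 * (S (b + z) + m * (- 1 - z)) = S (b + z)"
        by (simp add: field_simps)
      moreover have "(1 + z) / 2 * S (b + 1) + (1 - z) / 2 * S (b - 1) = e + d * z"
        by (simp add: e_def d_def field_simps)
      ultimately have "S (b + z) - (e + d * z) \<le> 0" by linarith
      moreover have "z\<^sup>2 - 1 \<le> 0" using \<open>\<bar>z\<bar> \<le> 1\<close> by (simp add: abs_square_le_1)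
      ultimately show ?thesis by (rule mult_nonpos_nonpos)
    next
      case 3
      obtain m where m: "\<forall>v>T. S (b + 1) + m * (v - (b + 1)) \<le> S v"
        using S_subgradient[of "b + 1"] b by auto
      have "S (b + 1) + m * (- 2) \<le> S (b - 1)" using m[rule_format, of "b - 1"] b by simp
      then have "d \<le> m" by (simp add: d_def)
      then have "d * (z - 1) \<le> m * (z - 1)" using 3 by (intro mult_right_mono) auto
      moreover have "S (b + 1) + m * (z - 1) \<le> S (b + z)" using m[rule_format, of "b + z"] that by (simp add: algebra_simps)
      moreover have "e + d * z = S (b + 1) + d * (z - 1)" by (simp add: e_def d_def field_simps)
      ultimately have "0 \<le> S (b + z) - (e + d * z)" by linarith
      moreover have "0 \<le> z\<^sup>2 - 1" using 3 abs_le_square_iff[of 1 z] by simp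
      ultimately show ?thesis by (rule mult_nonneg_nonneg)
    qed
  qed
  show ?thesis
  proof (cases "T < b + z")
    case True
    have "0 \<le> b * ((S (b + z) - (e + d * z)) * (z\<^sup>2 - 1))"
      using active[OF True] b0 less_imp_le by (metis mult_nonneg_nonneg)
    then show ?thesis using R by linarith
  next
    case False
    then have u: "b + z \<le> T" and z: "z < -1" using b by auto
    have z2: "0 \<le> z\<^sup>2 - 1" using z abs_le_square_iff[of 1 z] by simp
    obtain m where m: "- \<nu> \<le> m" "\<forall>v>T. S (b - 1) + m * (v - (b - 1)) \<le> S v"
      "S (b - 1) + m * (T - (b - 1)) \<le> \<nu> * T"
      using S_subgradient[of "b - 1"] b by auto
    have "S (b - 1) + m * 2 \<le> S (b + 1)" using m(2)[rule_format, of "b + 1"] b by simp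
    then have "m \<le> d" by (simp add: d_def)
    then have "d * (z + 1) \<le> m * (z + 1)" using z by (intro mult_right_mono_neg) auto
    moreover have "e + d * z = S (b - 1) + d * (z + 1)" by (simp add: e_def d_def field_simps)
    moreover have "m * (z + 1) = m * (T - (b - 1)) + m * (b + z - T)" by (simp add: algebra_simps)
    moreover have "m * (b + z - T) \<le> (- \<nu>) * (b + z - T)"
      using m(1) u by (intro mult_right_mono_neg) auto
    ultimately have line: "e + d * z \<le> \<nu> * T + \<nu> * (T - (b + z))"
      using m(3) by (simp add: algebra_simps)
    \<comment> \<open>The worst extended chord \<open>\<nu> * T + \<nu> * (T - u)\<close> meets the
      identity at \<open>u = 2 * \<nu> / (1 + \<nu>) * T = (1 - \<zeta>) * T\<close>, which is the
      origin of \<open>\<zeta>\<close>. Above this point the sign is right; below it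
      \<open>z\<close> is in the tail.\<close>
    show ?thesis
    proof (cases "(1 - \<zeta>) * T \<le> b + z")
      case True
      have "2 * \<nu> * T \<le> (1 + \<nu>) * (b + z)"
      proof -
        have "(1 + \<nu>) * ((1 - \<zeta>) * T) \<le> (1 + \<nu>) * (b + z)" using True nu0 by (intro mult_left_mono) auto
        moreover have "(1 + \<nu>) * ((1 - \<zeta>) * T) = 2 * \<nu> * T" using nu0 by (simp add: \<zeta> field_simps)
        ultimately show ?thesis by simp
      qed
      moreover have "0 \<le> (1 - \<zeta>) * T" using nu0 T_pos by (intro mult_nonneg_nonneg) (auto simp: \<zeta> field_simps)
      then have "S (b + z) = b + z" using u True by (intro S_small) auto
      ultimately have "0 \<le> S (b + z) - (e + d * z)" using line by (simp add: algebra_simps)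
      then have "0 \<le> b * ((S (b + z) - (e + d * z)) * (z\<^sup>2 - 1))"
        using z2 b0 by (intro mult_nonneg_nonneg) auto
      then show ?thesis using R by linarith
    next
      case False
      have "(1 - \<zeta>) * T \<le> (1 - \<zeta>) * b" using b nu0 by (intro mult_left_mono) (auto simp: \<zeta> field_simps)
      then have zb: "z < - (\<zeta> * b)" using False by (simp add: algebra_simps)
      then have bz: "b \<le> - z / \<zeta>" using \<zeta>0 by (simp add: field_simps)
      have "\<nu> * T + \<nu> * (T - (b + z)) \<le> 1 * T + 1 * (T - (b + z))"
        using nu1 T_pos u by (intro add_mono mult_right_mono) auto
      with line have "e + d * z \<le> 1 * T + 1 * (T - (b + z))" by (rule order_trans)
      moreover have "- S (b + z) \<le> b - z"
        using abs_S_le[of "b + z"] abs_ge_minus_self[of "S (b + z)"] b0 z by linarith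
      ultimately have "- (4 * b - 2 * z) \<le> S (b + z) - (e + d * z)"
        using b b0 by simp
      moreover have "4 * b - 2 * z \<le> (4 / \<zeta> + 2) * (- z)" using bz by (simp add: algebra_simps)
      ultimately have low: "- ((4 / \<zeta> + 2) * (- z)) \<le> S (b + z) - (e + d * z)" by linarith
      define W where "W = (4 / \<zeta> + 2) * (- z)"
      define D where "D = S (b + z) - (e + d * z)"
      have W0: "0 \<le> W" unfolding W_def using z \<zeta>0 by (intro mult_nonneg_nonneg) auto
      have "(- W) * (z\<^sup>2 - 1) \<le> D * (z\<^sup>2 - 1)"
        using low z2 unfolding W_def[symmetric] D_def[symmetric] by (intro mult_right_mono) auto
      then have "- (W * z\<^sup>2) \<le> D * (z\<^sup>2 - 1)" using W0 by (simp add: algebra_simps)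
      then have low': "b * - (W * z\<^sup>2) \<le> b * (D * (z\<^sup>2 - 1))" using b0 by (intro mult_left_mono) auto
      have "b * (W * z\<^sup>2) \<le> (- z / \<zeta>) * (W * z\<^sup>2)"
        using bz W0 by (intro mult_right_mono mult_nonneg_nonneg) auto
      also have "(- z / \<zeta>) * (W * z\<^sup>2) = (4 / \<zeta> + 2) / \<zeta> * z ^ 4"
        by (simp add: W_def power2_eq_square power4_eq_xxxx)
      also have "\<dots> \<le> (4 / \<zeta> + 2) / \<zeta> * (z ^ 4 * (1 + z\<^sup>2 / \<zeta>\<^sup>2) / (1 + b\<^sup>2))"
        using \<zeta>0 zb b0 by (intro mult_left_mono tail_weight) auto
      also have "z ^ 4 * (1 + z\<^sup>2 / \<zeta>\<^sup>2) = z ^ 4 + z ^ 6 / \<zeta>\<^sup>2"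
        by (simp add: distrib_left flip: power_add)
      finally have "- ?R \<le> - (b * (W * z\<^sup>2))" by (rule le_imp_neg_le)
      also have "\<dots> = b * - (W * z\<^sup>2)" by simp
      also note low'
      finally show ?thesis unfolding D_def .
    qed
  qed
qed

text \<open>The coefficient in \<open>chord_bound\<close> times the Gaussian mean of
  \<open>z ^ 4 + z ^ 6 / \<zeta>^2\<close>, the two moments being 3 and 15.\<close>

definition curvature_const :: real where
  "curvature_const = (let \<zeta> = (1 - \<nu>) / (1 + \<nu>) in (4 / \<zeta> + 2) / \<zeta> * (3 + 15 / \<zeta>\<^sup>2))"

lemma curvature_const_nonneg: "0 \<le> curvature_const"
  using nu0 nu1 by (simp add: curvature_const_def Let_def)

lemma curvature_far:
  assumes b: "T + 1 < b"
  shows "- (b * (\<integral>z. S (b + z) * (z\<^sup>2 - 1) \<partial>gauss)) \<le> curvature_const / (1 + b\<^sup>2)"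
proof -
  define \<zeta> where "\<zeta> = (1 - \<nu>) / (1 + \<nu>)"
  define d where "d = (S (b + 1) - S (b - 1)) / 2"
  define e where "e = (S (b + 1) + S (b - 1)) / 2"
  let ?f = "\<lambda>z. b * (S (b + z) * z\<^sup>2 - S (b + z) - e * z\<^sup>2 + e - d * z ^ 3 + d * z)"
  let ?g = "\<lambda>z. - ((4 / \<zeta> + 2) / \<zeta> * ((z ^ 4 + z ^ 6 / \<zeta>\<^sup>2) / (1 + b\<^sup>2)))"
  have "(\<integral>z. ?g z \<partial>gauss) \<le> (\<integral>z. ?f z \<partial>gauss)"
  proof (rule integral_mono)
    fix z
    have "?f z = b * ((S (b + z) - (e + d * z)) * (z\<^sup>2 - 1))"
      by (simp add: power2_eq_square power3_eq_cube algebra_simps)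
    then show "?g z \<le> ?f z" using chord_bound[OF b \<zeta>_def, of z] unfolding d_def[symmetric] e_def[symmetric] by linarith
  qed simp_all
  moreover have "(\<integral>z. ?f z \<partial>gauss) = b * (\<integral>z. S (b + z) * (z\<^sup>2 - 1) \<partial>gauss)"
    by (simp add: right_diff_distrib)
  moreover have "(\<integral>z. ?g z \<partial>gauss) = - (curvature_const / (1 + b\<^sup>2))"
    by (simp add: curvature_const_def Let_def \<zeta>_def)
  ultimately show ?thesis by linarith
qed

section \<open>Upper bounds for the slope of the noise-error correlation\<close>

lemma integrable_S_slope [simp]: "integrable gauss (\<lambda>z. S (b + z) * slope_weight a z)"
proof -
  have "(\<lambda>z. S (b + z) * slope_weight a z) = (\<lambda>z. (1 + a) * (S (b + z) * z ^ 3) - (2 + 3 * a) * (S (b + z) * z))"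
    by (simp add: slope_weight_eq algebra_simps)
  then show ?thesis by simp
qed

lemma integrable_S_curv [simp]: "integrable gauss (\<lambda>z. S (b + z) * (z\<^sup>2 - 1))"
  by (simp add: right_diff_distrib)

lemma risk_slope_eq:
  "risk_slope a b = 1 - (\<integral>z. S (b + z) * slope_weight a z \<partial>gauss)
     - a * (b * (\<integral>z. S (b + z) * (z\<^sup>2 - 1) \<partial>gauss))"
proof -
  have "(\<lambda>z. S (b + z) * ((1 + a) * (z ^ 3 - 2 * z) - a * z + a * b * (z\<^sup>2 - 1)))
      = (\<lambda>z. S (b + z) * slope_weight a z + a * b * (S (b + z) * (z\<^sup>2 - 1)))"
    by (simp add: slope_weight_def algebra_simps)
  then show ?thesis unfolding risk_slope_def by simp
qed

text \<open>The term with \<open>slope_weight\<close> is traded against the shrinkage energy by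
  Young's inequality. The curvature term carries a factor \<open>b\<close>, which the energy alone
  does not control. For \<open>\<bar>b\<bar> \<le> T + 1\<close> the part \<open>b^2\<close> of
  \<open>defect\<close> pays for it (\<open>z^2 - 1\<close> has mean square 2); beyond that its sign
  is used.\<close>

lemma risk_slope_upper:
  assumes "0 < \<eta>" "0 \<le> a"
  shows "risk_slope a b \<le> 1 + \<eta> * (\<integral>z. (slope_weight a z)\<^sup>2 \<partial>gauss) + (1 / (4 * \<eta>) + a) * defect b
    + a * curvature_const / (1 + b\<^sup>2)"
proof -
  have "- (\<integral>z. S (b + z) * slope_weight a z \<partial>gauss) = (\<integral>z. - (S (b + z) * slope_weight a z) \<partial>gauss)" by simp
  also have "\<dots> \<le> (\<integral>z. \<eta> * (slope_weight a z)\<^sup>2 + (S (b + z))\<^sup>2 / (4 * \<eta>) \<partial>gauss)"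
    using amgm[OF assms(1), of "- S (b + z)" "slope_weight a z" for z] by (intro integral_mono) auto
  also have "\<dots> = \<eta> * (\<integral>z. (slope_weight a z)\<^sup>2 \<partial>gauss) + shrink_energy b / (4 * \<eta>)"
    by (simp add: shrink_energy_def)
  finally have 1: "- (\<integral>z. S (b + z) * slope_weight a z \<partial>gauss)
      \<le> \<eta> * (\<integral>z. (slope_weight a z)\<^sup>2 \<partial>gauss) + shrink_energy b / (4 * \<eta>)" .
  have ed: "shrink_energy b \<le> defect b" by (simp add: defect_def)
  then have 2: "shrink_energy b / (4 * \<eta>) \<le> 1 / (4 * \<eta>) * defect b"
    using assms by (simp add: divide_right_mono)
  have cn: "0 \<le> curvature_const / (1 + b\<^sup>2)" using curvature_const_nonneg by (simp add: divide_nonneg_nonneg)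
  have 3: "- (b * (\<integral>z. S (b + z) * (z\<^sup>2 - 1) \<partial>gauss)) \<le> defect b + curvature_const / (1 + b\<^sup>2)"
  proof -
    consider "\<bar>b\<bar> \<le> T + 1" | "T + 1 < b" | "T + 1 < - b" by linarith
    then show ?thesis
    proof cases
      case 1
      have "- (b * (\<integral>z. S (b + z) * (z\<^sup>2 - 1) \<partial>gauss)) = (\<integral>z. - (b * (S (b + z) * (z\<^sup>2 - 1))) \<partial>gauss)" by simp
      also have "\<dots> \<le> (\<integral>z. b\<^sup>2 / 2 * z ^ 4 - b\<^sup>2 * z\<^sup>2 + b\<^sup>2 / 2 + (S (b + z))\<^sup>2 / 2 \<partial>gauss)"
      proof (rule integral_mono)
        fix z
        have "0 \<le> (b * (z\<^sup>2 - 1) + S (b + z))\<^sup>2" by simp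
        then show "- (b * (S (b + z) * (z\<^sup>2 - 1))) \<le> b\<^sup>2 / 2 * z ^ 4 - b\<^sup>2 * z\<^sup>2 + b\<^sup>2 / 2 + (S (b + z))\<^sup>2 / 2"
          by (simp add: power2_eq_square power4_eq_xxxx algebra_simps)
      qed simp_all
      also have "\<dots> = b\<^sup>2 + shrink_energy b / 2" by (simp add: shrink_energy_def)
      also have "\<dots> \<le> defect b" using 1 shrink_energy_nonneg[of b] by (simp add: defect_def abs_le_iff)
      finally show ?thesis using cn by linarith
    next
      case 2
      then show ?thesis using curvature_far[OF 2] defect_nonneg[of b] by linarith
    next
      case 3
      have "(\<integral>z. S (b + z) * (z\<^sup>2 - 1) \<partial>gauss) = (\<integral>z. S (b + - z) * ((- z)\<^sup>2 - 1) \<partial>gauss)"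
        by (subst integral_gauss_uminus) auto
      also have "\<dots> = (\<integral>z. - (S (- b + z) * (z\<^sup>2 - 1)) \<partial>gauss)"
        using S_uminus[of "- b + z" for z] by (intro Bochner_Integration.integral_cong) (auto simp: algebra_simps)
      finally have "- (b * (\<integral>z. S (b + z) * (z\<^sup>2 - 1) \<partial>gauss)) = - (- b * (\<integral>z. S (- b + z) * (z\<^sup>2 - 1) \<partial>gauss))"
        by simp
      then show ?thesis using curvature_far[OF 3] defect_nonneg[of b] by simp
    qed
  qed
  have "a * - (b * (\<integral>z. S (b + z) * (z\<^sup>2 - 1) \<partial>gauss)) \<le> a * (defect b + curvature_const / (1 + b\<^sup>2))"
    using 3 assms by (intro mult_left_mono) auto
  then have "- (a * (b * (\<integral>z. S (b + z) * (z\<^sup>2 - 1) \<partial>gauss))) \<le> a * defect b + a * curvature_const / (1 + b\<^sup>2)"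
    by (simp add: distrib_left)
  moreover have "(1 / (4 * \<eta>) + a) * defect b = 1 / (4 * \<eta>) * defect b + a * defect b"
    by (rule distrib_right)
  ultimately show ?thesis unfolding risk_slope_eq using 1 2 by linarith
qed

text \<open>At signal 0 the leading 1 has to cancel. Since \<open>z * slope_weight a z\<close> has
  mean \<open>3 * (1 + a) - (2 + 3 * a) = 1\<close>, the slope is the correlation of the error
  \<open>z - S z\<close> with the weight, which is small together with the risk at 0.\<close>

lemma risk_slope_zero_upper:
  assumes "0 < \<eta>"
  shows "risk_slope a 0 \<le> \<eta> * (\<integral>z. (slope_weight a z)\<^sup>2 \<partial>gauss) + noise_risk 0 / (4 * \<eta>)"
proof -
  have sw: "z * slope_weight a z = (1 + a) * z ^ 4 - (2 + 3 * a) * z\<^sup>2" for z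
    by (simp add: slope_weight_eq power2_eq_square power3_eq_cube power4_eq_xxxx algebra_simps)
  have i: "integrable gauss (\<lambda>z. z * slope_weight a z)" unfolding sw by simp
  have i2: "integrable gauss (\<lambda>z. S z * slope_weight a z)" using integrable_S_slope[of 0 a] by simp
  have "(\<integral>z. z * slope_weight a z \<partial>gauss) = 1" unfolding sw by (simp add: algebra_simps)
  then have "risk_slope a 0 = (\<integral>z. (z - S z) * slope_weight a z \<partial>gauss)"
    unfolding risk_slope_eq left_diff_distrib using i i2 by simp
  also have "\<dots> \<le> (\<integral>z. \<eta> * (slope_weight a z)\<^sup>2 + (z - S z)\<^sup>2 / (4 * \<eta>) \<partial>gauss)"
    using integrable_err_sq[of 0] i i2
    by (intro integral_mono amgm[OF assms]) (simp_all add: left_diff_distrib)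
  also have "\<dots> = \<eta> * (\<integral>z. (slope_weight a z)\<^sup>2 \<partial>gauss) + noise_risk 0 / (4 * \<eta>)"
    using integrable_err_sq[of 0] by (simp add: noise_risk_def)
  finally show ?thesis .
qed

end

section \<open>Differentiating Gaussian averages of discontinuous functions\<close>

text \<open>Dominated convergence for the difference quotients; the mean value inequality makes
  \<open>D\<close> dominate them.\<close>

lemma has_real_derivative_integral:
  fixes f f' :: "real \<Rightarrow> 'a \<Rightarrow> real"
  assumes \<theta>: "\<theta> \<in> {l<..<u}"
    and int: "\<And>t. t \<in> {l<..<u} \<Longrightarrow> integrable M (f t)"
    and meas: "f' \<theta> \<in> borel_measurable M"
    and deriv: "\<And>t x. t \<in> {l<..<u} \<Longrightarrow> x \<in> space M \<Longrightarrow> ((\<lambda>t. f t x) has_real_derivative f' t x) (at t)"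
    and bound: "\<And>t x. t \<in> {l<..<u} \<Longrightarrow> x \<in> space M \<Longrightarrow> \<bar>f' t x\<bar> \<le> D x"
    and D: "integrable M D"
  shows "((\<lambda>t. \<integral>x. f t x \<partial>M) has_real_derivative (\<integral>x. f' \<theta> x \<partial>M)) (at \<theta>)"
proof -
  have "((\<lambda>t. ((\<integral>x. f t x \<partial>M) - (\<integral>x. f \<theta> x \<partial>M)) / (t - \<theta>)) \<longlongrightarrow> (\<integral>x. f' \<theta> x \<partial>M)) (at \<theta> within {l<..<u})"
    unfolding tendsto_at_iff_sequentially comp_def
  proof (intro allI impI)
    fix X :: "nat \<Rightarrow> real" assume X: "\<forall>i. X i \<in> {l<..<u} - {\<theta>}" and lim: "X \<longlonglongrightarrow> \<theta>"
    have "(\<lambda>i. \<integral>x. (f (X i) x - f \<theta> x) / (X i - \<theta>) \<partial>M) \<longlonglongrightarrow> (\<integral>x. f' \<theta> x \<partial>M)"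
    proof (rule integral_dominated_convergence[where w=D])
      show "(\<lambda>x. (f (X i) x - f \<theta> x) / (X i - \<theta>)) \<in> borel_measurable M" for i
        using int[of "X i"] int[OF \<theta>] X by (auto intro!: borel_measurable_divide borel_measurable_diff)
      show "AE x in M. (\<lambda>i. (f (X i) x - f \<theta> x) / (X i - \<theta>)) \<longlonglongrightarrow> f' \<theta> x"
      proof (rule AE_I2)
        fix x assume x: "x \<in> space M"
        have "((\<lambda>t. (f t x - f \<theta> x) / (t - \<theta>)) \<longlongrightarrow> f' \<theta> x) (at \<theta>)"
          using deriv[OF \<theta> x] by (simp add: has_field_derivative_iff)
        then show "(\<lambda>i. (f (X i) x - f \<theta> x) / (X i - \<theta>)) \<longlonglongrightarrow> f' \<theta> x"
          using X lim unfolding tendsto_at_iff_sequentially comp_def by blast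
      qed
      show "AE x in M. norm ((f (X i) x - f \<theta> x) / (X i - \<theta>)) \<le> D x" for i
      proof (rule AE_I2)
        fix x assume x: "x \<in> space M"
        have "norm (f (X i) x - f \<theta> x) \<le> D x * norm (X i - \<theta>)"
        proof (rule field_differentiable_bound[where S="{l<..<u}" and f'="\<lambda>t. f' t x"])
          show "((\<lambda>t. f t x) has_real_derivative f' t x) (at t within {l<..<u})" if "t \<in> {l<..<u}" for t
            using deriv[OF that x] by (rule has_field_derivative_at_within)
        qed (use X \<theta> bound x in auto)
        then show "norm ((f (X i) x - f \<theta> x) / (X i - \<theta>)) \<le> D x"
          using X by (simp add: divide_simps)
      qed
    qed (use meas D in auto)
    moreover have eq: "(\<integral>x. (f (X i) x - f \<theta> x) / (X i - \<theta>) \<partial>M)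
        = ((\<integral>x. f (X i) x \<partial>M) - (\<integral>x. f \<theta> x \<partial>M)) / (X i - \<theta>)" for i
      using int[of "X i"] int[OF \<theta>] X by simp
    ultimately show "(\<lambda>i. ((\<integral>x. f (X i) x \<partial>M) - (\<integral>x. f \<theta> x \<partial>M)) / (X i - \<theta>)) \<longlonglongrightarrow> (\<integral>x. f' \<theta> x \<partial>M)"
      by (simp only: eq)
  qed
  then have "((\<lambda>t. \<integral>x. f t x \<partial>M) has_real_derivative (\<integral>x. f' \<theta> x \<partial>M)) (at \<theta> within {l<..<u})"
    by (simp add: has_field_derivative_iff)
  then show ?thesis unfolding at_within_open[OF \<theta> open_greaterThanLessThan] .
qed

section \<open>Gaussian kernels with polynomial weights\<close>

lemma bound_coeff_nonneg:
  fixes y P c :: real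
  assumes "\<bar>P\<bar> \<le> c * (1 + y\<^sup>2)\<^sup>2"
  shows "0 \<le> c"
proof -
  have "0 < 1 + y\<^sup>2" by (simp add: add_pos_nonneg)
  then have "0 < (1 + y\<^sup>2)\<^sup>2" by (rule zero_less_power)
  moreover have "0 \<le> c * (1 + y\<^sup>2)\<^sup>2" using assms by (rule order_trans[OF abs_ge_zero])
  ultimately show ?thesis by (meson not_le mult_neg_pos)
qed

text \<open>Half of the Gaussian exponent absorbs the polynomial: square
  \<open>1 + y^2 \<le> 8 * exp (y^2 / 8)\<close>.\<close>

lemma gaussian_poly_bound:
  fixes y P c :: real
  assumes "\<bar>P\<bar> \<le> c * (1 + y\<^sup>2)\<^sup>2"
  shows "\<bar>P * std_normal_density y\<bar> \<le> 64 * c * exp (- y\<^sup>2 / 4)"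
proof -
  have c: "0 \<le> c" by (rule bound_coeff_nonneg[OF assms])
  have "1 + y\<^sup>2 \<le> 8 * (1 + y\<^sup>2 / 8)" by simp
  also have "\<dots> \<le> 8 * exp (y\<^sup>2 / 8)" by (intro mult_left_mono exp_ge_add_one_self) auto
  finally have "(1 + y\<^sup>2)\<^sup>2 \<le> (8 * exp (y\<^sup>2 / 8))\<^sup>2" by (intro power_mono) auto
  also have "\<dots> = 64 * exp (y\<^sup>2 / 4)" by (simp add: power_mult_distrib flip: exp_of_nat_mult)
  finally have 1: "(1 + y\<^sup>2)\<^sup>2 \<le> 64 * exp (y\<^sup>2 / 4)" .
  have "1 / sqrt (2 * pi) \<le> 1" using pi_gt3 by (simp add: divide_simps)
  then have 2: "std_normal_density y \<le> exp (- y\<^sup>2 / 2)"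
    unfolding std_normal_density_def by (intro mult_left_le_one_le) auto
  have "\<bar>P * std_normal_density y\<bar> \<le> (c * (1 + y\<^sup>2)\<^sup>2) * exp (- y\<^sup>2 / 2)"
    unfolding abs_mult using assms 2 normal_density_nonneg[of 0 1 y] c by (intro mult_mono) auto
  also have "\<dots> \<le> (c * (64 * exp (y\<^sup>2 / 4))) * exp (- y\<^sup>2 / 2)"
    using 1 c by (intro mult_right_mono mult_left_mono) auto
  also have "\<dots> = 64 * c * exp (- y\<^sup>2 / 4)" by (simp flip: exp_add)
  finally show ?thesis .
qed

text \<open>\<open>smooth\<close> is the correlation of the noise with a function of the scaled signal along the curve
  \<open>\<sigma> e\<^sup>t\<close>, \<open>s e\<^sup>-\<^sup>a\<^sup>t\<close> of noise levels and shrinkage scales. The function may jump, so it is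
  differentiated after moving the dependence on \<open>t\<close> into the Gaussian kernel.\<close>

definition kernel_arg :: "real \<Rightarrow> real \<Rightarrow> real \<Rightarrow> real \<Rightarrow> real" where
  "kernel_arg a b t w = w * exp (- ((1 + a) * t)) - b * exp (- t)"

definition smooth :: "real \<Rightarrow> (real \<Rightarrow> real) \<Rightarrow> real \<Rightarrow> real \<Rightarrow> real" where
  "smooth a f b t = exp (- (a * t)) * (\<integral>z. f (b * exp (a * t) + exp ((1 + a) * t) * z) * z \<partial>gauss)"

definition smooth_deriv :: "real \<Rightarrow> (real \<Rightarrow> real) \<Rightarrow> real \<Rightarrow> real \<Rightarrow> real" where
  "smooth_deriv a f b t = exp (- (a * t)) * (\<integral>z. f (b * exp (a * t) + exp ((1 + a) * t) * z)
     * (slope_weight a z + a * b * exp (- t) * (z\<^sup>2 - 1)) \<partial>gauss)"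

lemma kernel_arg_affine: "kernel_arg a b t (b * exp (a * t) + exp ((1 + a) * t) * z) = z"
  unfolding kernel_arg_def by (simp add: algebra_simps flip: exp_add)

text \<open>The substitution \<open>w = b * exp (a * t) + exp ((1 + a) * t) * z\<close> frees the
  argument of \<open>f\<close> from \<open>t\<close>. The exponent \<open>1 + 2 * a\<close> adds
  that of the Jacobian, \<open>1 + a\<close>, to that of the prefactor, \<open>a\<close>.\<close>

lemma kernel_substitution:
  fixes f P :: "real \<Rightarrow> real"
  assumes [measurable]: "f \<in> borel_measurable borel" "P \<in> borel_measurable borel"
  shows "(\<integral>w. f w * (exp (- ((1 + 2 * a) * t)) * (P (kernel_arg a b t w) * std_normal_density (kernel_arg a b t w))) \<partial>lborel)
     = exp (- (a * t)) * (\<integral>z. f (b * exp (a * t) + exp ((1 + a) * t) * z) * P z \<partial>gauss)"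
proof -
  let ?c = "exp ((1 + a) * t)"
  have e: "?c * exp (- ((1 + 2 * a) * t)) = exp (- (a * t))" by (simp add: algebra_simps flip: exp_add)
  have "(\<integral>w. f w * (exp (- ((1 + 2 * a) * t)) * (P (kernel_arg a b t w) * std_normal_density (kernel_arg a b t w))) \<partial>lborel)
    = ?c * (\<integral>z. f (b * exp (a * t) + ?c * z) * (exp (- ((1 + 2 * a) * t)) * (P z * std_normal_density z)) \<partial>lborel)"
    by (subst lborel_integral_real_affine[where c="?c" and t="b * exp (a * t)"]) (simp_all add: kernel_arg_affine)
  also have "(\<lambda>z. f (b * exp (a * t) + ?c * z) * (exp (- ((1 + 2 * a) * t)) * (P z * std_normal_density z)))
     = (\<lambda>z. exp (- ((1 + 2 * a) * t)) * (std_normal_density z * (f (b * exp (a * t) + ?c * z) * P z)))"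
    by (simp add: ac_simps)
  also have "?c * (\<integral>z. exp (- ((1 + 2 * a) * t)) * (std_normal_density z * (f (b * exp (a * t) + ?c * z) * P z)) \<partial>lborel)
     = exp (- (a * t)) * (\<integral>z. std_normal_density z * (f (b * exp (a * t) + ?c * z) * P z) \<partial>lborel)"
    by (subst integral_mult_right_zero) (simp only: mult.assoc[symmetric] e)
  also have "\<dots> = exp (- (a * t)) * (\<integral>z. f (b * exp (a * t) + ?c * z) * P z \<partial>gauss)"
    by (subst integral_gauss) auto
  finally show ?thesis .
qed

text \<open>The bound has to be uniform in \<open>t\<close>. From
  \<open>0 \<le> (u - 2 * v)^2\<close> one gets \<open>(u - v)^2 \<ge> u^2 / 2 - v^2\<close>, which
  separates the integration variable from the shift and leaves a Gaussian in
  \<open>w\<close>.\<close>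

lemma kernel_dominated:
  assumes t: "t \<in> {-1<..<1}" and a: "0 \<le> a" and P: "\<bar>P\<bar> \<le> c * (1 + (kernel_arg a b t w)\<^sup>2)\<^sup>2"
  shows "\<bar>exp (- ((1 + 2 * a) * t)) * (P * std_normal_density (kernel_arg a b t w))\<bar>
    \<le> exp (1 + 2 * a) * (64 * c * exp (exp 2 * b\<^sup>2 / 4)) * exp (- (w\<^sup>2 / (8 * exp (2 * (1 + a)))))"
proof -
  let ?y = "kernel_arg a b t w"
  have c: "0 \<le> c" by (rule bound_coeff_nonneg[OF P])
  define u where "u = w * exp (- ((1 + a) * t))"
  define v where "v = b * exp (- t)"
  have "(1 + a) * t \<le> (1 + a) * 1" using t a by (intro mult_left_mono) auto
  then have "exp (- (1 + a)) \<le> exp (- ((1 + a) * t))" by simp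
  then have "(exp (- (1 + a)))\<^sup>2 \<le> (exp (- ((1 + a) * t)))\<^sup>2" by (intro power_mono) auto
  then have "w\<^sup>2 * (exp (- (1 + a)))\<^sup>2 \<le> u\<^sup>2" unfolding u_def power_mult_distrib by (intro mult_left_mono) auto
  moreover have "w\<^sup>2 * (exp (- (1 + a)))\<^sup>2 = w\<^sup>2 / exp (2 * (1 + a))"
    by (simp add: exp_minus field_simps power2_eq_square flip: exp_add)
  ultimately have u: "w\<^sup>2 / exp (2 * (1 + a)) \<le> u\<^sup>2" by simp
  have "exp (- t) \<le> exp 1" using t by simp
  then have "(exp (- t))\<^sup>2 \<le> (exp 1)\<^sup>2" by (intro power_mono) auto
  then have "v\<^sup>2 \<le> b\<^sup>2 * (exp 1)\<^sup>2" unfolding v_def power_mult_distrib by (intro mult_left_mono) auto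
  moreover have "(exp 1)\<^sup>2 = exp (2::real)" by (simp add: power2_eq_square flip: exp_add)
  ultimately have v: "v\<^sup>2 \<le> exp 2 * b\<^sup>2" by (simp add: mult.commute)
  have "0 \<le> (u - 2 * v)\<^sup>2" by simp
  then have "u\<^sup>2 / 2 - v\<^sup>2 \<le> (u - v)\<^sup>2" by (simp add: power2_eq_square algebra_simps)
  moreover have "?y = u - v" by (simp add: kernel_arg_def u_def v_def)
  ultimately have "u\<^sup>2 / 2 - v\<^sup>2 \<le> ?y\<^sup>2" by simp
  moreover have "w\<^sup>2 / exp (2 * (1 + a)) / 2 \<le> u\<^sup>2 / 2" using u by (intro divide_right_mono) auto
  ultimately have y: "w\<^sup>2 / exp (2 * (1 + a)) / 2 - exp 2 * b\<^sup>2 \<le> ?y\<^sup>2"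
    using v by (meson diff_mono order_trans)
  have "- ((1 + 2 * a) * t) \<le> 1 + 2 * a"
  proof -
    have "(1 + 2 * a) * (- t) \<le> (1 + 2 * a) * 1" using t a by (intro mult_left_mono) auto
    then show ?thesis by simp
  qed
  then have "\<bar>exp (- ((1 + 2 * a) * t)) * (P * std_normal_density ?y)\<bar> \<le> exp (1 + 2 * a) * (64 * c * exp (- ?y\<^sup>2 / 4))"
    using gaussian_poly_bound[OF P] unfolding abs_mult[of "exp _"] by (intro mult_mono) auto
  also have "exp (- ?y\<^sup>2 / 4) \<le> exp (exp 2 * b\<^sup>2 / 4 + - (w\<^sup>2 / (8 * exp (2 * (1 + a)))))"
    using y by (simp add: field_simps)
  then have "exp (1 + 2 * a) * (64 * c * exp (- ?y\<^sup>2 / 4))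
     \<le> exp (1 + 2 * a) * (64 * c * exp (exp 2 * b\<^sup>2 / 4 + - (w\<^sup>2 / (8 * exp (2 * (1 + a))))))"
    using c by (intro mult_left_mono) auto
  also have "\<dots> = exp (1 + 2 * a) * (64 * c * exp (exp 2 * b\<^sup>2 / 4)) * exp (- (w\<^sup>2 / (8 * exp (2 * (1 + a)))))"
    by (simp only: exp_add mult.assoc)
  finally show ?thesis by simp
qed

lemma integrable_exp_neg_square:
  assumes "0 < (k::real)"
  shows "integrable lborel (\<lambda>w. exp (- (w\<^sup>2 / (8 * k\<^sup>2))))"
proof -
  have "integrable lborel (\<lambda>w. sqrt (2 * pi * (2 * k)\<^sup>2) * normal_density 0 (2 * k) w)"
    using assms by (intro integrable_mult_right integrable_normal_density) simp
  also have "(\<lambda>w. sqrt (2 * pi * (2 * k)\<^sup>2) * normal_density 0 (2 * k) w) = (\<lambda>w. exp (- (w\<^sup>2 / (8 * k\<^sup>2))))"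
    using assms by (simp add: normal_density_def power_mult_distrib real_sqrt_mult)
  finally show ?thesis .
qed

lemma abs_poly_bounds:
  fixes y :: real
  shows "\<bar>y\<bar> \<le> (1 + y\<^sup>2)\<^sup>2" "\<bar>y\<bar> ^ 3 \<le> (1 + y\<^sup>2)\<^sup>2" "\<bar>y\<^sup>2 - 1\<bar> \<le> (1 + y\<^sup>2)\<^sup>2"
proof -
  have "0 \<le> (\<bar>y\<bar> - 1)\<^sup>2" by simp
  then have 1: "\<bar>y\<bar> \<le> 1 + y\<^sup>2" by (simp add: power2_eq_square algebra_simps)
  have 2: "1 + y\<^sup>2 \<le> (1 + y\<^sup>2)\<^sup>2" using self_le_power[of "1 + y\<^sup>2" 2] by simp
  show "\<bar>y\<bar> \<le> (1 + y\<^sup>2)\<^sup>2" using 1 2 by linarith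
  have "\<bar>y\<bar> * \<bar>y\<bar>\<^sup>2 \<le> (1 + y\<^sup>2) * (1 + y\<^sup>2)" using 1 by (intro mult_mono) auto
  then show "\<bar>y\<bar> ^ 3 \<le> (1 + y\<^sup>2)\<^sup>2" by (simp add: power2_eq_square power3_eq_cube)
  have "\<bar>y\<^sup>2 - 1\<bar> \<le> 1 + y\<^sup>2" by (simp add: abs_le_iff)
  then show "\<bar>y\<^sup>2 - 1\<bar> \<le> (1 + y\<^sup>2)\<^sup>2" using 2 by linarith
qed

lemma slope_weight_bound: "0 \<le> a \<Longrightarrow> \<bar>slope_weight a y\<bar> \<le> (3 + 4 * a) * (1 + y\<^sup>2)\<^sup>2"
proof -
  assume a: "0 \<le> a"
  have "\<bar>slope_weight a y\<bar> \<le> (1 + a) * \<bar>y\<bar> ^ 3 + (2 + 3 * a) * \<bar>y\<bar>"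
    unfolding slope_weight_eq using a abs_triangle_ineq4[of "(1 + a) * y ^ 3" "(2 + 3 * a) * y"]
    by (simp add: abs_mult power_abs)
  also have "\<dots> \<le> (1 + a) * (1 + y\<^sup>2)\<^sup>2 + (2 + 3 * a) * (1 + y\<^sup>2)\<^sup>2"
    using a abs_poly_bounds[of y] by (intro add_mono mult_left_mono) auto
  finally show ?thesis by (simp add: algebra_simps)
qed

lemma deriv_weight_bound:
  assumes a: "0 \<le> a" and t: "t \<in> {-1<..<1}"
  shows "\<bar>slope_weight a z + a * b * exp (- t) * (z\<^sup>2 - 1)\<bar> \<le> ((3 + 4 * a) + a * \<bar>b\<bar> * exp 1) * (1 + z\<^sup>2)\<^sup>2"
proof -
  have "\<bar>slope_weight a z + a * b * exp (- t) * (z\<^sup>2 - 1)\<bar> \<le> \<bar>slope_weight a z\<bar> + \<bar>a * b * exp (- t) * (z\<^sup>2 - 1)\<bar>"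
    by (rule abs_triangle_ineq)
  also have "\<bar>a * b * exp (- t) * (z\<^sup>2 - 1)\<bar> \<le> a * \<bar>b\<bar> * exp 1 * (1 + z\<^sup>2)\<^sup>2"
    unfolding abs_mult using a t abs_poly_bounds(3)[of z] by (intro mult_mono) auto
  also note slope_weight_bound[OF a, of z]
  finally show ?thesis by (simp add: distrib_right)
qed

lemma kernel_deriv:
  "((\<lambda>t. exp (- ((1 + 2 * a) * t)) * (kernel_arg a b t w * std_normal_density (kernel_arg a b t w)))
    has_real_derivative
    exp (- ((1 + 2 * a) * t)) * ((slope_weight a (kernel_arg a b t w)
      + a * b * exp (- t) * ((kernel_arg a b t w)\<^sup>2 - 1)) * std_normal_density (kernel_arg a b t w))) (at t)"
proof -
  let ?y = "\<lambda>t. kernel_arg a b t w"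
  have "(?y has_real_derivative w * (exp (- ((1 + a) * t)) * - (1 + a)) - b * (exp (- t) * - 1)) (at t)"
    unfolding kernel_arg_def by (auto intro!: derivative_eq_intros)
  then have y: "(?y has_real_derivative (- ((1 + a) * ?y t) - a * b * exp (- t))) (at t)"
    by (rule DERIV_cong) (simp add: kernel_arg_def algebra_simps)
  have d: "(std_normal_density has_real_derivative - (x * std_normal_density x)) (at x)" for x
  proof -
    define c :: real where "c = 1 / sqrt (2 * pi)"
    have "std_normal_density = (\<lambda>x. c * exp (- x\<^sup>2 / 2))"
      by (simp add: fun_eq_iff std_normal_density_def c_def)
    then show ?thesis by (auto intro!: derivative_eq_intros)
  qed
  have phi: "((\<lambda>t. std_normal_density (?y t)) has_real_derivative
      - (?y t * std_normal_density (?y t)) * (- ((1 + a) * ?y t) - a * b * exp (- t))) (at t)"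
    by (rule DERIV_chain2[OF d y])
  have "((\<lambda>t. exp (- ((1 + 2 * a) * t)) * (?y t * std_normal_density (?y t))) has_real_derivative
     (- (1 + 2 * a) * exp (- ((1 + 2 * a) * t))) * (?y t * std_normal_density (?y t))
     + ((- ((1 + a) * ?y t) - a * b * exp (- t)) * std_normal_density (?y t)
       + - (?y t * std_normal_density (?y t)) * (- ((1 + a) * ?y t) - a * b * exp (- t)) * ?y t) * exp (- ((1 + 2 * a) * t))) (at t)"
    by (intro DERIV_mult y phi) (auto intro!: derivative_eq_intros)
  then show ?thesis
    by (rule DERIV_cong) (simp add: slope_weight_eq power2_eq_square power3_eq_cube algebra_simps)
qed

lemma smooth_has_derivative:
  fixes f :: "real \<Rightarrow> real"
  assumes f [measurable]: "f \<in> borel_measurable borel" and fB: "\<And>x. \<bar>f x\<bar> \<le> B" and a: "0 \<le> a"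
    and t: "t \<in> {-1<..<1}"
  shows "((\<lambda>t. smooth a f b t) has_real_derivative smooth_deriv a f b t) (at t)"
proof -
  let ?K = "\<lambda>t P w. (exp (- ((1 + 2 * a) * t)) * (P * std_normal_density (kernel_arg a b t w)))"
  let ?E = "\<lambda>w. exp (- (w\<^sup>2 / (8 * exp (2 * (1 + a)))))"
  let ?P = "\<lambda>t y. slope_weight a y + a * b * exp (- t) * (y\<^sup>2 - 1)"
  define c where "c = (3 + 4 * a) + a * \<bar>b\<bar> * exp 1"
  define K where "K = B * (exp (1 + 2 * a) * (64 * c * exp (exp 2 * b\<^sup>2 / 4)))"
  have B0: "0 \<le> B" using order_trans[OF abs_ge_zero fB[of 0]] .
  have c1: "1 \<le> c" using a by (simp add: c_def)
  have [measurable]: "kernel_arg a b t \<in> borel_measurable borel" for t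
    unfolding kernel_arg_def[abs_def] by measurable
  have sub1: "smooth a f b t = (\<integral>w. f w * ?K t (kernel_arg a b t w) w \<partial>lborel)" for t
    unfolding smooth_def by (rule kernel_substitution[of f "\<lambda>y. y" a t b, symmetric]) simp_all
  have sub2: "smooth_deriv a f b t = (\<integral>w. f w * ?K t (?P t (kernel_arg a b t w)) w \<partial>lborel)" for t
    unfolding smooth_deriv_def by (rule kernel_substitution[of f "?P t" a t b, symmetric]) measurable
  have int: "integrable lborel (\<lambda>w. K * ?E w)"
    using integrable_exp_neg_square[of "exp (1 + a)"] by (simp add: power2_eq_square flip: exp_add)
  have dom: "\<bar>f w * ?K t P w\<bar>
      \<le> K * ?E w"
    if "t \<in> {-1<..<1}" "\<bar>P\<bar> \<le> c * (1 + (kernel_arg a b t w)\<^sup>2)\<^sup>2" for t w P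
  proof -
    have "\<bar>f w\<bar> * \<bar>exp (- ((1 + 2 * a) * t)) * (P * std_normal_density (kernel_arg a b t w))\<bar>
      \<le> B * (exp (1 + 2 * a) * (64 * c * exp (exp 2 * b\<^sup>2 / 4)) * ?E w)"
      by (rule mult_mono[OF fB kernel_dominated[OF that(1) a that(2)] B0 abs_ge_zero])
    then show ?thesis unfolding K_def by (simp only: abs_mult mult.assoc)
  qed
  have P: "\<bar>?P t y\<bar> \<le> c * (1 + y\<^sup>2)\<^sup>2" if "t \<in> {-1<..<1}" for t y
    unfolding c_def by (rule deriv_weight_bound[OF a that])
  have Q: "\<bar>y\<bar> \<le> c * (1 + y\<^sup>2)\<^sup>2" for y
    using abs_poly_bounds(1)[of y] mult_right_mono[OF c1, of "(1 + y\<^sup>2)\<^sup>2"] by simp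
  show ?thesis unfolding sub1 sub2
  proof (rule has_real_derivative_integral[OF t, where D="\<lambda>w. K * ?E w"])
    show "integrable lborel (\<lambda>w. f w * ?K t (kernel_arg a b t w) w)"
      if "t \<in> {-1<..<1}" for t
      by (rule Bochner_Integration.integrable_bound[OF int]) (use dom[OF that Q] in \<open>auto intro: order_trans[OF _ abs_ge_self]\<close>)
    show "\<bar>f w * ?K t (?P t (kernel_arg a b t w)) w\<bar>
        \<le> K * ?E w" if "t \<in> {-1<..<1}" for t w
      using that P[OF that] by (rule dom)
    show "(\<lambda>w. f w * ?K t (?P t (kernel_arg a b t w)) w)
        \<in> borel_measurable lborel"
      by simp
  qed (rule DERIV_cmult[OF kernel_deriv], rule int)
qed

text \<open>Growth at most linear in \<open>b\<close> lets a first moment of the signal dominate the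
  derivative under the expectation.\<close>

lemma smooth_deriv_bound:
  fixes f :: "real \<Rightarrow> real"
  assumes f [measurable]: "f \<in> borel_measurable borel" and fB: "\<And>x. \<bar>f x\<bar> \<le> B" and a: "0 \<le> a"
  obtains C where "0 \<le> C" "\<And>t b. t \<in> {-1<..<1} \<Longrightarrow> \<bar>smooth_deriv a f b t\<bar> \<le> C * (1 + \<bar>b\<bar>)"
proof
  let ?c = "(3 + 4 * a) + a * exp 1"
  let ?I = "\<integral>z. (1 + z\<^sup>2)\<^sup>2 \<partial>gauss"
  have B0: "0 \<le> B" using order_trans[OF abs_ge_zero fB[of 0]] .
  have sq: "(1 + z\<^sup>2)\<^sup>2 = 1 + 2 * z\<^sup>2 + z ^ 4" for z :: real by (simp add: power2_eq_square power4_eq_xxxx algebra_simps)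
  have I: "integrable gauss (\<lambda>z. (1 + z\<^sup>2)\<^sup>2)" unfolding sq by simp
  have I0: "0 \<le> ?I" by simp
  show "0 \<le> exp a * (B * ?c * ?I)" using B0 a I0 by simp
  fix t b :: real assume t: "t \<in> {-1<..<1}"
  let ?h = "\<lambda>z. f (b * exp (a * t) + exp ((1 + a) * t) * z) * (slope_weight a z + a * b * exp (- t) * (z\<^sup>2 - 1))"
  have pt: "\<bar>?h z\<bar> \<le> B * (?c * (1 + \<bar>b\<bar>)) * (1 + z\<^sup>2)\<^sup>2" for z
  proof -
    note deriv_weight_bound[OF a t, of z b]
    also have "((3 + 4 * a) + a * \<bar>b\<bar> * exp 1) * (1 + z\<^sup>2)\<^sup>2 \<le> (?c * (1 + \<bar>b\<bar>)) * (1 + z\<^sup>2)\<^sup>2"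
      using a by (intro mult_right_mono) (auto simp: algebra_simps)
    finally have "\<bar>slope_weight a z + a * b * exp (- t) * (z\<^sup>2 - 1)\<bar> \<le> (?c * (1 + \<bar>b\<bar>)) * (1 + z\<^sup>2)\<^sup>2" .
    then show ?thesis unfolding abs_mult[of "f _"] mult.assoc[of B] using fB B0 by (intro mult_mono) auto
  qed
  have "\<bar>\<integral>z. ?h z \<partial>gauss\<bar> \<le> (\<integral>z. B * (?c * (1 + \<bar>b\<bar>)) * (1 + z\<^sup>2)\<^sup>2 \<partial>gauss)"
  proof (rule integral_abs_bound_integral)
    show "integrable gauss ?h"
      by (rule Bochner_Integration.integrable_bound[OF integrable_mult_right[OF I, of "B * (?c * (1 + \<bar>b\<bar>))"]])
         (use pt in \<open>auto intro: order_trans[OF _ abs_ge_self]\<close>)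
  qed (use pt I in auto)
  then have "\<bar>\<integral>z. ?h z \<partial>gauss\<bar> \<le> B * (?c * (1 + \<bar>b\<bar>)) * ?I" by simp
  moreover have "exp (- (a * t)) \<le> exp a"
  proof -
    have "a * (- t) \<le> a * 1" using a t by (intro mult_left_mono) auto
    then show ?thesis by simp
  qed
  ultimately have "exp (- (a * t)) * \<bar>\<integral>z. ?h z \<partial>gauss\<bar> \<le> exp a * (B * (?c * (1 + \<bar>b\<bar>)) * ?I)"
    by (intro mult_mono) auto
  then show "\<bar>smooth_deriv a f b t\<bar> \<le> exp a * (B * ?c * ?I) * (1 + \<bar>b\<bar>)"
    unfolding smooth_deriv_def abs_mult[of "exp _"] by (simp add: ac_simps)
qed

lemma integrable_smooth:
  fixes f :: "real \<Rightarrow> real" and X :: "'a \<Rightarrow> real"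
  assumes f [measurable]: "f \<in> borel_measurable borel" and fB: "\<And>x. \<bar>f x\<bar> \<le> B"
    and M: "finite_measure M" and X [measurable]: "X \<in> borel_measurable M"
  shows "integrable M (\<lambda>w. smooth a f (X w) t)"
proof -
  interpret finite_measure M by (rule M)
  have bound: "\<bar>smooth a f b t\<bar> \<le> exp (- (a * t)) * (B * (\<integral>z. \<bar>z\<bar> \<partial>gauss))" for b t
  proof -
    have i: "integrable gauss (\<lambda>z. B * \<bar>z\<bar>)" using integrable_gauss_abs_power[of 1] by simp
    have "\<bar>\<integral>z. f (b * exp (a * t) + exp ((1 + a) * t) * z) * z \<partial>gauss\<bar> \<le> (\<integral>z. B * \<bar>z\<bar> \<partial>gauss)"
      using i fB by (intro integral_abs_bound_integral)
        (auto simp: abs_mult intro!: mult_right_mono integrable_gauss_bounded_mult[where B=B])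
    then show ?thesis unfolding smooth_def abs_mult[of "exp _"] by simp
  qed
  show ?thesis
  proof (rule integrable_const_bound)
    show "AE w in M. norm (smooth a f (X w) t) \<le> exp (- (a * t)) * (B * (\<integral>z. \<bar>z\<bar> \<partial>gauss))"
      using bound by auto
    show "(\<lambda>w. smooth a f (X w) t) \<in> borel_measurable M" unfolding smooth_def by measurable
  qed
qed

lemma smooth_integral_derivative:
  fixes f :: "real \<Rightarrow> real" and X :: "'a \<Rightarrow> real"
  assumes f [measurable]: "f \<in> borel_measurable borel" and fB: "\<And>x. \<bar>f x\<bar> \<le> B" and a: "0 \<le> a"
    and M: "finite_measure M" and X: "integrable M X"
  shows "((\<lambda>t. \<integral>w. smooth a f (X w) t \<partial>M) has_real_derivative (\<integral>w. smooth_deriv a f (X w) 0 \<partial>M)) (at 0)"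
proof -
  interpret finite_measure M by (rule M)
  have [measurable]: "X \<in> borel_measurable M" using X by auto
  obtain C where C: "0 \<le> C" "\<And>t b. t \<in> {-1<..<1} \<Longrightarrow> \<bar>smooth_deriv a f b t\<bar> \<le> C * (1 + \<bar>b\<bar>)"
    using smooth_deriv_bound[OF f fB a] by metis
  show ?thesis
  proof (rule has_real_derivative_integral[where l="-1" and u=1 and D="\<lambda>w. C * (1 + \<bar>X w\<bar>)"])
    show "integrable M (\<lambda>w. smooth a f (X w) t)" for t by (rule integrable_smooth[OF f fB M]) simp
    show "(\<lambda>w. smooth_deriv a f (X w) 0) \<in> borel_measurable M" unfolding smooth_deriv_def by measurable
    show "integrable M (\<lambda>w. C * (1 + \<bar>X w\<bar>))" using X by simp
  qed (use smooth_has_derivative[OF f fB a] C in auto)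
qed

section \<open>Continuity of the optimal risk\<close>

context shrinkage
begin

lemma isCont_S: assumes "\<bar>u\<bar> \<noteq> T" shows "isCont S u"
proof -
  have "continuous_on {T<..} S"
  proof (rule continuous_on_subset[OF lipschitz_on_continuous_on])
    show "1-lipschitz_on {T<..} S"
    proof (rule lipschitz_onI)
      have *: "dist (S u) (S v) \<le> 1 * dist u v" if "T < u" "u \<le> v" for u v
      proof -
        have "\<nu> * (v - u) \<le> 1 * (v - u)" using nu1 that by (intro mult_right_mono) auto
        then show ?thesis using S_antimono[OF that] S_Lipschitz[OF that] that by (simp add: dist_real_def)
      qed
      show "dist (S u) (S v) \<le> 1 * dist u v" if "u \<in> {T<..}" "v \<in> {T<..}" for u v
        using *[of u v] *[of v u] that by (cases "u \<le> v") (auto simp: dist_commute)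
    qed simp
  qed simp
  then have pos: "isCont S u" if "T < u" for u
    using that by (simp add: continuous_on_eq_continuous_at)
  consider "\<bar>u\<bar> < T" | "T < u" | "T < - u" using assms by linarith
  then show ?thesis
  proof cases
    case 1
    have "continuous_on {-T<..<T} S"
      by (rule continuous_on_eq[of _ "\<lambda>u. u"]) (auto simp: S_small_abs)
    then show ?thesis using 1 by (auto simp: continuous_on_eq_continuous_at abs_less_iff)
  next
    case 3
    have "isCont (\<lambda>u. S (- u)) u"
      by (rule isCont_o2[where f=uminus and g=S]) (auto intro: pos 3)
    then have "isCont (\<lambda>u. - S (- u)) u" by (rule continuous_minus)
    then show ?thesis by (simp add: S_uminus)
  qed (rule pos)
qed

text \<open>The scale \<open>s\<close> of the shrinkage ranges over \<open>[0, \<infinity>]\<close>; it is compactified by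
  \<open>s = (1 - \<kappa>) / \<kappa>\<close>. At \<open>\<kappa> = 0\<close> everything is shrunk to \<open>0\<close>.\<close>

definition scaled :: "real \<Rightarrow> real \<Rightarrow> real" where
  "scaled s u = s * S (u / s)"

definition clip :: "real \<Rightarrow> real \<Rightarrow> real" where
  "clip \<kappa> u = (if \<kappa> = 0 then u else scaled ((1 - \<kappa>) / \<kappa>) u)"

lemma abs_scaled_le: "0 \<le> s \<Longrightarrow> \<bar>scaled s u\<bar> \<le> \<bar>u\<bar>"
  using abs_S_le[of "u / s"] by (cases "s = 0") (auto simp: scaled_def abs_mult field_simps)

lemma abs_scaled_le_T: "0 \<le> s \<Longrightarrow> \<bar>scaled s u\<bar> \<le> s * T"
  using abs_S_le_T[of "u / s"] by (auto simp: scaled_def abs_mult intro: mult_left_mono)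

lemma abs_clip_le: "\<kappa> \<in> {0..1} \<Longrightarrow> \<bar>clip \<kappa> u\<bar> \<le> \<bar>u\<bar>"
  by (auto simp: clip_def intro!: abs_scaled_le divide_nonneg_nonneg)

lemma measurable_scaled [measurable]: "scaled s \<in> borel_measurable borel"
  unfolding scaled_def[abs_def] by measurable

lemma measurable_clip [measurable]: "clip \<kappa> \<in> borel_measurable borel"
  unfolding clip_def[abs_def] by measurable

lemma clip_one [simp]: "clip 1 u = 0" by (simp add: clip_def scaled_def)

lemma clip_zero [simp]: "clip 0 u = u" by (simp add: clip_def)

text \<open>The jump has to be avoided for interior \<open>k\<close> only: as \<open>k\<close> tends
  to 0 the threshold leaves every bounded set, and as \<open>k\<close> tends to 1 the clipped part
  is at most the scale times \<open>T\<close>, which tends to 0.\<close>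

lemma clip_tendsto:
  assumes \<kappa>: "\<And>n. K n \<in> {0..1}" "k \<in> {0..1}" "K \<longlonglongrightarrow> k" and U: "U \<longlonglongrightarrow> u"
    and nu: "0 < k \<Longrightarrow> k < 1 \<Longrightarrow> \<bar>u\<bar> \<noteq> (1 - k) / k * T"
  shows "(\<lambda>n. clip (K n) (U n)) \<longlonglongrightarrow> clip k u"
proof -
  consider "k = 0" | "k = 1" | "0 < k" "k < 1" using \<kappa>(2) by force
  then show ?thesis
  proof cases
    case 1
    \<comment> \<open>The inequality \<open>\<bar>U n\<bar> < (1 - K n) / K n * T\<close>,
      multiplied by \<open>K n\<close> so that it also makes sense for
      \<open>K n = 0\<close>.\<close>
    have "(\<lambda>n. \<bar>U n\<bar> * K n - (1 - K n) * T) \<longlonglongrightarrow> \<bar>u\<bar> * k - (1 - k) * T" by (intro tendsto_intros \<kappa> U)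
    then have "\<forall>\<^sub>F n in sequentially. \<bar>U n\<bar> * K n - (1 - K n) * T < 0"
      using 1 T_pos by (intro order_tendstoD) auto
    moreover have "\<forall>\<^sub>F n in sequentially. K n < 1" using 1 \<kappa> by (intro order_tendstoD) auto
    ultimately have "\<forall>\<^sub>F n in sequentially. clip (K n) (U n) = U n"
    proof eventually_elim
      case (elim n)
      show ?case
      proof (cases "K n = 0")
        case False
        then have "0 < K n" using \<kappa>(1)[of n] by auto
        then have "0 < (1 - K n) / K n" and "\<bar>U n / ((1 - K n) / K n)\<bar> \<le> T"
          using elim by (auto simp: field_simps abs_mult)
        then show ?thesis using False elim by (simp add: clip_def scaled_def S_small_abs)
      qed simp
    qed
    then show ?thesis using U 1 by (simp add: tendsto_cong)
  next
    case 2
    have "\<forall>\<^sub>F n in sequentially. 0 < K n" using 2 \<kappa> by (intro order_tendstoD) auto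
    then have "\<forall>\<^sub>F n in sequentially. norm (clip (K n) (U n)) \<le> (1 - K n) / K n * T"
    proof eventually_elim
      case (elim n)
      then show ?case using \<kappa>(1)[of n] abs_scaled_le_T[of "(1 - K n) / K n" "U n"] by (simp add: clip_def)
    qed
    moreover {
      have "(\<lambda>n. (1 - K n) / K n * T) \<longlonglongrightarrow> (1 - k) / k * T" using 2 by (intro tendsto_intros \<kappa>) auto
      then have "(\<lambda>n. (1 - K n) / K n * T) \<longlonglongrightarrow> 0" using 2 by simp
    }
    ultimately have "(\<lambda>n. clip (K n) (U n)) \<longlonglongrightarrow> 0" by (rule Lim_null_comparison)
    then show ?thesis using 2 by simp
  next
    case 3
    have "\<forall>\<^sub>F n in sequentially. 0 < K n" using 3 \<kappa> by (intro order_tendstoD) auto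
    then have ev: "\<forall>\<^sub>F n in sequentially. clip (K n) (U n) = scaled ((1 - K n) / K n) (U n)"
      by eventually_elim (simp add: clip_def)
    have s: "(\<lambda>n. (1 - K n) / K n) \<longlonglongrightarrow> (1 - k) / k" using 3 by (intro tendsto_intros \<kappa>) auto
    have s0: "0 < (1 - k) / k" using 3 by simp
    have "(\<lambda>n. U n / ((1 - K n) / K n)) \<longlonglongrightarrow> u / ((1 - k) / k)" using s0 by (intro tendsto_divide U s) auto
    moreover have "isCont S (u / ((1 - k) / k))"
      using nu 3 s0 by (intro isCont_S) (auto simp: abs_mult field_simps)
    ultimately have "(\<lambda>n. scaled ((1 - K n) / K n) (U n)) \<longlonglongrightarrow> scaled ((1 - k) / k) u"
      unfolding scaled_def by (intro tendsto_mult s isCont_tendsto_compose[of _ S])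
    then show ?thesis using 3 ev by (simp add: tendsto_cong clip_def)
  qed
qed

end

section \<open>The noisy observation and the continuity of its risk\<close>

locale noisy_signal = prob_space M for M :: "'a measure" +
  fixes X Z :: "'a \<Rightarrow> real"
  assumes X_measurable [measurable]: "X \<in> borel_measurable M"
    and X_sq: "integrable M (\<lambda>\<omega>. (X \<omega>)\<^sup>2)"
    and Z_normal: "distributed M lborel Z std_normal_density"
    and indep: "indep_var borel X borel Z"
begin

lemma Z_measurable [measurable]: "Z \<in> borel_measurable M"
  using distributed_measurable[OF Z_normal] by simp

lemma distr_Z: "distr M borel Z = gauss"
proof -
  have "distr M borel Z = distr M lborel Z" by (rule distr_cong) simp_all
  then show ?thesis using distributed_distr_eq_density[OF Z_normal] by (simp add: gauss_def)
qed

lemma distr_XZ: "distr M (borel \<Otimes>\<^sub>M borel) (\<lambda>\<omega>. (X \<omega>, Z \<omega>)) = distr M borel X \<Otimes>\<^sub>M gauss"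
  using indep unfolding indep_var_distribution_eq distr_Z[symmetric] by simp

lemma integral_Z:
  fixes f :: "real \<Rightarrow> real"
  assumes [measurable]: "f \<in> borel_measurable borel"
  shows "(\<integral>\<omega>. f (Z \<omega>) \<partial>M) = (\<integral>z. f z \<partial>gauss)" "integrable M (\<lambda>\<omega>. f (Z \<omega>)) \<longleftrightarrow> integrable gauss f"
  unfolding distr_Z[symmetric] by (simp_all add: integral_distr integrable_distr_eq)

lemma X_integrable: "integrable M X"
proof (rule Bochner_Integration.integrable_bound)
  show "integrable M (\<lambda>\<omega>. 1 + (X \<omega>)\<^sup>2)" using X_sq by simp
  have "\<bar>x\<bar> \<le> 1 + x\<^sup>2" for x :: real
  proof -
    have "0 \<le> (\<bar>x\<bar> - 1)\<^sup>2" by simp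
    then show ?thesis by (simp add: power2_eq_square algebra_simps)
  qed
  then show "AE \<omega> in M. norm (X \<omega>) \<le> norm (1 + (X \<omega>)\<^sup>2)" by simp
qed simp

lemma integral_XZ:
  fixes F :: "real \<Rightarrow> real \<Rightarrow> real"
  assumes [measurable]: "case_prod F \<in> borel_measurable (borel \<Otimes>\<^sub>M borel)"
    and int: "integrable M (\<lambda>\<omega>. F (X \<omega>) (Z \<omega>))"
  shows "(\<integral>\<omega>. F (X \<omega>) (Z \<omega>) \<partial>M) = (\<integral>\<omega>. (\<integral>z. F (X \<omega>) z \<partial>gauss) \<partial>M)"
proof -
  interpret PX: prob_space "distr M borel X" by (rule prob_space_distr) simp
  interpret P: pair_sigma_finite "distr M borel X" gauss ..
  have "integrable (distr M (borel \<Otimes>\<^sub>M borel) (\<lambda>\<omega>. (X \<omega>, Z \<omega>))) (case_prod F)"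
    using int by (subst integrable_distr_eq) auto
  then have i: "integrable (distr M borel X \<Otimes>\<^sub>M gauss) (case_prod F)" by (simp add: distr_XZ)
  have "(\<integral>\<omega>. F (X \<omega>) (Z \<omega>) \<partial>M) = integral\<^sup>L (distr M (borel \<Otimes>\<^sub>M borel) (\<lambda>\<omega>. (X \<omega>, Z \<omega>))) (case_prod F)"
    by (subst integral_distr) auto
  also have "\<dots> = (\<integral>x. (\<integral>z. F x z \<partial>gauss) \<partial>distr M borel X)"
    unfolding distr_XZ using P.integral_fst'[OF i] by simp
  also have "\<dots> = (\<integral>\<omega>. (\<integral>z. F (X \<omega>) z \<partial>gauss) \<partial>M)"
    by (subst integral_distr) auto
  finally show ?thesis .
qed

text \<open>For each signal value the level is hit at a single noise value, which is a null event.
  This keeps the jumps of \<open>S\<close> out of the limits of the risk.\<close>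

lemma AE_not_level:
  assumes "\<sigma> \<noteq> 0"
  shows "AE \<omega> in M. X \<omega> + \<sigma> * Z \<omega> \<noteq> t"
proof -
  have "(\<integral>\<omega>. indicat_real {t} (X \<omega> + \<sigma> * Z \<omega>) \<partial>M) = (\<integral>\<omega>. (\<integral>z. indicat_real {t} (X \<omega> + \<sigma> * z) \<partial>gauss) \<partial>M)"
    by (rule integral_XZ) (auto intro!: integrable_const_bound[where B=1])
  also have "(\<lambda>x. \<integral>z. indicat_real {t} (x + \<sigma> * z) \<partial>gauss) = (\<lambda>x. 0)"
  proof
    fix x
    have "(\<integral>z. indicat_real {t} (x + \<sigma> * z) \<partial>gauss) = (\<integral>z. std_normal_density z * indicat_real {t} (x + \<sigma> * z) \<partial>lborel)"
      by (rule integral_gauss) simp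
    also have "\<dots> = integral\<^sup>L lborel (\<lambda>z::real. 0::real)"
    proof (rule integral_cong_AE)
      have "AE z in lborel. z \<noteq> (t - x) / \<sigma>" by (rule AE_lborel_singleton)
      then show "AE z in lborel. std_normal_density z * indicat_real {t} (x + \<sigma> * z) = 0"
        by eventually_elim (use assms in \<open>auto simp: indicator_def field_simps\<close>)
    qed auto
    finally show "(\<integral>z. indicat_real {t} (x + \<sigma> * z) \<partial>gauss) = 0" by simp
  qed
  finally have "(\<integral>\<omega>. indicat_real {t} (X \<omega> + \<sigma> * Z \<omega>) \<partial>M) = 0" by simp
  then have "AE \<omega> in M. indicat_real {t} (X \<omega> + \<sigma> * Z \<omega>) = 0"
    by (subst (asm) integral_nonneg_eq_0_iff_AE) (auto intro!: integrable_const_bound[where B=1])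
  then show ?thesis by eventually_elim (auto simp: indicator_def)
qed

end

locale shrinkage_model = shrinkage + noisy_signal
begin

text \<open>Estimate minus signal, the estimate being the observation less its clipped part. It is
  \<open>- X \<omega>\<close> at \<open>\<kappa> = 0\<close> and pure noise at
  \<open>\<kappa> = 1\<close>.\<close>

definition err :: "real \<Rightarrow> real \<Rightarrow> 'a \<Rightarrow> real" where
  "err \<sigma> \<kappa> \<omega> = \<sigma> * Z \<omega> - clip \<kappa> (X \<omega> + \<sigma> * Z \<omega>)"

definition risk :: "real \<Rightarrow> real \<Rightarrow> real" where
  "risk \<sigma> \<kappa> = (\<integral>\<omega>. (err \<sigma> \<kappa> \<omega>)\<^sup>2 \<partial>M)"

definition opt_risk :: "real \<Rightarrow> real" where
  "opt_risk \<sigma> = (INF \<kappa>\<in>{0..1}. risk \<sigma> \<kappa>)"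

lemma measurable_err [measurable]: "err \<sigma> \<kappa> \<in> borel_measurable M"
  unfolding err_def[abs_def] by measurable

lemma err_bound:
  assumes "\<kappa> \<in> {0..1}" "0 \<le> \<sigma>" "\<sigma> \<le> c"
  shows "(err \<sigma> \<kappa> \<omega>)\<^sup>2 \<le> 2 * (X \<omega>)\<^sup>2 + 8 * c\<^sup>2 * (Z \<omega>)\<^sup>2"
proof -
  have "\<bar>\<sigma> * Z \<omega>\<bar> \<le> c * \<bar>Z \<omega>\<bar>" using assms by (simp add: abs_mult mult_right_mono)
  then have "\<bar>err \<sigma> \<kappa> \<omega>\<bar> \<le> \<bar>X \<omega>\<bar> + 2 * (c * \<bar>Z \<omega>\<bar>)"
    using abs_clip_le[OF assms(1), of "X \<omega> + \<sigma> * Z \<omega>"] unfolding err_def by linarith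
  then have "\<bar>err \<sigma> \<kappa> \<omega>\<bar>\<^sup>2 \<le> (\<bar>X \<omega>\<bar> + 2 * (c * \<bar>Z \<omega>\<bar>))\<^sup>2" by (rule power_mono) simp
  then have "(err \<sigma> \<kappa> \<omega>)\<^sup>2 \<le> (\<bar>X \<omega>\<bar> + 2 * (c * \<bar>Z \<omega>\<bar>))\<^sup>2" by (simp only: power2_abs)
  also have "\<dots> \<le> 2 * (X \<omega>)\<^sup>2 + 8 * c\<^sup>2 * (Z \<omega>)\<^sup>2"
  proof -
    have "0 \<le> (\<bar>X \<omega>\<bar> - 2 * (c * \<bar>Z \<omega>\<bar>))\<^sup>2" by simp
    then show ?thesis by (simp add: power2_eq_square algebra_simps)
  qed
  finally show ?thesis .
qed

lemma Z_sq_integrable: "integrable M (\<lambda>\<omega>. (Z \<omega>)\<^sup>2)"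
  using integral_Z(2)[of "\<lambda>z. z\<^sup>2"] by simp

lemma err_sq_integrable:
  assumes "\<kappa> \<in> {0..1}" "0 \<le> \<sigma>"
  shows "integrable M (\<lambda>\<omega>. (err \<sigma> \<kappa> \<omega>)\<^sup>2)"
proof (rule Bochner_Integration.integrable_bound)
  show "integrable M (\<lambda>\<omega>. 2 * (X \<omega>)\<^sup>2 + 8 * \<sigma>\<^sup>2 * (Z \<omega>)\<^sup>2)" using X_sq Z_sq_integrable by simp
qed (use err_bound[OF assms order_refl] in \<open>auto intro: order_trans[OF _ abs_ge_self]\<close>)

lemma risk_nonneg: "0 \<le> risk \<sigma> \<kappa>" unfolding risk_def by simp

lemma risk_one: "risk \<sigma> 1 = \<sigma>\<^sup>2"
  unfolding risk_def err_def by (simp add: power_mult_distrib integral_Z(1)[of "\<lambda>z. z\<^sup>2"])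

lemma risk_zero: "risk \<sigma> 0 = (\<integral>\<omega>. (X \<omega>)\<^sup>2 \<partial>M)"
  unfolding risk_def err_def by simp

lemma risk_tendsto:
  assumes K: "\<And>n. K n \<in> {0..1}" "k \<in> {0..1}" "K \<longlonglongrightarrow> k"
    and Q: "\<And>n. 0 < Q n" "0 < q" "Q \<longlonglongrightarrow> q"
  shows "(\<lambda>n. risk (Q n) (K n)) \<longlonglongrightarrow> risk q k"
  unfolding risk_def
proof -
  obtain c where c: "\<And>n. \<bar>Q n\<bar> \<le> c" using convergent_imp_Bseq[OF convergentI[OF Q(3)]] unfolding Bseq_def by auto
  show "(\<lambda>n. \<integral>\<omega>. (err (Q n) (K n) \<omega>)\<^sup>2 \<partial>M) \<longlonglongrightarrow> (\<integral>\<omega>. (err q k \<omega>)\<^sup>2 \<partial>M)"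
  proof (rule integral_dominated_convergence[where w="\<lambda>\<omega>. 2 * (X \<omega>)\<^sup>2 + 8 * c\<^sup>2 * (Z \<omega>)\<^sup>2"])
    show "integrable M (\<lambda>\<omega>. 2 * (X \<omega>)\<^sup>2 + 8 * c\<^sup>2 * (Z \<omega>)\<^sup>2)" using X_sq Z_sq_integrable by simp
    show "AE \<omega> in M. norm ((err (Q n) (K n) \<omega>)\<^sup>2) \<le> 2 * (X \<omega>)\<^sup>2 + 8 * c\<^sup>2 * (Z \<omega>)\<^sup>2" for n
      using err_bound[OF K(1)[of n], of "Q n" c] Q(1)[of n] c[of n] by auto
    have "AE \<omega> in M. X \<omega> + q * Z \<omega> \<noteq> (1 - k) / k * T" "AE \<omega> in M. X \<omega> + q * Z \<omega> \<noteq> - ((1 - k) / k * T)"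
      using Q by (auto intro!: AE_not_level)
    then show "AE \<omega> in M. (\<lambda>n. (err (Q n) (K n) \<omega>)\<^sup>2) \<longlonglongrightarrow> (err q k \<omega>)\<^sup>2"
    proof eventually_elim
      case (elim \<omega>)
      have "(\<lambda>n. clip (K n) (X \<omega> + Q n * Z \<omega>)) \<longlonglongrightarrow> clip k (X \<omega> + q * Z \<omega>)"
        by (rule clip_tendsto[OF K]) (use elim in \<open>auto intro!: tendsto_intros Q\<close>)
      then show ?case unfolding err_def by (intro tendsto_intros Q)
    qed
  qed auto
qed

lemma continuous_on_risk: "continuous_on ({0<..} \<times> {0..1}) (\<lambda>(\<sigma>, \<kappa>). risk \<sigma> \<kappa>)"
  unfolding continuous_on_sequentially
proof (intro ballI allI impI)
  fix f :: "nat \<Rightarrow> real \<times> real" and a assume a: "a \<in> {0<..} \<times> {0..1}" and f: "(\<forall>n. f n \<in> {0<..} \<times> {0..1}) \<and> f \<longlonglongrightarrow> a"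
  have "(\<lambda>n. risk (fst (f n)) (snd (f n))) \<longlonglongrightarrow> risk (fst a) (snd a)"
    by (rule risk_tendsto) (use a f in \<open>auto simp: mem_Times_iff intro: tendsto_fst tendsto_snd\<close>)
  then show "((\<lambda>(\<sigma>, \<kappa>). risk \<sigma> \<kappa>) \<circ> f) \<longlonglongrightarrow> (\<lambda>(\<sigma>, \<kappa>). risk \<sigma> \<kappa>) a"
    by (simp add: comp_def case_prod_beta)
qed

lemma opt_risk_le: "\<kappa> \<in> {0..1} \<Longrightarrow> opt_risk \<sigma> \<le> risk \<sigma> \<kappa>"
  unfolding opt_risk_def by (intro cINF_lower bdd_belowI2[where m=0] risk_nonneg)

lemma opt_risk_nonneg: "0 \<le> opt_risk \<sigma>"
  unfolding opt_risk_def by (intro cINF_greatest risk_nonneg) auto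

lemma opt_risk_le_sq: "opt_risk \<sigma> \<le> \<sigma>\<^sup>2"
  using opt_risk_le[of 1 \<sigma>] by (simp add: risk_one)

lemma opt_risk_le_bound: "opt_risk \<sigma> \<le> (\<integral>\<omega>. (X \<omega>)\<^sup>2 \<partial>M)"
  using opt_risk_le[of 0 \<sigma>] by (simp add: risk_zero)

lemma opt_risk_attained:
  assumes "0 < \<sigma>"
  obtains \<kappa> where "\<kappa> \<in> {0..1}" "opt_risk \<sigma> = risk \<sigma> \<kappa>"
proof -
  have "continuous_on {0..1} (\<lambda>\<kappa>. (\<lambda>(\<sigma>, \<kappa>). risk \<sigma> \<kappa>) (\<sigma>, \<kappa>))"
    using assms by (intro continuous_on_compose2[OF continuous_on_risk] continuous_intros) auto
  then have "continuous_on {0..1} (risk \<sigma>)" by simp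
  then obtain \<kappa> where k: "\<kappa> \<in> {0..1}" "\<forall>\<kappa>'\<in>{0..1}. risk \<sigma> \<kappa> \<le> risk \<sigma> \<kappa>'"
    using continuous_attains_inf[of "{0..1::real}" "risk \<sigma>"] by auto
  then have "risk \<sigma> \<kappa> \<le> opt_risk \<sigma>" unfolding opt_risk_def by (intro cINF_greatest) auto
  with k opt_risk_le[of \<kappa> \<sigma>] that show ?thesis by force
qed

text \<open>By uniform continuity on a compact set, an optimal \<kappa> for one noise level is
  nearly optimal for a neighbouring one, and conversely.\<close>

lemma isCont_opt_risk:
  assumes "0 < \<sigma>"
  shows "isCont opt_risk \<sigma>"
  unfolding continuous_at_eps_delta
proof (intro allI impI)
  fix e :: real assume e: "0 < e"
  have "compact ({\<sigma> / 2..2 * \<sigma>} \<times> {0..1::real})" by (intro compact_Times) auto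
  then have "uniformly_continuous_on ({\<sigma> / 2..2 * \<sigma>} \<times> {0..1}) (\<lambda>(\<sigma>, \<kappa>). risk \<sigma> \<kappa>)"
    using assms by (intro compact_uniformly_continuous continuous_on_subset[OF continuous_on_risk]) auto
  then obtain d where d: "0 < d" and dd: "\<And>x x'. x \<in> {\<sigma> / 2..2 * \<sigma>} \<times> {0..1} \<Longrightarrow> x' \<in> {\<sigma> / 2..2 * \<sigma>} \<times> {0..1}
      \<Longrightarrow> dist x' x < d \<Longrightarrow> dist ((\<lambda>(\<sigma>, \<kappa>). risk \<sigma> \<kappa>) x') ((\<lambda>(\<sigma>, \<kappa>). risk \<sigma> \<kappa>) x) < e"
    using e unfolding uniformly_continuous_on_def by metis
  have *: "opt_risk t < opt_risk t' + e" if t: "t \<in> {\<sigma> / 2..2 * \<sigma>}" "t' \<in> {\<sigma> / 2..2 * \<sigma>}" "dist t t' < d" for t t'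
  proof -
    obtain \<kappa> where k: "\<kappa> \<in> {0..1}" "opt_risk t' = risk t' \<kappa>"
      using opt_risk_attained[of t'] t assms by auto
    have "dist (risk t \<kappa>) (risk t' \<kappa>) < e" using dd[of "(t', \<kappa>)" "(t, \<kappa>)"] t k by (auto simp: dist_Pair_Pair)
    then show ?thesis using opt_risk_le[OF k(1), of t] k(2) by (auto simp: dist_real_def)
  qed
  show "\<exists>d>0. \<forall>x'. dist x' \<sigma> < d \<longrightarrow> dist (opt_risk x') (opt_risk \<sigma>) < e"
  proof (intro exI[of _ "min d (\<sigma> / 2)"] conjI allI impI)
    fix t assume t: "dist t \<sigma> < min d (\<sigma> / 2)"
    then have "t - \<sigma> < \<sigma> / 2 \<and> - (t - \<sigma>) < \<sigma> / 2" unfolding dist_real_def abs_less_iff[symmetric] by simp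
    then have "t \<in> {\<sigma> / 2..2 * \<sigma>}" "\<sigma> \<in> {\<sigma> / 2..2 * \<sigma>}" using assms by auto
    then show "dist (opt_risk t) (opt_risk \<sigma>) < e"
      using *[of t \<sigma>] *[of \<sigma> t] t by (auto simp: dist_commute dist_real_def abs_less_iff)
  qed (use d assms in auto)
qed

lemma continuous_on_opt_risk: "continuous_on {0..} (\<lambda>v. opt_risk (sqrt v))"
  unfolding continuous_on_eq_continuous_within
proof
  fix v :: real assume v: "v \<in> {0..}"
  show "continuous (at v within {0..}) (\<lambda>v. opt_risk (sqrt v))"
  \<comment> \<open>Without noise the observation may sit on a jump with positive probability, so at
    \<open>v = 0\<close> a squeeze between 0 and \<open>v\<close> replaces the joint continuity of
    the risk.\<close>
  proof (cases "v = 0")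
    case True
    have o0: "opt_risk 0 = 0" using opt_risk_le_sq[of 0] opt_risk_nonneg[of 0] by simp
    have le: "opt_risk (sqrt v) \<le> v" if "0 \<le> v" for v
      using opt_risk_le_sq[of "sqrt v"] that by simp
    have "((\<lambda>v. opt_risk (sqrt v)) \<longlongrightarrow> 0) (at 0 within {0..})"
    proof (rule tendsto_sandwich[where f="\<lambda>_. 0" and h="\<lambda>v. v"])
      show "\<forall>\<^sub>F v in at 0 within {0..}. opt_risk (sqrt v) \<le> v"
        unfolding eventually_at_filter using le by (auto intro!: always_eventually)
    qed (auto intro!: tendsto_intros simp: opt_risk_nonneg)
    then show ?thesis using True by (simp add: continuous_within o0)
  next
    case False
    then have "isCont (\<lambda>v. opt_risk (sqrt v)) v"
      using v by (intro isCont_o2[where f=sqrt and g=opt_risk] isCont_opt_risk isCont_real_sqrt) auto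
    then show ?thesis by (rule continuous_at_imp_continuous_at_within)
  qed
qed

end

section \<open>The optimal risk for small noise\<close>

lemma (in prob_space) affine_integral:
  fixes f g h :: "'a \<Rightarrow> real"
  assumes "integrable M f" "integrable M g" "integrable M h"
  shows "integrable M (\<lambda>\<omega>. k0 + k1 * f \<omega> + k2 * g \<omega> + k3 * h \<omega>)"
    and "(\<integral>\<omega>. k0 + k1 * f \<omega> + k2 * g \<omega> + k3 * h \<omega> \<partial>M)
      = k0 + k1 * integral\<^sup>L M f + k2 * integral\<^sup>L M g + k3 * integral\<^sup>L M h"
  using assms by (simp_all add: prob_space)

lemma (in prob_space) integrable_bounded_comp:
  fixes f :: "real \<Rightarrow> real" and Y :: "'a \<Rightarrow> real"
  assumes [measurable]: "Y \<in> borel_measurable M" "f \<in> borel_measurable borel"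
    and "\<And>y. 0 \<le> f y" "\<And>y. f y \<le> B"
  shows "integrable M (\<lambda>\<omega>. f (Y \<omega>))"
  using assms by (intro integrable_const_bound[where B=B]) auto

lemma (in prob_space) expectation_nonzero:
  fixes Y :: "'a \<Rightarrow> real"
  assumes [measurable]: "Y \<in> borel_measurable M"
  shows "(\<integral>\<omega>. indicat_real (- {0}) (Y \<omega>) \<partial>M) = prob {\<omega> \<in> space M. Y \<omega> \<noteq> 0}"
proof -
  have "(\<integral>\<omega>. indicat_real (- {0}) (Y \<omega>) \<partial>M) = (\<integral>\<omega>. indicat_real {\<omega> \<in> space M. Y \<omega> \<noteq> 0} \<omega> \<partial>M)"
    by (intro Bochner_Integration.integral_cong) (auto simp: indicator_def)
  then show ?thesis by simp
qed

lemma tendsto_at_right_0I: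
  fixes f :: "real \<Rightarrow> real"
  assumes "\<And>Q. (\<And>n. 0 < Q n) \<Longrightarrow> Q \<longlonglongrightarrow> 0 \<Longrightarrow> (\<lambda>n. f (Q n)) \<longlonglongrightarrow> l"
  shows "(f \<longlongrightarrow> l) (at_right 0)"
  unfolding tendsto_at_iff_sequentially comp_def using assms by auto

lemma tail_integrand:
  fixes y :: real
  shows "0 \<le> indicat_real A y / (1 + y\<^sup>2)" "\<bar>indicat_real A y / (1 + y\<^sup>2)\<bar> \<le> 1"
proof -
  have "0 < 1 + y\<^sup>2" by (simp add: add_pos_nonneg)
  then show "0 \<le> indicat_real A y / (1 + y\<^sup>2)" "\<bar>indicat_real A y / (1 + y\<^sup>2)\<bar> \<le> 1"
    by (auto simp: indicator_def)
qed

text \<open>The value \<open>\<kappa> = c / (\<sigma> + c)\<close> stands for the scale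
  \<open>\<sigma> / c\<close>. In noise units the shrinkage is then \<open>rescale c\<close>, so
  \<open>c\<close> is the noise level measured in units of the scale.\<close>

lemma interior_obtain:
  fixes \<sigma> \<kappa> :: real
  assumes "0 < \<sigma>" "\<kappa> \<in> {0..1}" "\<kappa> \<noteq> 0" "\<kappa> \<noteq> 1"
  obtains c where "0 < c" "\<kappa> = c / (\<sigma> + c)"
proof
  have k: "0 < \<kappa>" "0 < 1 - \<kappa>" using assms by auto
  show "0 < \<sigma> * \<kappa> / (1 - \<kappa>)" using k assms by simp
  have "\<sigma> + \<sigma> * \<kappa> / (1 - \<kappa>) = \<sigma> / (1 - \<kappa>)" using k by (simp add: field_simps)
  then show "\<kappa> = \<sigma> * \<kappa> / (1 - \<kappa>) / (\<sigma> + \<sigma> * \<kappa> / (1 - \<kappa>))" using k assms by simp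
qed

context shrinkage
begin

lemma measurable_noise_risk [measurable]: "noise_risk \<in> borel_measurable borel"
  unfolding noise_risk_def[abs_def] by measurable

lemma measurable_shrink_energy [measurable]: "shrink_energy \<in> borel_measurable borel"
  unfolding shrink_energy_def[abs_def] by measurable

lemma measurable_defect [measurable]: "defect \<in> borel_measurable borel"
  unfolding defect_def[abs_def] by measurable

lemma measurable_risk_slope [measurable]: "risk_slope a \<in> borel_measurable borel"
  unfolding risk_slope_def[abs_def] by measurable

lemma S_sq_le: "(S u)\<^sup>2 \<le> T\<^sup>2"
  using abs_S_le_T[of u] T_pos by (metis abs_le_square_iff abs_of_pos)

lemma err_sq_le: "(z - S u)\<^sup>2 \<le> 2 * z\<^sup>2 + 2 * T\<^sup>2"
proof -
  have "0 \<le> (z + S u)\<^sup>2" by simp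
  then have "(z - S u)\<^sup>2 \<le> 2 * z\<^sup>2 + 2 * (S u)\<^sup>2" by (simp add: power2_eq_square algebra_simps)
  then show ?thesis using S_sq_le[of u] by linarith
qed

lemma noise_risk_le: "noise_risk b \<le> 2 + 2 * T\<^sup>2"
proof -
  have "noise_risk b \<le> (\<integral>z. 2 * z\<^sup>2 + 2 * T\<^sup>2 \<partial>gauss)"
    unfolding noise_risk_def by (rule integral_mono) (simp_all add: err_sq_le)
  then show ?thesis by simp
qed

lemma shrink_energy_le_T: "shrink_energy b \<le> T\<^sup>2"
proof -
  have "shrink_energy b \<le> (\<integral>z. T\<^sup>2 \<partial>gauss)"
    unfolding shrink_energy_def by (rule integral_mono) (simp_all add: S_sq_le)
  then show ?thesis by simp
qed

lemma defect_le: "defect b \<le> T\<^sup>2 + (T + 1)\<^sup>2"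
proof -
  have "b\<^sup>2 * indicator {- (T + 1)..T + 1} b \<le> (T + 1)\<^sup>2"
  proof (cases "b \<in> {- (T + 1)..T + 1}")
    case True
    then have "\<bar>b\<bar> \<le> \<bar>T + 1\<bar>" using T_pos by auto
    then show ?thesis using True by (simp add: abs_le_square_iff)
  qed simp
  then show ?thesis using shrink_energy_le_T[of b] by (simp add: defect_def)
qed

lemma risk_slope_smooth: "risk_slope a b = 1 - smooth_deriv a S b 0"
  by (simp add: risk_slope_def smooth_deriv_def slope_weight_def)

definition tail_const :: real where
  "tail_const = 1 / risk_const + 1332 + 2 * (1 + 3 / (1 - \<nu>)\<^sup>2)"

lemma tail_const_ge_1: "1 \<le> tail_const"
proof -
  have "0 < 1 / risk_const" "0 \<le> 3 / (1 - \<nu>)\<^sup>2" using risk_const by auto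
  then show ?thesis by (simp add: tail_const_def)
qed

section \<open>Averages over the signal, split at signal zero\<close>

context
  fixes M :: "'a measure" and Y :: "'a \<Rightarrow> real"
  assumes M: "prob_space M" and Y [measurable]: "Y \<in> borel_measurable M"
begin

interpretation prob_space M by (rule M)

lemma integrable_nonzero_parts:
  "integrable M (\<lambda>\<omega>. indicat_real (- {0}) (Y \<omega>))"
  "integrable M (\<lambda>\<omega>. indicat_real (- {0}) (Y \<omega>) * defect (Y \<omega>))"
  "integrable M (\<lambda>\<omega>. indicat_real (- {0}) (Y \<omega>) / (1 + (Y \<omega>)\<^sup>2))"
  by (rule integrable_bounded_comp[OF Y, where B=1] integrable_bounded_comp[OF Y, where B="T\<^sup>2 + (T + 1)\<^sup>2"];
    auto simp: indicator_def defect_nonneg defect_le divide_simps add_pos_nonneg; fail)+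

text \<open>The bound is exact where \<open>Y\<close> vanishes and uses
  \<open>noise_risk_lower\<close> elsewhere. Keeping the risk at 0 explicit makes it possible to
  show later that it is small at an optimal scale.\<close>

lemma expectation_noise_risk_lower:
  fixes \<epsilon> :: real
  defines "\<epsilon> \<equiv> prob {\<omega> \<in> space M. Y \<omega> \<noteq> 0}"
  shows "(1 - \<epsilon>) * noise_risk 0 + \<epsilon> + risk_const * (\<integral>\<omega>. indicat_real (- {0}) (Y \<omega>) * defect (Y \<omega>) \<partial>M)
     - tail_const * (\<integral>\<omega>. indicat_real (- {0}) (Y \<omega>) / (1 + (Y \<omega>)\<^sup>2) \<partial>M) \<le> (\<integral>\<omega>. noise_risk (Y \<omega>) \<partial>M)"
proof -
  let ?I = "indicat_real (- {0})"
  let ?g = "\<lambda>\<omega>. noise_risk 0 + (1 - noise_risk 0) * ?I (Y \<omega>) + risk_const * (?I (Y \<omega>) * defect (Y \<omega>))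
      + (- tail_const) * (?I (Y \<omega>) / (1 + (Y \<omega>)\<^sup>2))"
  have n: "integrable M (\<lambda>\<omega>. noise_risk (Y \<omega>))"
    by (rule integrable_bounded_comp[OF Y, where B="2 + 2 * T\<^sup>2"]) (auto simp: noise_risk_nonneg noise_risk_le)
  have "(\<integral>\<omega>. ?g \<omega> \<partial>M) \<le> (\<integral>\<omega>. noise_risk (Y \<omega>) \<partial>M)"
  proof (rule integral_mono)
    fix \<omega>
    show "?g \<omega> \<le> noise_risk (Y \<omega>)"
      using noise_risk_lower[of "Y \<omega>", folded tail_const_def] by (cases "Y \<omega> = 0") auto
  qed (rule affine_integral(1)[OF integrable_nonzero_parts] n)+
  also have "(\<integral>\<omega>. ?g \<omega> \<partial>M)
     = noise_risk 0 + (1 - noise_risk 0) * \<epsilon> + risk_const * (\<integral>\<omega>. ?I (Y \<omega>) * defect (Y \<omega>) \<partial>M)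
      - tail_const * (\<integral>\<omega>. ?I (Y \<omega>) / (1 + (Y \<omega>)\<^sup>2) \<partial>M)"
    unfolding affine_integral(2)[OF integrable_nonzero_parts] expectation_nonzero[OF Y] \<epsilon>_def by simp
  finally show ?thesis by (simp add: algebra_simps)
qed

lemma expectation_risk_slope_upper:
  fixes \<epsilon> :: real
  defines "\<epsilon> \<equiv> prob {\<omega> \<in> space M. Y \<omega> \<noteq> 0}"
  assumes \<eta>: "0 < \<eta>" and a: "0 \<le> a" and Yi: "integrable M Y"
  shows "(\<integral>\<omega>. risk_slope a (Y \<omega>) \<partial>M) \<le> \<epsilon> + \<eta> * (\<integral>z. (slope_weight a z)\<^sup>2 \<partial>gauss)
     + (1 - \<epsilon>) * noise_risk 0 / (4 * \<eta>)
     + (1 / (4 * \<eta>) + a) * (\<integral>\<omega>. indicat_real (- {0}) (Y \<omega>) * defect (Y \<omega>) \<partial>M)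
     + a * curvature_const * (\<integral>\<omega>. indicat_real (- {0}) (Y \<omega>) / (1 + (Y \<omega>)\<^sup>2) \<partial>M)"
proof -
  let ?I = "indicat_real (- {0})" and ?Q = "\<integral>z. (slope_weight a z)\<^sup>2 \<partial>gauss"
  obtain C where C: "\<And>t b. t \<in> {-1<..<1} \<Longrightarrow> \<bar>smooth_deriv a S b t\<bar> \<le> C * (1 + \<bar>b\<bar>)"
    using smooth_deriv_bound[OF S_measurable abs_S_le_T a] by metis
  have n: "integrable M (\<lambda>\<omega>. risk_slope a (Y \<omega>))"
  proof (rule Bochner_Integration.integrable_bound)
    show "integrable M (\<lambda>\<omega>. 1 + C * (1 + \<bar>Y \<omega>\<bar>))" using Yi by simp
    have "\<bar>risk_slope a b\<bar> \<le> 1 + C * (1 + \<bar>b\<bar>)" for b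
      using C[of 0 b] by (simp add: risk_slope_smooth)
    then show "AE \<omega> in M. norm (risk_slope a (Y \<omega>)) \<le> norm (1 + C * (1 + \<bar>Y \<omega>\<bar>))"
      by (auto intro: order_trans[OF _ abs_ge_self])
  qed simp
  let ?z = "?Q * \<eta> + noise_risk 0 / (4 * \<eta>)"
  let ?g = "\<lambda>\<omega>. ?z + (1 - noise_risk 0 / (4 * \<eta>)) * ?I (Y \<omega>) + (1 / (4 * \<eta>) + a) * (?I (Y \<omega>) * defect (Y \<omega>))
      + a * curvature_const * (?I (Y \<omega>) / (1 + (Y \<omega>)\<^sup>2))"
  have "(\<integral>\<omega>. risk_slope a (Y \<omega>) \<partial>M) \<le> (\<integral>\<omega>. ?g \<omega> \<partial>M)"
  proof (rule integral_mono)
    fix \<omega>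
    show "risk_slope a (Y \<omega>) \<le> ?g \<omega>"
    proof (cases "Y \<omega> = 0")
      case True
      then show ?thesis using risk_slope_zero_upper[OF \<eta>, of a] by (simp add: mult.commute)
    next
      case False
      then show ?thesis using risk_slope_upper[OF \<eta> a, of "Y \<omega>"] by (simp add: mult.commute)
    qed
  qed (rule affine_integral(1)[OF integrable_nonzero_parts] n)+
  also have "(\<integral>\<omega>. ?g \<omega> \<partial>M)
    = ?z + (1 - noise_risk 0 / (4 * \<eta>)) * \<epsilon> + (1 / (4 * \<eta>) + a) * (\<integral>\<omega>. ?I (Y \<omega>) * defect (Y \<omega>) \<partial>M)
      + a * curvature_const * (\<integral>\<omega>. ?I (Y \<omega>) / (1 + (Y \<omega>)\<^sup>2) \<partial>M)"
    unfolding affine_integral(2)[OF integrable_nonzero_parts] expectation_nonzero[OF Y] \<epsilon>_def by simp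
  also have "\<dots> = \<epsilon> + \<eta> * ?Q + (1 - \<epsilon>) * noise_risk 0 / (4 * \<eta>)
     + (1 / (4 * \<eta>) + a) * (\<integral>\<omega>. ?I (Y \<omega>) * defect (Y \<omega>) \<partial>M)
     + a * curvature_const * (\<integral>\<omega>. ?I (Y \<omega>) / (1 + (Y \<omega>)\<^sup>2) \<partial>M)"
    using \<eta> by (simp add: diff_divide_distrib left_diff_distrib right_diff_distrib mult.commute)
  finally show ?thesis .
qed

end

lemma noise_risk_tendsto:
  assumes B: "filterlim B at_top sequentially"
  shows "(\<lambda>n. noise_risk (B n)) \<longlonglongrightarrow> 1"
proof -
  have "(\<lambda>n. noise_risk (B n)) \<longlonglongrightarrow> (\<integral>z. z\<^sup>2 \<partial>gauss)"
    unfolding noise_risk_def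
  proof (rule integral_dominated_convergence[where w="\<lambda>z. 2 * z\<^sup>2 + 2 * T\<^sup>2"])
    show "AE z in gauss. (\<lambda>n. (z - S (B n + z))\<^sup>2) \<longlonglongrightarrow> z\<^sup>2"
    proof (rule AE_I2)
      fix z
      have "filterlim (\<lambda>n. B n + z) at_top sequentially"
        using filterlim_tendsto_add_at_top[OF tendsto_const B, of z] by (simp add: add.commute)
      then have "(\<lambda>n. S (B n + z)) \<longlonglongrightarrow> 0" by (rule filterlim_compose[OF S_tendsto])
      then have "(\<lambda>n. (z - S (B n + z))\<^sup>2) \<longlonglongrightarrow> (z - 0)\<^sup>2" by (intro tendsto_intros)
      then show "(\<lambda>n. (z - S (B n + z))\<^sup>2) \<longlonglongrightarrow> z\<^sup>2" by simp
    qed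
  qed (auto simp: err_sq_le)
  then show ?thesis by simp
qed

definition rescale :: "real \<Rightarrow> real \<Rightarrow> real" where
  "rescale c u = S (c * u) / c"

lemma measurable_rescale [measurable]: "rescale c \<in> borel_measurable borel"
  unfolding rescale_def[abs_def] by measurable

lemma shrinkage_rescale: "0 < c \<Longrightarrow> shrinkage (rescale c) (T / c) \<nu>"
  using shrinkage_scale[of c] by (simp add: rescale_def[abs_def])

text \<open>As \<open>c\<close> tends to 0 the threshold \<open>T / c\<close> outgrows the noise, so
  pure noise is removed entirely.\<close>

lemma noise_risk_rescale_tendsto:
  assumes C: "C \<longlonglongrightarrow> 0" "\<And>n. 0 < C n"
  shows "(\<lambda>n. shrinkage.noise_risk (rescale (C n)) 0) \<longlonglongrightarrow> 0"
proof -
  have eq: "shrinkage.noise_risk (rescale (C n)) 0 = (\<integral>z. (z - rescale (C n) z)\<^sup>2 \<partial>gauss)" for n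
    using shrinkage.noise_risk_def[OF shrinkage_rescale[OF C(2)]] by simp
  have "(\<lambda>n. \<integral>z. (z - rescale (C n) z)\<^sup>2 \<partial>gauss) \<longlonglongrightarrow> (\<integral>z. 0 \<partial>gauss)"
  proof (rule integral_dominated_convergence[where w="\<lambda>z. 4 * z\<^sup>2"])
    show "AE z in gauss. (\<lambda>n. (z - rescale (C n) z)\<^sup>2) \<longlonglongrightarrow> 0"
    proof (rule AE_I2)
      fix z :: real
      have "(\<lambda>n. \<bar>C n * z\<bar>) \<longlonglongrightarrow> \<bar>0 * z\<bar>" by (intro tendsto_intros C)
      then have "\<forall>\<^sub>F n in sequentially. \<bar>C n * z\<bar> < T" using T_pos by (intro order_tendstoD) auto
      then have "\<forall>\<^sub>F n in sequentially. (z - rescale (C n) z)\<^sup>2 = 0"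
      proof eventually_elim
        case (elim n)
        then have "S (C n * z) = C n * z" by (intro S_small_abs) simp
        then show ?case using C(2)[of n] by (simp add: rescale_def)
      qed
      then show "(\<lambda>n. (z - rescale (C n) z)\<^sup>2) \<longlonglongrightarrow> 0" by (simp add: tendsto_eventually)
    qed
    show "AE z in gauss. norm ((z - rescale (C n) z)\<^sup>2) \<le> 4 * z\<^sup>2" for n
    proof (rule AE_I2)
      fix z
      have "\<bar>rescale (C n) z\<bar> \<le> \<bar>z\<bar>" using shrinkage.abs_S_le[OF shrinkage_rescale[OF C(2)]] .
      then have "\<bar>z - rescale (C n) z\<bar> \<le> 2 * \<bar>z\<bar>" by linarith
      then have "\<bar>z - rescale (C n) z\<bar>\<^sup>2 \<le> (2 * \<bar>z\<bar>)\<^sup>2" by (intro power_mono) auto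
      then show "norm ((z - rescale (C n) z)\<^sup>2) \<le> 4 * z\<^sup>2" by (simp add: power_mult_distrib)
    qed
    show "(\<lambda>z. (z - rescale (C n) z)\<^sup>2) \<in> borel_measurable gauss" for n
      unfolding rescale_def by simp
  qed auto
  then show ?thesis unfolding eq by simp
qed

end

context shrinkage_model
begin

definition density :: real where
  "density = prob {\<omega> \<in> space M. X \<omega> \<noteq> 0}"

text \<open>A smoothed probability that the signal is nonzero but not large compared with the
  noise.\<close>

definition tail :: "real \<Rightarrow> real" where
  "tail \<sigma> = (\<integral>\<omega>. indicat_real (- {0}) (X \<omega> / \<sigma>) / (1 + (X \<omega> / \<sigma>)\<^sup>2) \<partial>M)"

lemma density_scaled: "0 < \<sigma> \<Longrightarrow> prob {\<omega> \<in> space M. X \<omega> / \<sigma> \<noteq> 0} = density"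
  by (simp add: density_def)

lemma density_le_1: "density \<le> 1"
  by (simp add: density_def)

lemma tail_nonneg: "0 \<le> tail \<sigma>"
  unfolding tail_def by (intro Bochner_Integration.integral_nonneg) (auto intro!: divide_nonneg_nonneg)

lemma tail_tendsto: "(tail \<longlongrightarrow> 0) (at_right 0)"
proof (rule tendsto_at_right_0I)
  fix Q :: "nat \<Rightarrow> real" assume Q: "\<And>n. 0 < Q n" "Q \<longlonglongrightarrow> 0"
  have "(\<lambda>n. tail (Q n)) \<longlonglongrightarrow> (\<integral>\<omega>. 0 \<partial>M)"
    unfolding tail_def
  proof (rule integral_dominated_convergence[where w="\<lambda>_. 1"])
    show "AE \<omega> in M. norm (indicat_real (- {0}) (X \<omega> / Q n) / (1 + (X \<omega> / Q n)\<^sup>2)) \<le> 1" for n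
      using tail_integrand by simp
    show "AE \<omega> in M. (\<lambda>n. indicat_real (- {0}) (X \<omega> / Q n) / (1 + (X \<omega> / Q n)\<^sup>2)) \<longlonglongrightarrow> 0"
    proof (rule AE_I2)
      fix \<omega>
      show "(\<lambda>n. indicat_real (- {0}) (X \<omega> / Q n) / (1 + (X \<omega> / Q n)\<^sup>2)) \<longlonglongrightarrow> 0"
      proof (cases "X \<omega> = 0")
        case False
        have eq: "indicat_real (- {0}) (X \<omega> / Q n) / (1 + (X \<omega> / Q n)\<^sup>2) = (Q n)\<^sup>2 / ((Q n)\<^sup>2 + (X \<omega>)\<^sup>2)" for n
        proof -
          have "0 < (Q n)\<^sup>2" using Q(1)[of n] by simp
          then show ?thesis using False Q(1)[of n] by (simp add: power_divide divide_simps)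
        qed
        have "(\<lambda>n. (Q n)\<^sup>2 / ((Q n)\<^sup>2 + (X \<omega>)\<^sup>2)) \<longlonglongrightarrow> 0\<^sup>2 / (0\<^sup>2 + (X \<omega>)\<^sup>2)"
          using False by (intro tendsto_intros Q) auto
        then show ?thesis unfolding eq by simp
      qed simp
    qed
  qed auto
  then show "(\<lambda>n. tail (Q n)) \<longlonglongrightarrow> 0" by simp
qed

lemma risk_rescale:
  assumes \<sigma>: "0 < \<sigma>" and c: "0 < c"
  shows "risk \<sigma> (c / (\<sigma> + c)) = \<sigma>\<^sup>2 * (\<integral>\<omega>. shrinkage.noise_risk (rescale c) (X \<omega> / \<sigma>) \<partial>M)"
proof -
  define \<kappa> where "\<kappa> = c / (\<sigma> + c)"
  have k: "\<kappa> \<in> {0..1}" "\<kappa> \<noteq> 0" using assms by (auto simp: \<kappa>_def)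
  have "1 - \<kappa> = \<sigma> / (\<sigma> + c)" using assms by (simp add: \<kappa>_def field_simps)
  then have s: "(1 - \<kappa>) / \<kappa> = \<sigma> / c" using assms by (simp add: \<kappa>_def)
  have e: "err \<sigma> \<kappa> \<omega> = \<sigma> * (Z \<omega> - rescale c (X \<omega> / \<sigma> + Z \<omega>))" for \<omega>
  proof -
    have "(X \<omega> + \<sigma> * Z \<omega>) / (\<sigma> / c) = c * (X \<omega> / \<sigma> + Z \<omega>)" using assms by (simp add: field_simps)
    then show ?thesis unfolding err_def clip_def scaled_def s rescale_def using k by (simp add: right_diff_distrib)
  qed
  have i: "integrable M (\<lambda>\<omega>. (\<sigma> * (Z \<omega> - rescale c (X \<omega> / \<sigma> + Z \<omega>)))\<^sup>2)"
    using err_sq_integrable[OF k(1), of \<sigma>] \<sigma> unfolding e by simp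
  have "risk \<sigma> \<kappa> = (\<integral>\<omega>. (\<integral>z. (\<sigma> * (z - rescale c (X \<omega> / \<sigma> + z)))\<^sup>2 \<partial>gauss) \<partial>M)"
    unfolding risk_def e by (rule integral_XZ[OF _ i]) measurable
  also have "\<dots> = (\<integral>\<omega>. \<sigma>\<^sup>2 * shrinkage.noise_risk (rescale c) (X \<omega> / \<sigma>) \<partial>M)"
    unfolding shrinkage.noise_risk_def[OF shrinkage_rescale[OF c]] power_mult_distrib by simp
  finally show ?thesis by (simp add: \<kappa>_def)
qed

text \<open>The two extreme scales are treated by hand, at \<open>\<kappa> = 0\<close> with
  \<open>1 - 1 / (1 + b^2) \<le> b^2\<close>. For the others the estimate is applied to
  \<open>rescale c\<close>, whose \<open>tail_const\<close> is the same because it depends on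
  \<open>\<nu>\<close> only.\<close>

lemma risk_lower:
  assumes \<sigma>: "0 < \<sigma>" and \<kappa>: "\<kappa> \<in> {0..1}"
  shows "\<sigma>\<^sup>2 * (density - tail_const * tail \<sigma>) \<le> risk \<sigma> \<kappa>"
proof -
  consider "\<kappa> = 0" | "\<kappa> = 1" | "\<kappa> \<noteq> 0" "\<kappa> \<noteq> 1" by blast
  then show ?thesis
  proof cases
    case 1
    let ?b = "\<lambda>\<omega>. X \<omega> / \<sigma>"
    have t: "tail \<sigma> \<le> tail_const * tail \<sigma>" using mult_right_mono[OF tail_const_ge_1 tail_nonneg] by simp
    have i: "integrable M (\<lambda>\<omega>. indicat_real (- {0}) (?b \<omega>))" by (rule integrable_const_bound[where B=1]) auto
    have s: "integrable M (\<lambda>\<omega>. indicat_real (- {0}) (?b \<omega>) / (1 + (?b \<omega>)\<^sup>2))"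
      by (rule integrable_const_bound[where B=1]) (use tail_integrand in auto)
    have x: "integrable M (\<lambda>\<omega>. (?b \<omega>)\<^sup>2)" using X_sq by (simp add: power_divide)
    have "(\<integral>\<omega>. indicat_real (- {0}) (?b \<omega>) - indicat_real (- {0}) (?b \<omega>) / (1 + (?b \<omega>)\<^sup>2) \<partial>M) \<le> (\<integral>\<omega>. (?b \<omega>)\<^sup>2 \<partial>M)"
    proof (rule integral_mono)
      fix \<omega>
      have "1 - 1 / (1 + b\<^sup>2) \<le> b\<^sup>2" for b :: real
      proof -
        have pos: "0 < 1 + b\<^sup>2" by (simp add: add_pos_nonneg)
        then have "1 - 1 / (1 + b\<^sup>2) = b\<^sup>2 / (1 + b\<^sup>2)" by (simp add: field_simps)
        also have "\<dots> \<le> b\<^sup>2 / 1" using pos by (intro divide_left_mono) auto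
        finally show ?thesis by simp
      qed
      then show "indicat_real (- {0}) (?b \<omega>) - indicat_real (- {0}) (?b \<omega>) / (1 + (?b \<omega>)\<^sup>2) \<le> (?b \<omega>)\<^sup>2"
        by (auto simp: indicator_def simp del: power_divide)
    qed (use i s x in auto)
    moreover have "(\<integral>\<omega>. indicat_real (- {0}) (?b \<omega>) - indicat_real (- {0}) (?b \<omega>) / (1 + (?b \<omega>)\<^sup>2) \<partial>M) = density - tail \<sigma>"
      unfolding Bochner_Integration.integral_diff[OF i s] tail_def
      using expectation_nonzero[of ?b] density_scaled[OF \<sigma>] by simp
    moreover have "(\<integral>\<omega>. (?b \<omega>)\<^sup>2 \<partial>M) = risk \<sigma> 0 / \<sigma>\<^sup>2" unfolding risk_zero by (simp add: power_divide)
    ultimately have "density - tail_const * tail \<sigma> \<le> risk \<sigma> 0 / \<sigma>\<^sup>2" using t by linarith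
    then show ?thesis using 1 \<sigma> by (simp add: field_simps)
  next
    case 2
    have "density - tail_const * tail \<sigma> \<le> 1"
      using density_le_1 tail_nonneg[of \<sigma>] tail_const_ge_1 mult_nonneg_nonneg[of tail_const "tail \<sigma>"] by linarith
    then have "\<sigma>\<^sup>2 * (density - tail_const * tail \<sigma>) \<le> \<sigma>\<^sup>2 * 1" by (intro mult_left_mono) auto
    then show ?thesis using 2 by (simp add: risk_one)
  next
    case 3
    obtain c where c: "0 < c" "\<kappa> = c / (\<sigma> + c)" using interior_obtain[OF \<sigma> \<kappa> 3] by metis
    interpret A: shrinkage "rescale c" "T / c" \<nu> by (rule shrinkage_rescale[OF c(1)])
    let ?r = "\<integral>\<omega>. A.noise_risk (X \<omega> / \<sigma>) \<partial>M"
    let ?d = "\<integral>\<omega>. indicat_real (- {0}) (X \<omega> / \<sigma>) * A.defect (X \<omega> / \<sigma>) \<partial>M"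
    have "(1 - density) * A.noise_risk 0 + density + risk_const * ?d
       - tail_const * tail \<sigma> \<le> ?r"
      using A.expectation_noise_risk_lower[OF prob_space_axioms, of "\<lambda>\<omega>. X \<omega> / \<sigma>"] density_scaled[OF \<sigma>]
      unfolding tail_def by simp
    moreover have "0 \<le> (1 - density) * A.noise_risk 0" using density_le_1 A.noise_risk_nonneg by simp
    moreover have "0 \<le> risk_const * ?d"
      using risk_const A.defect_nonneg by (intro mult_nonneg_nonneg Bochner_Integration.integral_nonneg) auto
    ultimately have "density - tail_const * tail \<sigma> \<le> ?r" by linarith
    then have "\<sigma>\<^sup>2 * (density - tail_const * tail \<sigma>) \<le> \<sigma>\<^sup>2 * ?r"
      by (intro mult_left_mono) auto
    then show ?thesis unfolding c(2) risk_rescale[OF \<sigma> c(1)] .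
  qed
qed

lemma expected_noise_risk_tendsto:
  assumes c: "0 < c"
  shows "((\<lambda>\<sigma>. \<integral>\<omega>. shrinkage.noise_risk (rescale c) (X \<omega> / \<sigma>) \<partial>M) \<longlongrightarrow>
    (1 - density) * shrinkage.noise_risk (rescale c) 0 + density) (at_right 0)"
proof (rule tendsto_at_right_0I)
  interpret A: shrinkage "rescale c" "T / c" \<nu> by (rule shrinkage_rescale[OF c])
  fix Q :: "nat \<Rightarrow> real" assume Q: "\<And>n. 0 < Q n" "Q \<longlonglongrightarrow> 0"
  let ?L = "\<lambda>\<omega>. A.noise_risk 0 + (1 - A.noise_risk 0) * indicat_real (- {0}) (X \<omega>)"
  have inv: "filterlim (\<lambda>n. inverse (Q n)) at_top sequentially"
    using Q by (intro filterlim_inverse_at_top) auto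
  have lim: "(\<lambda>n. A.noise_risk (x / Q n)) \<longlonglongrightarrow> 1" if "0 < x" for x
    using filterlim_tendsto_pos_mult_at_top[OF tendsto_const that inv]
    by (intro A.noise_risk_tendsto) (simp add: divide_inverse)
  have "(\<lambda>n. \<integral>\<omega>. A.noise_risk (X \<omega> / Q n) \<partial>M) \<longlonglongrightarrow> (\<integral>\<omega>. ?L \<omega> \<partial>M)"
  proof (rule integral_dominated_convergence[where w="\<lambda>_. 2 + 2 * (T / c)\<^sup>2"])
    show "AE \<omega> in M. (\<lambda>n. A.noise_risk (X \<omega> / Q n)) \<longlonglongrightarrow> ?L \<omega>"
    proof (rule AE_I2)
      fix \<omega>
      consider "X \<omega> = 0" | "0 < X \<omega>" | "0 < - X \<omega>" by linarith
      then show "(\<lambda>n. A.noise_risk (X \<omega> / Q n)) \<longlonglongrightarrow> ?L \<omega>"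
      proof cases
        case 3
        then show ?thesis using lim[OF 3] by (simp add: A.noise_risk_uminus)
      qed (use lim in auto)
    qed
    show "AE \<omega> in M. norm (A.noise_risk (X \<omega> / Q n)) \<le> 2 + 2 * (T / c)\<^sup>2" for n
      using A.noise_risk_nonneg A.noise_risk_le by auto
  qed auto
  moreover have "(\<integral>\<omega>. ?L \<omega> \<partial>M) = (1 - density) * A.noise_risk 0 + density"
  proof -
    have "integrable M (\<lambda>\<omega>. indicat_real (- {0}) (X \<omega>))" by (rule integrable_const_bound[where B=1]) auto
    then show ?thesis
      using expectation_nonzero[OF X_measurable] by (simp add: prob_space density_def algebra_simps)
  qed
  ultimately show "(\<lambda>n. \<integral>\<omega>. A.noise_risk (X \<omega> / Q n) \<partial>M) \<longlonglongrightarrow> (1 - density) * A.noise_risk 0 + density" by simp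
qed

text \<open>The order of the limits matters: first \<open>c\<close> is taken so small that pure
  noise costs less than \<eta>, then \<sigma> tends to 0 for this fixed \<open>c\<close>, so that
  each nonzero signal ends up far above the threshold and costs \<sigma>^2.\<close>

lemma opt_risk_upper:
  assumes \<eta>: "0 < \<eta>"
  shows "\<forall>\<^sub>F \<sigma> in at_right 0. opt_risk \<sigma> < \<sigma>\<^sup>2 * (density + \<eta>)"
proof -
  have "(\<lambda>n. shrinkage.noise_risk (rescale (inverse (real (Suc n)))) 0) \<longlonglongrightarrow> 0"
    by (intro noise_risk_rescale_tendsto LIMSEQ_inverse_real_of_nat) simp
  then have "\<forall>\<^sub>F n in sequentially. shrinkage.noise_risk (rescale (inverse (real (Suc n)))) 0 < \<eta>"
    using \<eta> by (intro order_tendstoD) auto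
  then obtain n where n: "shrinkage.noise_risk (rescale (inverse (real (Suc n)))) 0 < \<eta>"
    using eventually_happens[of _ sequentially] by auto
  define c where "c = inverse (real (Suc n))"
  have c: "0 < c" by (simp add: c_def)
  interpret A: shrinkage "rescale c" "T / c" \<nu> by (rule shrinkage_rescale[OF c])
  have "0 \<le> density" by (simp add: density_def)
  then have "(1 - density) * A.noise_risk 0 \<le> 1 * A.noise_risk 0"
    using A.noise_risk_nonneg by (intro mult_right_mono) auto
  then have "(1 - density) * A.noise_risk 0 + density < density + \<eta>" using n by (simp add: c_def)
  then have "\<forall>\<^sub>F \<sigma> in at_right 0. (\<integral>\<omega>. A.noise_risk (X \<omega> / \<sigma>) \<partial>M) < density + \<eta>"
    by (rule order_tendstoD(2)[OF expected_noise_risk_tendsto[OF c]])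
  moreover note eventually_at_right_less[of "0::real"]
  ultimately show ?thesis
  proof eventually_elim
    case (elim \<sigma>)
    have "opt_risk \<sigma> \<le> risk \<sigma> (c / (\<sigma> + c))" using elim c by (intro opt_risk_le) auto
    also have "\<dots> < \<sigma>\<^sup>2 * (density + \<eta>)" unfolding risk_rescale[OF elim(2) c]
      using elim by (intro mult_strict_left_mono) auto
    finally show ?case .
  qed
qed

lemma opt_risk_lower: "0 < \<sigma> \<Longrightarrow> \<sigma>\<^sup>2 * (density - tail_const * tail \<sigma>) \<le> opt_risk \<sigma>"
  unfolding opt_risk_def by (intro cINF_greatest risk_lower) auto

lemma opt_risk_ratio: "((\<lambda>v. opt_risk (sqrt v) / v) \<longlongrightarrow> density) (at_right 0)"
proof -
  have "((\<lambda>\<sigma>. opt_risk \<sigma> / \<sigma>\<^sup>2) \<longlongrightarrow> density) (at_right 0)"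
  proof (rule order_tendstoI)
    fix l assume l: "l < density"
    have "((\<lambda>\<sigma>. density - tail_const * tail \<sigma>) \<longlongrightarrow> density - tail_const * 0) (at_right 0)"
      by (intro tendsto_intros tail_tendsto)
    then have "\<forall>\<^sub>F \<sigma> in at_right 0. l < density - tail_const * tail \<sigma>"
      using l by (intro order_tendstoD) auto
    moreover note eventually_at_right_less[of "0::real"]
    ultimately show "\<forall>\<^sub>F \<sigma> in at_right 0. l < opt_risk \<sigma> / \<sigma>\<^sup>2"
    proof eventually_elim
      case (elim \<sigma>)
      then have "\<sigma>\<^sup>2 * l < \<sigma>\<^sup>2 * (density - tail_const * tail \<sigma>)" by (intro mult_strict_left_mono) auto
      then show ?case using opt_risk_lower[OF elim(2)] elim(2) by (simp add: field_simps)
    qed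
  next
    fix u assume "density < u"
    then have "\<forall>\<^sub>F \<sigma> in at_right 0. opt_risk \<sigma> < \<sigma>\<^sup>2 * (density + (u - density))" by (intro opt_risk_upper) simp
    moreover note eventually_at_right_less[of "0::real"]
    ultimately show "\<forall>\<^sub>F \<sigma> in at_right 0. opt_risk \<sigma> / \<sigma>\<^sup>2 < u"
      by eventually_elim (simp add: field_simps)
  qed
  moreover have "filterlim sqrt (at_right 0) (at_right (0::real))"
    unfolding filterlim_at
    by (auto simp: eventually_at_right_less intro!: tendsto_eq_intros eventually_mono[OF eventually_at_right_less])
  ultimately have "((\<lambda>v. opt_risk (sqrt v) / (sqrt v)\<^sup>2) \<longlongrightarrow> density) (at_right 0)"
    by (rule filterlim_compose)
  moreover have "\<forall>\<^sub>F v in at_right (0::real). opt_risk (sqrt v) / (sqrt v)\<^sup>2 = opt_risk (sqrt v) / v"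
    using eventually_at_right_less by eventually_elim simp
  ultimately show ?thesis by (simp add: tendsto_cong)
qed

text \<open>At an optimal scale the risk lies between \<open>opt_risk_upper\<close> and the lower
  bound with its extra terms. The risk at 0 and the mean defect are thereby bounded by multiples of
  \<open>e\<close>, and they make up the error terms of the slope bound.\<close>

lemma opt_slope_upper:
  assumes \<eta>: "0 < \<eta>" and a: "0 \<le> a"
  shows "\<forall>\<^sub>F \<sigma> in at_right 0. \<forall>c>0. risk \<sigma> (c / (\<sigma> + c)) = opt_risk \<sigma> \<longrightarrow>
    (\<integral>\<omega>. shrinkage.risk_slope (rescale c) a (X \<omega> / \<sigma>) \<partial>M) \<le> density + \<eta>"
proof -
  define Q where "Q = (\<integral>z. (slope_weight a z)\<^sup>2 \<partial>gauss)"
  have Q0: "0 \<le> Q" by (simp add: Q_def)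
  \<comment> \<open>\<open>h\<close> is the Young parameter and uses up half of \<eta>. It enters
    \<open>B\<close> through its inverse, so \<open>e\<close> is fixed after it, with
    \<open>B * e\<close> as the other half.\<close>
  define h where "h = \<eta> / (2 * (Q + 1))"
  have h: "0 < h" using \<eta> Q0 by (simp add: h_def)
  have hQ: "h * Q \<le> \<eta> / 2"
  proof -
    have "h * Q \<le> h * (Q + 1)" using h by simp
    also have "\<dots> = \<eta> / 2" using Q0 by (simp add: h_def field_simps)
    finally show ?thesis .
  qed
  define B where "B = (1 + tail_const) / (4 * h) + (1 / (4 * h) + a) * ((1 + tail_const) / risk_const) + a * curvature_const + 1"
  have B: "0 < B" unfolding B_def
    using h a tail_const_ge_1 risk_const curvature_const_nonneg
    by (intro add_nonneg_pos add_nonneg_nonneg mult_nonneg_nonneg divide_nonneg_nonneg) auto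
  define e where "e = \<eta> / 2 / B"
  have e: "0 < e" using \<eta> B by (simp add: e_def)
  have "\<forall>\<^sub>F \<sigma> in at_right 0. tail \<sigma> < e" using tail_tendsto e by (intro order_tendstoD)
  moreover note opt_risk_upper[OF e]
  moreover note eventually_at_right_less[of "0::real"]
  ultimately show ?thesis
  proof eventually_elim
    case (elim \<sigma>)
    note \<sigma> = elim(3)
    show ?case
    proof (intro allI impI)
      fix c :: real assume c: "0 < c" and opt: "risk \<sigma> (c / (\<sigma> + c)) = opt_risk \<sigma>"
      interpret A: shrinkage "rescale c" "T / c" \<nu> by (rule shrinkage_rescale[OF c])
      let ?r = "\<integral>\<omega>. A.noise_risk (X \<omega> / \<sigma>) \<partial>M"
      let ?s = "\<integral>\<omega>. A.risk_slope a (X \<omega> / \<sigma>) \<partial>M"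
      let ?n = "(1 - density) * A.noise_risk 0"
      let ?d = "\<integral>\<omega>. indicat_real (- {0}) (X \<omega> / \<sigma>) * A.defect (X \<omega> / \<sigma>) \<partial>M"
      have low: "?n + density + risk_const * ?d - tail_const * tail \<sigma> \<le> ?r"
        using A.expectation_noise_risk_lower[OF prob_space_axioms, of "\<lambda>\<omega>. X \<omega> / \<sigma>"] density_scaled[OF \<sigma>]
        unfolding tail_def by simp
      have "\<sigma>\<^sup>2 * ?r < \<sigma>\<^sup>2 * (density + e)"
        using elim(2) opt risk_rescale[OF \<sigma> c] by simp
      then have "?r < density + e" using \<sigma> by simp
      moreover have "tail_const * tail \<sigma> \<le> tail_const * e" using elim(1) tail_const_ge_1 by (intro mult_left_mono) auto
      ultimately have sum: "?n + risk_const * ?d \<le> (1 + tail_const) * e" using low by (simp add: algebra_simps)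
      have n0: "0 \<le> ?n" using density_le_1 A.noise_risk_nonneg by simp
      have d0: "0 \<le> ?d" using A.defect_nonneg by (intro Bochner_Integration.integral_nonneg) auto
      have n1: "?n \<le> (1 + tail_const) * e" using sum mult_nonneg_nonneg[of risk_const ?d] d0 risk_const by linarith
      have "risk_const * ?d \<le> (1 + tail_const) * e" using sum n0 by linarith
      then have d1: "?d \<le> (1 + tail_const) / risk_const * e" using risk_const by (simp add: field_simps)
      have "?s \<le> density + h * Q + ?n / (4 * h) + (1 / (4 * h) + a) * ?d + a * curvature_const * tail \<sigma>"
        using A.expectation_risk_slope_upper[OF prob_space_axioms, of "\<lambda>\<omega>. X \<omega> / \<sigma>" h a] h a density_scaled[OF \<sigma>] X_integrable
        unfolding tail_def Q_def by simp
      also have "?n / (4 * h) \<le> (1 + tail_const) * e / (4 * h)" using n1 h by (intro divide_right_mono) auto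
      also have "(1 / (4 * h) + a) * ?d \<le> (1 / (4 * h) + a) * ((1 + tail_const) / risk_const * e)"
        using d1 h a by (intro mult_left_mono) auto
      also have "a * curvature_const * tail \<sigma> \<le> a * curvature_const * e"
        using elim(1) a curvature_const_nonneg by (intro mult_left_mono) auto
      finally have "?s \<le> density + h * Q + (B - 1) * e"
        by (simp add: B_def algebra_simps)
      moreover have "B * e = \<eta> / 2" using B by (simp add: e_def)
      moreover have "(B - 1) * e \<le> B * e" using e by (intro mult_right_mono) auto
      ultimately show "?s \<le> density + \<eta>" using hQ by linarith
    qed
  qed
qed

end

section \<open>Growth of the optimal risk\<close>

lemma exp_quotient: "((\<lambda>t. (exp (m * t) - 1) / t) \<longlongrightarrow> (m::real)) (at_right 0)"
proof -
  have "((\<lambda>t. exp (m * t)) has_real_derivative m) (at 0)" by (auto intro!: derivative_eq_intros)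
  then have "((\<lambda>t. (exp (m * t) - 1) / t) \<longlongrightarrow> m) (at 0)" by (simp add: has_field_derivative_iff)
  then show ?thesis by (rule tendsto_within_subset) simp
qed

text \<open>The shrinkage is what a penalised least-squares problem removes, the scale acting only
  through the factor \<open>s powr q\<close> of the penalty. This is what allows different scales
  and noise levels to be compared pointwise.\<close>

locale penalized_model = shrinkage_model +
  fixes J :: "real \<Rightarrow> real" and q :: real
  assumes q_pos: "0 < q"
    and scaled_minimizes: "0 < s \<Longrightarrow>
      (scaled s u)\<^sup>2 / 2 + s powr q * J (u - scaled s u) \<le> (u - y)\<^sup>2 / 2 + s powr q * J y"
begin

text \<open>Adding the two optimality inequalities, weighted such that the penalties cancel.\<close>

lemma revealed_preference:
  fixes x z \<sigma>1 \<sigma>2 s1 s2 w1 w2 :: real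
  assumes s: "0 < s1" "0 < s2" and w: "0 < w1" "0 < w2" "w1 * s1 powr q = w2 * s2 powr q"
  defines "e1 \<equiv> \<sigma>1 * z - scaled s1 (x + \<sigma>1 * z)" and "e2 \<equiv> \<sigma>2 * z - scaled s2 (x + \<sigma>2 * z)"
  shows "(w2 - w1) * (e2\<^sup>2 - e1\<^sup>2) \<le> 2 * (w2 * \<sigma>2 - w1 * \<sigma>1) * (z * (e2 - e1))"
proof -
  have sc: "scaled s1 (x + \<sigma>1 * z) = \<sigma>1 * z - e1" "scaled s2 (x + \<sigma>2 * z) = \<sigma>2 * z - e2"
    by (simp_all add: e1_def e2_def)
  have cancel: "x + a - (a - e) = x + e" "(x + a) - (x + e) = a - e" for a e by simp_all
  have "(\<sigma>1 * z - e1)\<^sup>2 / 2 + s1 powr q * J (x + e1) \<le> (\<sigma>1 * z - e2)\<^sup>2 / 2 + s1 powr q * J (x + e2)"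
    using scaled_minimizes[OF s(1), of "x + \<sigma>1 * z" "x + e2"] unfolding sc cancel .
  then have "w1 * ((\<sigma>1 * z - e1)\<^sup>2 / 2 + s1 powr q * J (x + e1)) \<le> w1 * ((\<sigma>1 * z - e2)\<^sup>2 / 2 + s1 powr q * J (x + e2))"
    using w by (intro mult_left_mono) auto
  then have 1: "w1 * (\<sigma>1 * z - e1)\<^sup>2 / 2 + (w1 * s1 powr q) * J (x + e1) \<le> w1 * (\<sigma>1 * z - e2)\<^sup>2 / 2 + (w1 * s1 powr q) * J (x + e2)"
    by (simp only: distrib_left mult.assoc times_divide_eq_right)
  have "(\<sigma>2 * z - e2)\<^sup>2 / 2 + s2 powr q * J (x + e2) \<le> (\<sigma>2 * z - e1)\<^sup>2 / 2 + s2 powr q * J (x + e1)"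
    using scaled_minimizes[OF s(2), of "x + \<sigma>2 * z" "x + e1"] unfolding sc cancel .
  then have "w2 * ((\<sigma>2 * z - e2)\<^sup>2 / 2 + s2 powr q * J (x + e2)) \<le> w2 * ((\<sigma>2 * z - e1)\<^sup>2 / 2 + s2 powr q * J (x + e1))"
    using w by (intro mult_left_mono) auto
  then have 2: "w2 * (\<sigma>2 * z - e2)\<^sup>2 / 2 + (w1 * s1 powr q) * J (x + e2) \<le> w2 * (\<sigma>2 * z - e1)\<^sup>2 / 2 + (w1 * s1 powr q) * J (x + e1)"
    unfolding w(3) by (simp only: distrib_left mult.assoc times_divide_eq_right)
  have "w1 * (\<sigma>1 * z - e1)\<^sup>2 + w2 * (\<sigma>2 * z - e2)\<^sup>2 \<le> w1 * (\<sigma>1 * z - e2)\<^sup>2 + w2 * (\<sigma>2 * z - e1)\<^sup>2"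
    using 1 2 by linarith
  then show ?thesis by (simp add: power2_eq_square algebra_simps)
qed

lemma err_interior:
  assumes "0 < \<sigma>" "0 < c"
  shows "err \<sigma> (c / (\<sigma> + c)) \<omega> = \<sigma> * Z \<omega> - scaled (\<sigma> / c) (X \<omega> + \<sigma> * Z \<omega>)"
proof -
  have "1 - c / (\<sigma> + c) = \<sigma> / (\<sigma> + c)" using assms by (simp add: field_simps)
  then have "(1 - c / (\<sigma> + c)) / (c / (\<sigma> + c)) = (\<sigma> / (\<sigma> + c)) / (c / (\<sigma> + c))" by (simp only:)
  also have "\<dots> = \<sigma> / c" using assms by simp
  finally have s: "(1 - c / (\<sigma> + c)) / (c / (\<sigma> + c)) = \<sigma> / c" .
  have "c / (\<sigma> + c) \<noteq> 0" using assms by simp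
  then show ?thesis unfolding err_def clip_def s by (simp only: if_False)
qed

lemma integrable_Z_err:
  assumes "\<kappa> \<in> {0..1}" "0 \<le> \<sigma>"
  shows "integrable M (\<lambda>\<omega>. Z \<omega> * err \<sigma> \<kappa> \<omega>)"
proof (rule Bochner_Integration.integrable_bound)
  show "integrable M (\<lambda>\<omega>. (Z \<omega>)\<^sup>2 + (err \<sigma> \<kappa> \<omega>)\<^sup>2)" using Z_sq_integrable err_sq_integrable[OF assms] by simp
  have "\<bar>x * y\<bar> \<le> \<bar>x\<^sup>2 + y\<^sup>2\<bar>" for x y :: real
  proof -
    have "0 \<le> (\<bar>x\<bar> - \<bar>y\<bar>)\<^sup>2" by simp
    then have "2 * (\<bar>x\<bar> * \<bar>y\<bar>) \<le> x\<^sup>2 + y\<^sup>2" by (simp add: power2_eq_square algebra_simps)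
    moreover have "0 \<le> \<bar>x\<bar> * \<bar>y\<bar>" by simp
    ultimately have "\<bar>x\<bar> * \<bar>y\<bar> \<le> x\<^sup>2 + y\<^sup>2" by linarith
    then show ?thesis unfolding abs_mult by (rule order_trans[OF _ abs_ge_self])
  qed
  then show "AE \<omega> in M. norm (Z \<omega> * err \<sigma> \<kappa> \<omega>) \<le> norm ((Z \<omega>)\<^sup>2 + (err \<sigma> \<kappa> \<omega>)\<^sup>2)" by simp
qed simp

text \<open>Along the curve the scale is \<open>\<sigma> / c * exp (- (a * t))\<close>. Expressing
  the observation in units of \<open>\<sigma> / c\<close> produces the argument of
  \<open>smooth\<close>, with \<open>b = X \<omega> / \<sigma>\<close>.\<close>

lemma expectation_Z_err:
  fixes a t \<sigma> c :: real
  assumes \<sigma>: "0 < \<sigma>" and c: "0 < c"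
  defines "\<sigma>' \<equiv> \<sigma> * exp t" and "c' \<equiv> c * exp ((1 + a) * t)"
  shows "(\<integral>\<omega>. Z \<omega> * err \<sigma>' (c' / (\<sigma>' + c')) \<omega> \<partial>M)
    = \<sigma> * (exp t - (\<integral>\<omega>. smooth a (rescale c) (X \<omega> / \<sigma>) t \<partial>M))"
proof -
  let ?e = "\<lambda>x z. \<sigma> * (exp t * z - exp (- (a * t)) * rescale c (x / \<sigma> * exp (a * t) + exp ((1 + a) * t) * z))"
  have pos: "0 < \<sigma>'" "0 < c'" using \<sigma> c by (auto simp: \<sigma>'_def c'_def)
  have sc: "\<sigma>' / c' = \<sigma> / c * exp (- (a * t))"
    unfolding \<sigma>'_def c'_def using c by (simp add: distrib_right exp_add exp_minus field_simps)
  have e: "err \<sigma>' (c' / (\<sigma>' + c')) \<omega> = ?e (X \<omega>) (Z \<omega>)" for \<omega>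
  proof -
    have arg: "(X \<omega> + \<sigma>' * Z \<omega>) / (\<sigma> / c * exp (- (a * t))) = c * (X \<omega> / \<sigma> * exp (a * t) + exp ((1 + a) * t) * Z \<omega>)"
      using \<sigma> c by (simp add: \<sigma>'_def distrib_right exp_add exp_minus field_simps)
    show ?thesis
      unfolding err_interior[OF pos] scaled_def sc arg unfolding rescale_def \<sigma>'_def
      by (simp add: right_diff_distrib)
  qed
  have "c' / (\<sigma>' + c') \<in> {0..1}" using pos by auto
  from integrable_Z_err[OF this, of \<sigma>'] pos
  have i: "integrable M (\<lambda>\<omega>. Z \<omega> * ?e (X \<omega>) (Z \<omega>))"
    unfolding e by simp
  have "(\<integral>\<omega>. Z \<omega> * err \<sigma>' (c' / (\<sigma>' + c')) \<omega> \<partial>M)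
     = (\<integral>\<omega>. (\<integral>z. z * ?e (X \<omega>) z \<partial>gauss) \<partial>M)"
    unfolding e by (rule integral_XZ[OF _ i]) measurable
  also have "\<dots> = (\<integral>\<omega>. \<sigma> * (exp t - smooth a (rescale c) (X \<omega> / \<sigma>) t) \<partial>M)"
  proof (rule Bochner_Integration.integral_cong[OF refl])
    fix \<omega>
    let ?f = "\<lambda>z. rescale c (X \<omega> / \<sigma> * exp (a * t) + exp ((1 + a) * t) * z)"
    have "integrable gauss (\<lambda>z. ?f z * z)"
      using shrinkage.abs_S_le_T[OF shrinkage_rescale[OF c]] by (intro integrable_gauss_bounded_mult) auto
    moreover have "(\<lambda>z. z * (\<sigma> * (exp t * z - exp (- (a * t)) * ?f z))) = (\<lambda>z. \<sigma> * (exp t * z\<^sup>2 - exp (- (a * t)) * (?f z * z)))"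
      by (simp add: power2_eq_square algebra_simps)
    ultimately show "(\<integral>z. z * (\<sigma> * (exp t * z - exp (- (a * t)) * ?f z)) \<partial>gauss) = \<sigma> * (exp t - smooth a (rescale c) (X \<omega> / \<sigma>) t)"
      by (simp add: smooth_def)
  qed
  also have "\<dots> = \<sigma> * (exp t - (\<integral>\<omega>. smooth a (rescale c) (X \<omega> / \<sigma>) t \<partial>M))"
  proof -
    have "integrable M (\<lambda>\<omega>. smooth a (rescale c) (X \<omega> / \<sigma>) t)"
      using shrinkage.abs_S_le_T[OF shrinkage_rescale[OF c]] by (intro integrable_smooth[OF _ _ finite_measure_axioms]) auto
    then show ?thesis by (simp add: prob_space)
  qed
  finally show ?thesis .
qed

text \<open>The choice \<open>a = k / q\<close> is forced: the weights 1 and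
  \<open>exp (k * t)\<close> cancel the penalties only if the scale shrinks at that rate. The new
  scale may fail to be optimal at the new noise level, but \<open>opt_risk\<close> there can only be
  smaller.\<close>

lemma risk_increment:
  fixes k t \<sigma> c :: real
  assumes \<sigma>: "0 < \<sigma>" and c: "0 < c" and k: "0 < k" and t: "0 < t"
  defines "a \<equiv> k / q"
  defines "G \<equiv> \<lambda>t. exp t - (\<integral>\<omega>. smooth a (rescale c) (X \<omega> / \<sigma>) t \<partial>M)"
  shows "(exp (k * t) - 1) * (opt_risk (\<sigma> * exp t) - risk \<sigma> (c / (\<sigma> + c)))
    \<le> 2 * \<sigma>\<^sup>2 * (exp ((k + 1) * t) - 1) * (G t - G 0)"
proof -
  define \<sigma>' where "\<sigma>' = \<sigma> * exp t"
  define c' where "c' = c * exp ((1 + a) * t)"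
  define k1 where "k1 = c / (\<sigma> + c)"
  define k2 where "k2 = c' / (\<sigma>' + c')"
  have pos: "0 < \<sigma>'" "0 < c'" using \<sigma> c by (auto simp: \<sigma>'_def c'_def)
  have K: "k1 \<in> {0..1}" "k2 \<in> {0..1}" using pos \<sigma> c by (auto simp: k1_def k2_def)
  have sc: "\<sigma>' / c' = \<sigma> / c * exp (- (a * t))"
    unfolding \<sigma>'_def c'_def using c by (simp add: distrib_right exp_add exp_minus field_simps)
  have "(\<sigma>' / c') powr q = (\<sigma> / c) powr q * exp (- (k * t))"
  proof -
    have "exp (- (a * t)) powr q = exp (- (k * t))" using q_pos by (simp add: exp_powr_real a_def)
    then show ?thesis unfolding sc using \<sigma> c by (subst powr_mult) auto
  qed
  then have w: "1 * (\<sigma> / c) powr q = exp (k * t) * (\<sigma>' / c') powr q" by (simp add: exp_minus)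
  have pw: "(exp (k * t) - 1) * ((err \<sigma>' k2 \<omega>)\<^sup>2 - (err \<sigma> k1 \<omega>)\<^sup>2)
      \<le> 2 * (exp (k * t) * \<sigma>' - \<sigma>) * (Z \<omega> * err \<sigma>' k2 \<omega> - Z \<omega> * err \<sigma> k1 \<omega>)" for \<omega>
    using revealed_preference[of "\<sigma> / c" "\<sigma>' / c'" 1 "exp (k * t)" \<sigma>' "Z \<omega>" "X \<omega>" \<sigma>] w \<sigma> c pos
    unfolding k1_def k2_def err_interior[OF \<sigma> c] err_interior[OF pos] right_diff_distrib[symmetric] by simp
  note i = err_sq_integrable[OF K(1), of \<sigma>] err_sq_integrable[OF K(2), of \<sigma>'] integrable_Z_err[OF K(1), of \<sigma>] integrable_Z_err[OF K(2), of \<sigma>']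
  have "(\<integral>\<omega>. (exp (k * t) - 1) * ((err \<sigma>' k2 \<omega>)\<^sup>2 - (err \<sigma> k1 \<omega>)\<^sup>2) \<partial>M)
     \<le> (\<integral>\<omega>. 2 * (exp (k * t) * \<sigma>' - \<sigma>) * (Z \<omega> * err \<sigma>' k2 \<omega> - Z \<omega> * err \<sigma> k1 \<omega>) \<partial>M)"
    using i \<sigma> pos by (intro integral_mono pw) auto
  then have main: "(exp (k * t) - 1) * (risk \<sigma>' k2 - risk \<sigma> k1)
     \<le> 2 * (exp (k * t) * \<sigma>' - \<sigma>) * ((\<integral>\<omega>. Z \<omega> * err \<sigma>' k2 \<omega> \<partial>M) - (\<integral>\<omega>. Z \<omega> * err \<sigma> k1 \<omega> \<partial>M))"
    using i \<sigma> pos by (simp add: risk_def)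
  have "(\<integral>\<omega>. Z \<omega> * err \<sigma>' k2 \<omega> \<partial>M) = \<sigma> * G t"
    using expectation_Z_err[OF \<sigma> c, of t a] by (simp add: k2_def \<sigma>'_def c'_def G_def)
  moreover have "(\<integral>\<omega>. Z \<omega> * err \<sigma> k1 \<omega> \<partial>M) = \<sigma> * G 0"
    using expectation_Z_err[OF \<sigma> c, of 0 a] by (simp add: k1_def G_def)
  moreover have "exp (k * t) * \<sigma>' - \<sigma> = \<sigma> * (exp ((k + 1) * t) - 1)"
    by (simp add: \<sigma>'_def distrib_right exp_add algebra_simps)
  ultimately have "(exp (k * t) - 1) * (risk \<sigma>' k2 - risk \<sigma> k1) \<le> 2 * (\<sigma> * (exp ((k + 1) * t) - 1)) * (\<sigma> * G t - \<sigma> * G 0)"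
    using main by simp
  also have "\<dots> = 2 * \<sigma>\<^sup>2 * (exp ((k + 1) * t) - 1) * (G t - G 0)" by (simp add: power2_eq_square algebra_simps)
  finally have *: "(exp (k * t) - 1) * (risk \<sigma>' k2 - risk \<sigma> k1) \<le> 2 * \<sigma>\<^sup>2 * (exp ((k + 1) * t) - 1) * (G t - G 0)" .
  have "(exp (k * t) - 1) * (opt_risk \<sigma>' - risk \<sigma> k1) \<le> (exp (k * t) - 1) * (risk \<sigma>' k2 - risk \<sigma> k1)"
    using opt_risk_le[OF K(2), of \<sigma>'] k t by (intro mult_left_mono) auto
  with * show ?thesis unfolding \<sigma>'_def k1_def by linarith
qed

text \<open>The bound of \<open>risk_increment\<close> and the target, multiplied by
  \<open>exp (k * t) - 1\<close>, both vanish to second order at \<open>t = 0\<close>. After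
  division by \<open>\<sigma>^2 * t^2\<close> their limits are \<open>2 * (k + 1)\<close> times the
  slope and \<open>2 * k * D\<close>.\<close>

lemma opt_risk_local_growth:
  fixes k D \<sigma> c :: real
  assumes \<sigma>: "0 < \<sigma>" and c: "0 < c" and k: "0 < k" and opt: "risk \<sigma> (c / (\<sigma> + c)) = opt_risk \<sigma>"
  defines "a \<equiv> k / q"
  assumes slope: "(k + 1) * (\<integral>\<omega>. shrinkage.risk_slope (rescale c) a (X \<omega> / \<sigma>) \<partial>M) < k * D"
  shows "\<forall>\<^sub>F t in at_right 0. opt_risk (\<sigma> * exp t) - opt_risk \<sigma> \<le> D * (\<sigma>\<^sup>2 * (exp (2 * t) - 1))"
proof -
  interpret A: shrinkage "rescale c" "T / c" \<nu> by (rule shrinkage_rescale[OF c])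
  let ?s = "\<integral>\<omega>. A.risk_slope a (X \<omega> / \<sigma>) \<partial>M"
  define G where "G = (\<lambda>t. exp t - (\<integral>\<omega>. smooth a (rescale c) (X \<omega> / \<sigma>) t \<partial>M))"
  have a: "0 \<le> a" using k q_pos by (simp add: a_def)
  have Xi: "integrable M (\<lambda>\<omega>. X \<omega> / \<sigma>)" using X_integrable by simp
  obtain C where C: "\<And>t b. t \<in> {-1<..<1} \<Longrightarrow> \<bar>smooth_deriv a (rescale c) b t\<bar> \<le> C * (1 + \<bar>b\<bar>)"
    using smooth_deriv_bound[OF A.S_measurable A.abs_S_le_T a] by metis
  have C0: "norm (smooth_deriv a (rescale c) b 0) \<le> norm (C * (1 + \<bar>b\<bar>))" for b
    using order_trans[OF C[of 0 b] abs_ge_self] by simp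
  have int: "integrable M (\<lambda>\<omega>. smooth_deriv a (rescale c) (X \<omega> / \<sigma>) 0)"
  proof (rule Bochner_Integration.integrable_bound)
    show "integrable M (\<lambda>\<omega>. C * (1 + \<bar>X \<omega> / \<sigma>\<bar>))"
      by (intro integrable_mult_right Bochner_Integration.integrable_add integrable_abs Xi) simp
    show "AE \<omega> in M. norm (smooth_deriv a (rescale c) (X \<omega> / \<sigma>) 0) \<le> norm (C * (1 + \<bar>X \<omega> / \<sigma>\<bar>))"
      by (rule AE_I2) (rule C0)
    have "(\<lambda>b. smooth_deriv a (rescale c) b 0) \<in> borel_measurable borel"
      using A.measurable_risk_slope[of a] borel_measurable_diff[OF borel_measurable_const[of 1 borel]]
      unfolding A.risk_slope_smooth[abs_def] by fastforce
    from measurable_compose[OF _ this, of "\<lambda>\<omega>. X \<omega> / \<sigma>"]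
    show "(\<lambda>\<omega>. smooth_deriv a (rescale c) (X \<omega> / \<sigma>) 0) \<in> borel_measurable M" by simp
  qed
  have s_eq: "?s = 1 - (\<integral>\<omega>. smooth_deriv a (rescale c) (X \<omega> / \<sigma>) 0 \<partial>M)"
    unfolding A.risk_slope_smooth using int by (simp add: prob_space)
  have "(G has_real_derivative (1 - (\<integral>\<omega>. smooth_deriv a (rescale c) (X \<omega> / \<sigma>) 0 \<partial>M))) (at 0)"
    unfolding G_def
    by (intro DERIV_diff smooth_integral_derivative[OF A.S_measurable A.abs_S_le_T a finite_measure_axioms Xi])
       (auto intro!: derivative_eq_intros)
  then have "((\<lambda>t. (G t - G 0) / t) \<longlongrightarrow> ?s) (at 0)" unfolding s_eq by (simp add: has_field_derivative_iff)
  then have Glim: "((\<lambda>t. (G t - G 0) / t) \<longlongrightarrow> ?s) (at_right 0)" by (rule tendsto_within_subset) simp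
  have "((\<lambda>t. D * ((exp (k * t) - 1) / t) * ((exp (2 * t) - 1) / t) - 2 * ((exp ((k + 1) * t) - 1) / t) * ((G t - G 0) / t))
     \<longlongrightarrow> D * k * 2 - 2 * (k + 1) * ?s) (at_right 0)"
    by (intro tendsto_intros exp_quotient Glim)
  moreover have "0 < D * k * 2 - 2 * (k + 1) * ?s"
  proof -
    have "0 < 2 * (k * D - (k + 1) * ?s)" using slope by simp
    also have "\<dots> = D * k * 2 - 2 * (k + 1) * ?s" by (simp add: algebra_simps)
    finally show ?thesis .
  qed
  ultimately have "\<forall>\<^sub>F t in at_right 0. 0 < D * ((exp (k * t) - 1) / t) * ((exp (2 * t) - 1) / t) - 2 * ((exp ((k + 1) * t) - 1) / t) * ((G t - G 0) / t)"
    by (rule order_tendstoD(1))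
  moreover note eventually_at_right_less[of "0::real"]
  ultimately show ?thesis
  proof eventually_elim
    case (elim t)
    let ?E = "exp (k * t) - 1"
    have E: "0 < ?E" using elim k by simp
    have t2: "0 < t\<^sup>2" using elim by simp
    have eq: "D * (x / t) * (y / t) - 2 * (u / t) * (g / t) = (D * x * y - 2 * u * g) / t\<^sup>2" for x y u g
      by (simp add: power2_eq_square diff_divide_distrib)
    have "2 * (exp ((k + 1) * t) - 1) * (G t - G 0) \<le> D * ?E * (exp (2 * t) - 1)"
      using elim(1) t2 unfolding eq by (simp only: zero_less_divide_iff) linarith
    then have "\<sigma>\<^sup>2 * (2 * (exp ((k + 1) * t) - 1) * (G t - G 0)) \<le> \<sigma>\<^sup>2 * (D * ?E * (exp (2 * t) - 1))"
      by (intro mult_left_mono) auto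
    moreover have "?E * (opt_risk (\<sigma> * exp t) - opt_risk \<sigma>) \<le> 2 * \<sigma>\<^sup>2 * (exp ((k + 1) * t) - 1) * (G t - G 0)"
      using risk_increment[OF \<sigma> c k elim(2)] unfolding opt a_def[symmetric] G_def .
    moreover have "2 * \<sigma>\<^sup>2 * (exp ((k + 1) * t) - 1) * (G t - G 0) = \<sigma>\<^sup>2 * (2 * (exp ((k + 1) * t) - 1) * (G t - G 0))"
      by (simp only: ac_simps)
    moreover have "\<sigma>\<^sup>2 * (D * ?E * (exp (2 * t) - 1)) = ?E * (D * (\<sigma>\<^sup>2 * (exp (2 * t) - 1)))"
      by (simp only: ac_simps)
    ultimately have "?E * (opt_risk (\<sigma> * exp t) - opt_risk \<sigma>) \<le> ?E * (D * (\<sigma>\<^sup>2 * (exp (2 * t) - 1)))"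
      by (simp only: order_trans)
    then show ?case using E by simp
  qed
qed

lemma opt_risk_growth:
  assumes d1: "density < 1" and D: "density < D"
  shows "\<forall>\<^sub>F \<sigma> in at_right 0. \<forall>\<^sub>F t in at_right 0.
    opt_risk (\<sigma> * exp t) - opt_risk \<sigma> \<le> D * (\<sigma>\<^sup>2 * (exp (2 * t) - 1))"
proof -
  have d0: "0 \<le> density" by (simp add: density_def)
  define m where "m = (density + D) / 2"
  have m: "0 < m" "m < D" "density < m" using d0 D by (auto simp: m_def)
  \<comment> \<open>Then \<open>k * (D - m) = 2 * m > m\<close>, which is
    \<open>(k + 1) * m < k * D\<close>.\<close>
  define k where "k = 2 * m / (D - m)"
  have k: "0 < k" using m by (simp add: k_def)
  have km: "(k + 1) * m < k * D"
  proof -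
    have "k * (D - m) = 2 * m" using m by (simp add: k_def)
    then show ?thesis using m by (simp add: algebra_simps)
  qed
  have a: "0 \<le> k / q" using k q_pos by simp
  have "\<forall>\<^sub>F \<sigma> in at_right 0. \<forall>c>0. risk \<sigma> (c / (\<sigma> + c)) = opt_risk \<sigma> \<longrightarrow>
      (\<integral>\<omega>. shrinkage.risk_slope (rescale c) (k / q) (X \<omega> / \<sigma>) \<partial>M) \<le> density + (m - density)"
    using m by (intro opt_slope_upper a) simp
  moreover have "\<forall>\<^sub>F \<sigma> in at_right 0. opt_risk \<sigma> < \<sigma>\<^sup>2 * (density + (1 - density))"
    using d1 by (intro opt_risk_upper) simp
  moreover note eventually_at_right_less[of "0::real"]
  ultimately show ?thesis
  proof eventually_elim
    case (elim \<sigma>)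
    note \<sigma> = elim(3)
    obtain \<kappa> where \<kappa>: "\<kappa> \<in> {0..1}" "opt_risk \<sigma> = risk \<sigma> \<kappa>" using opt_risk_attained[OF \<sigma>] by metis
    have "\<kappa> \<noteq> 1" using elim(2) \<kappa>(2) by (auto simp: risk_one)
    show ?case
    \<comment> \<open>At \<open>\<kappa> = 0\<close> the risk is the second moment of
      \<open>X\<close> at every noise level and bounds \<open>opt_risk\<close> everywhere, so the
      optimal risk cannot grow from there.\<close>
    proof (cases "\<kappa> = 0")
      case True
      show ?thesis using eventually_at_right_less[of "0::real"]
      proof eventually_elim
        case (elim t)
        have "opt_risk (\<sigma> * exp t) - opt_risk \<sigma> \<le> 0" using opt_risk_le_bound[of "\<sigma> * exp t"] \<kappa>(2) True by (simp add: risk_zero)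
        also have "0 \<le> D * (\<sigma>\<^sup>2 * (exp (2 * t) - 1))" using elim m by simp
        finally show ?case .
      qed
    next
      case False
      obtain c where c: "0 < c" "\<kappa> = c / (\<sigma> + c)" using interior_obtain[OF \<sigma> \<kappa>(1) False \<open>\<kappa> \<noteq> 1\<close>] by metis
      have opt: "risk \<sigma> (c / (\<sigma> + c)) = opt_risk \<sigma>" using \<kappa>(2) c(2) by simp
      have "(\<integral>\<omega>. shrinkage.risk_slope (rescale c) (k / q) (X \<omega> / \<sigma>) \<partial>M) \<le> m" using elim(1) c(1) opt by simp
      then have "(k + 1) * (\<integral>\<omega>. shrinkage.risk_slope (rescale c) (k / q) (X \<omega> / \<sigma>) \<partial>M) \<le> (k + 1) * m"
        using k by (intro mult_left_mono) auto
      also note km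
      finally show ?thesis by (rule opt_risk_local_growth[OF \<sigma> c(1) k opt])
    qed
  qed
qed

end

section \<open>The lowest fixed point\<close>

lemma right_growth_le:
  fixes f :: "real \<Rightarrow> real"
  assumes ab: "a \<le> b" and cont: "continuous_on {a..b} f"
    and step: "\<And>v. a \<le> v \<Longrightarrow> v < b \<Longrightarrow> \<exists>d>0. \<forall>v'. v < v' \<and> v' < v + d \<longrightarrow> f v' \<le> f v"
  shows "f b \<le> f a"
proof -
  let ?A = "{a..b} \<inter> f -` {..f a}"
  have "closed ?A" by (intro continuous_closed_preimage cont) auto
  then have "compact ?A"
    using bounded_subset[OF bounded_closed_interval, of ?A a b] by (auto simp: compact_eq_bounded_closed)
  moreover have "a \<in> ?A" using ab by auto
  ultimately obtain c where c: "c \<in> ?A" "\<forall>t\<in>?A. t \<le> c"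
    using compact_attains_sup[of ?A] by blast
  show ?thesis
  proof (cases "c = b")
    case False
    then have "a \<le> c" "c < b" using c by auto
    from step[OF this] obtain d where d: "d > 0" "\<And>v'. c < v' \<Longrightarrow> v' < c + d \<Longrightarrow> f v' \<le> f c" by auto
    define v' where "v' = min (c + d / 2) b"
    have "c < v'" "v' < c + d" "v' \<le> b" using d \<open>c < b\<close> by (auto simp: v'_def)
    then have "v' \<in> ?A" using d(2)[of v'] c by auto
    then have "v' \<le> c" using c(2) by blast
    then show ?thesis using \<open>c < v'\<close> by simp
  qed (use c in auto)
qed

section \<open>The lowest solution of the fixed-point equation\<close>

context
  fixes R :: "real \<Rightarrow> real" and \<delta> \<delta>1 \<epsilon> B v0 :: real
  assumes R_cont: "continuous_on {0..} R" and R0: "R 0 = 0" and R_le: "\<And>v. 0 \<le> v \<Longrightarrow> R v \<le> B"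
    and \<delta>: "0 < \<delta>" "\<delta>1 < \<delta>" and v0: "0 < v0"
    and growth: "\<And>v v'. 0 \<le> v \<Longrightarrow> v \<le> v' \<Longrightarrow> v' \<le> v0 \<Longrightarrow> R v' - R v \<le> \<delta>1 * (v' - v)"
    and ratio: "((\<lambda>v. R v / v) \<longlongrightarrow> \<epsilon>) (at_right 0)" and \<epsilon>: "\<epsilon> < \<delta>"
begin

definition excess :: "real \<Rightarrow> real" where
  "excess v = v - R v / \<delta>"

definition fixed_points :: "real \<Rightarrow> real set" where
  "fixed_points w = {v. 0 \<le> v \<and> excess v = w}"

definition lowest :: "real \<Rightarrow> real" where
  "lowest w = Inf (fixed_points w)"

lemma excess_cont: "continuous_on {0..} excess"
  unfolding excess_def[abs_def] using \<delta> by (intro continuous_intros R_cont) auto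

lemma excess_0: "excess 0 = 0" by (simp add: excess_def R0)

lemma excess_reaches:
  assumes "0 \<le> w" "w \<le> excess u" "0 \<le> u"
  shows "\<exists>v. 0 \<le> v \<and> v \<le> u \<and> excess v = w"
  using IVT'[of excess 0 w u] assms excess_0 continuous_on_subset[OF excess_cont, of "{0..u}"] by auto

lemma lowest_in:
  assumes w: "0 \<le> w"
  shows "lowest w \<in> fixed_points w"
proof -
  define u where "u = max 0 (w + B / \<delta>)"
  have "R u / \<delta> \<le> B / \<delta>" using R_le[of u] \<delta> by (intro divide_right_mono) (auto simp: u_def)
  then have "w \<le> excess u" by (simp add: excess_def u_def)
  then have ne: "fixed_points w \<noteq> {}"
    using excess_reaches[OF w, of u] by (auto simp: fixed_points_def u_def)
  have "closed ({0..} \<inter> excess -` {w})" by (intro continuous_closed_preimage excess_cont) auto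
  also have "{0..} \<inter> excess -` {w} = fixed_points w" by (auto simp: fixed_points_def)
  finally show ?thesis unfolding lowest_def
    using ne by (intro closed_contains_Inf bdd_belowI[of _ 0]) (auto simp: fixed_points_def)
qed

lemma lowest_le: "v \<in> fixed_points w \<Longrightarrow> lowest w \<le> v"
  unfolding lowest_def by (intro cInf_lower bdd_belowI[of _ 0]) (auto simp: fixed_points_def)

lemma lowest_nonneg: "0 \<le> w \<Longrightarrow> 0 \<le> lowest w"
  using lowest_in by (auto simp: fixed_points_def)

lemma excess_lowest: "0 \<le> w \<Longrightarrow> excess (lowest w) = w"
  using lowest_in by (auto simp: fixed_points_def)

lemma excess_growth:
  assumes "0 \<le> v" "v \<le> v'" "v' \<le> v0"
  shows "(1 - \<delta>1 / \<delta>) * (v' - v) \<le> excess v' - excess v"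
proof -
  have "(R v' - R v) / \<delta> \<le> \<delta>1 * (v' - v) / \<delta>" using growth[OF assms] \<delta> by (intro divide_right_mono) auto
  then show ?thesis by (simp add: excess_def diff_divide_distrib algebra_simps)
qed

lemma rate_pos: "0 < 1 - \<delta>1 / \<delta>"
  using \<delta> by simp

text \<open>Monotonicity of \<open>excess\<close> is known only up to \<open>v0\<close>. The
  intermediate value theorem on \<open>[0, v0]\<close> keeps the lowest solution inside that
  range.\<close>

lemma lowest_small:
  assumes "0 \<le> w" "w \<le> excess v0"
  shows "lowest w \<le> v0"
proof -
  obtain v where "0 \<le> v" "v \<le> v0" "excess v = w" using excess_reaches[OF assms] v0 by auto
  then show ?thesis using lowest_le[of v w] by (simp add: fixed_points_def)
qed

lemma excess_v0_pos: "0 < excess v0"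
proof -
  have "0 < (1 - \<delta>1 / \<delta>) * (v0 - 0)" using rate_pos v0 by (intro mult_pos_pos) auto
  then show ?thesis using excess_growth[of 0 v0] v0 excess_0 by simp
qed

lemma lowest_Lipschitz:
  assumes "0 \<le> w" "w \<le> excess v0" "0 \<le> w'" "w' \<le> excess v0"
  shows "(1 - \<delta>1 / \<delta>) * \<bar>lowest w' - lowest w\<bar> \<le> \<bar>w' - w\<bar>"
proof -
  have *: "(1 - \<delta>1 / \<delta>) * \<bar>lowest w' - lowest w\<bar> \<le> \<bar>w' - w\<bar>"
    if "0 \<le> w" "w \<le> excess v0" "0 \<le> w'" "w' \<le> excess v0" "lowest w \<le> lowest w'" for w w'
    using excess_growth[OF lowest_nonneg[OF that(1)] that(5) lowest_small[OF that(3,4)]] that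
    by (simp add: excess_lowest)
  show ?thesis using *[of w w'] *[of w' w] assms by (cases "lowest w \<le> lowest w'") (auto simp: abs_minus_commute)
qed

lemma lowest_continuous: "continuous_on {0..<excess v0} lowest"
proof -
  have "(1 / (1 - \<delta>1 / \<delta>))-lipschitz_on {0..<excess v0} lowest"
  proof (rule lipschitz_onI)
    fix w w' assume "w \<in> {0..<excess v0}" "w' \<in> {0..<excess v0}"
    then have "(1 - \<delta>1 / \<delta>) * \<bar>lowest w - lowest w'\<bar> \<le> \<bar>w - w'\<bar>" by (intro lowest_Lipschitz) auto
    then show "dist (lowest w) (lowest w') \<le> 1 / (1 - \<delta>1 / \<delta>) * dist w w'"
      using rate_pos by (simp only: dist_real_def) (simp add: pos_le_divide_eq mult.commute)
  qed (use rate_pos in simp)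
  then show ?thesis by (rule lipschitz_on_continuous_on)
qed

text \<open>Dividing \<open>excess (lowest w) = w\<close> by \<open>lowest w\<close> expresses
  \<open>w / lowest w\<close> through \<open>R (lowest w) / lowest w\<close>, and
  \<open>lowest w\<close> tends to 0 by continuity.\<close>

lemma lowest_ratio: "((\<lambda>w. lowest w / w) \<longlongrightarrow> 1 / (1 - \<epsilon> / \<delta>)) (at_right 0)"
proof -
  have "lowest 0 = 0"
    using lowest_le[of 0 0] lowest_nonneg[of 0] by (simp add: fixed_points_def excess_0)
  then have "(lowest \<longlongrightarrow> 0) (at 0 within {0..<excess v0})"
    using bspec[OF lowest_continuous[unfolded continuous_on_def], of 0] excess_v0_pos by simp
  then have "(lowest \<longlongrightarrow> 0) (at 0 within {0..excess v0 / 2})"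
    by (rule tendsto_within_subset) (use excess_v0_pos in auto)
  then have lim: "(lowest \<longlongrightarrow> 0) (at_right 0)" using excess_v0_pos by (simp add: at_within_Icc_at_right)
  have pos: "0 < lowest w" if "0 < w" for w
  proof -
    have "lowest w \<noteq> 0" using excess_lowest[of w] that excess_0 by auto
    then show ?thesis using lowest_nonneg[of w] that by simp
  qed
  have "filterlim lowest (at_right 0) (at_right 0)"
    unfolding filterlim_at
  proof
    show "\<forall>\<^sub>F w in at_right 0. lowest w \<in> {0<..} \<and> lowest w \<noteq> 0"
      using eventually_at_right_less[of "0::real"]
    proof eventually_elim
      case (elim w)
      then show ?case using pos[OF elim] by simp
    qed
  qed (rule lim)
  then have "((\<lambda>w. R (lowest w) / lowest w) \<longlongrightarrow> \<epsilon>) (at_right 0)" by (rule filterlim_compose[OF ratio])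
  then have "((\<lambda>w. 1 / (1 - R (lowest w) / lowest w / \<delta>)) \<longlongrightarrow> 1 / (1 - \<epsilon> / \<delta>)) (at_right 0)"
    using \<delta> \<epsilon> by (intro tendsto_intros) auto
  moreover have "\<forall>\<^sub>F w in at_right 0. 1 / (1 - R (lowest w) / lowest w / \<delta>) = lowest w / w"
    using eventually_at_right_less[of "0::real"]
  proof eventually_elim
    case (elim w)
    have "1 - R (lowest w) / lowest w / \<delta> = excess (lowest w) / lowest w"
      using pos[OF elim] by (simp add: excess_def diff_divide_distrib mult.commute)
    then show ?case using elim by (simp add: excess_lowest)
  qed
  ultimately show ?thesis by (simp add: tendsto_cong)
qed

lemma lowest_fixed_point:
  assumes w: "0 \<le> w" and \<Psi>: "\<And>v. 0 \<le> v \<Longrightarrow> \<Psi> v = w + 1 / \<delta> * R v"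
  shows "is_lowest_fixed_point \<Psi> (sqrt (lowest w))"
    and "(THE \<sigma>. is_lowest_fixed_point \<Psi> \<sigma>) = sqrt (lowest w)"
proof -
  have fp: "\<Psi> (\<sigma>\<^sup>2) = \<sigma>\<^sup>2 \<longleftrightarrow> \<sigma>\<^sup>2 \<in> fixed_points w" for \<sigma>
    using \<Psi>[of "\<sigma>\<^sup>2"] by (auto simp: fixed_points_def excess_def)
  have "sqrt (lowest w) \<le> \<tau>" if "0 \<le> \<tau>" "\<tau>\<^sup>2 \<in> fixed_points w" for \<tau>
    using lowest_le[OF that(2)] that(1) by (simp add: real_le_lsqrt)
  then show 1: "is_lowest_fixed_point \<Psi> (sqrt (lowest w))"
    unfolding is_lowest_fixed_point_def fp using lowest_in[OF w] lowest_nonneg[OF w] by simp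
  show "(THE \<sigma>. is_lowest_fixed_point \<Psi> \<sigma>) = sqrt (lowest w)"
  proof (rule the_equality[of _ "sqrt (lowest w)"])
    fix \<sigma> assume "is_lowest_fixed_point \<Psi> \<sigma>"
    with 1 show "\<sigma> = sqrt (lowest w)" unfolding is_lowest_fixed_point_def by (intro antisym) auto
  qed (rule 1)
qed

end

section \<open>From growth in the noise level to growth in the variance\<close>

context penalized_model
begin

lemma opt_risk_0: "opt_risk 0 = 0"
  using opt_risk_le_sq[of 0] opt_risk_nonneg[of 0] by simp

text \<open>\<open>right_growth_le\<close> is applied to the optimal risk minus
  \<open>D * v\<close>. Multiplicative steps cannot start at \<open>v = 0\<close>, where the limit
  of the ratio takes their place.\<close>

lemma opt_risk_variance_growth:
  assumes d1: "density < 1" and D: "density < D"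
  shows "\<exists>v0>0. \<forall>v v'. 0 \<le> v \<and> v \<le> v' \<and> v' \<le> v0 \<longrightarrow> opt_risk (sqrt v') - opt_risk (sqrt v) \<le> D * (v' - v)"
proof -
  let ?R = "\<lambda>v. opt_risk (sqrt v)"
  obtain s0 where s0: "0 < s0" "\<And>\<sigma>. 0 < \<sigma> \<Longrightarrow> \<sigma> < s0 \<Longrightarrow>
      \<forall>\<^sub>F t in at_right 0. opt_risk (\<sigma> * exp t) - opt_risk \<sigma> \<le> D * (\<sigma>\<^sup>2 * (exp (2 * t) - 1))"
    using opt_risk_growth[OF d1 D] unfolding eventually_at_right_field by auto
  have D0: "0 < D" using D by (auto simp: density_def intro: order_le_less_trans[rotated])
  have step: "\<exists>d>0. \<forall>v'. v < v' \<and> v' < v + d \<longrightarrow> ?R v' - D * v' \<le> ?R v - D * v"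
    if v: "0 \<le> v" "v < s0\<^sup>2" for v
  proof (cases "v = 0")
    case True
    have "\<forall>\<^sub>F v in at_right 0. ?R v / v < D" using opt_risk_ratio D by (rule order_tendstoD(2))
    then obtain d where d: "0 < d" "\<And>v'. 0 < v' \<Longrightarrow> v' < d \<Longrightarrow> ?R v' / v' < D"
      unfolding eventually_at_right_field by auto
    have "?R v' - D * v' \<le> 0" if "0 < v'" "v' < d" for v' using d(2)[OF that] that by (simp add: field_simps)
    then show ?thesis using d(1) True by (auto simp: opt_risk_0)
  next
    case False
    have sv: "0 < sqrt v" "sqrt v < s0" using v False s0(1) by (auto simp: real_less_lsqrt)
    obtain b where b: "0 < b" "\<And>t. 0 < t \<Longrightarrow> t < b \<Longrightarrow>
        opt_risk (sqrt v * exp t) - opt_risk (sqrt v) \<le> D * ((sqrt v)\<^sup>2 * (exp (2 * t) - 1))"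
      using s0(2)[OF sv] unfolding eventually_at_right_field by auto
    have "?R v' - D * v' \<le> ?R v - D * v" if v': "v < v'" "v' < v + v * (exp (2 * b) - 1)" for v'
    proof -
      define t where "t = ln (v' / v) / 2"
      have vp: "0 < v" using v False by simp
      have e: "exp (2 * t) = v' / v" using vp v' by (simp add: t_def)
      have "1 < exp (2 * t)" unfolding e using vp v' by simp
      then have t0: "0 < t" by simp
      have "exp (2 * t) < exp (2 * b)" unfolding e using vp v' by (simp add: field_simps)
      then have tb: "t < b" by simp
      have "(sqrt v * exp t)\<^sup>2 = v * exp (2 * t)" using vp by (simp add: power_mult_distrib flip: exp_of_nat_mult)
      then have "(sqrt v * exp t)\<^sup>2 = v'" unfolding e using vp by simp
      then have s1: "sqrt v' = sqrt v * exp t" using vp by (intro real_sqrt_unique) auto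
      have s2: "(sqrt v)\<^sup>2 * (exp (2 * t) - 1) = v' - v" unfolding e using vp by (simp add: field_simps)
      show ?thesis using b(2)[OF t0 tb] unfolding s1 s2 by (simp add: algebra_simps)
    qed
    moreover have "0 < v * (exp (2 * b) - 1)" using v False b by simp
    ultimately show ?thesis by blast
  qed
  define v0 where "v0 = s0\<^sup>2 / 2"
  have v0: "0 < v0" "v0 < s0\<^sup>2" using s0(1) by (auto simp: v0_def)
  have "?R v' - ?R v \<le> D * (v' - v)" if v: "0 \<le> v" "v \<le> v'" "v' \<le> v0" for v v'
  proof -
    have "?R v' - D * v' \<le> ?R v - D * v"
    proof (rule right_growth_le[OF v(2)])
      show "continuous_on {v..v'} (\<lambda>v. ?R v - D * v)"
        using v by (intro continuous_intros continuous_on_subset[OF continuous_on_opt_risk]) auto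
    qed (use v v0 step in auto)
    then show ?thesis by (simp add: algebra_simps)
  qed
  then show ?thesis using v0 by blast
qed

text \<open>Finite penalties correspond to positive \<kappa>. The added point 0 is an infinite
  penalty, and its risk is a limit of risks at positive \<kappa>.\<close>

lemma cINF_positive_scale:
  assumes "0 \<le> \<sigma>"
  shows "(INF \<kappa>\<in>{0<..1}. risk \<sigma> \<kappa>) = opt_risk \<sigma>"
proof (rule antisym)
  show "opt_risk \<sigma> \<le> (INF \<kappa>\<in>{0<..1}. risk \<sigma> \<kappa>)" by (intro cINF_greatest opt_risk_le) auto
  have low: "(INF \<kappa>\<in>{0<..1}. risk \<sigma> \<kappa>) \<le> risk \<sigma> \<kappa>" if "\<kappa> \<in> {0<..1}" for \<kappa>
    using that by (intro cINF_lower bdd_belowI2[where m=0] risk_nonneg) auto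
  show "(INF \<kappa>\<in>{0<..1}. risk \<sigma> \<kappa>) \<le> opt_risk \<sigma>"
  proof (cases "\<sigma> = 0")
    case True
    then show ?thesis using low[of 1] by (simp add: risk_one opt_risk_0)
  next
    case False
    then have \<sigma>: "0 < \<sigma>" using assms by simp
    obtain \<kappa> where \<kappa>: "\<kappa> \<in> {0..1}" "opt_risk \<sigma> = risk \<sigma> \<kappa>" using opt_risk_attained[OF \<sigma>] by metis
    show ?thesis
    proof (cases "\<kappa> = 0")
      case True
      have "(\<lambda>n. risk \<sigma> (inverse (real (Suc n)))) \<longlonglongrightarrow> risk \<sigma> 0"
        using \<sigma> by (intro risk_tendsto LIMSEQ_inverse_real_of_nat) (auto simp: inverse_le_1_iff)
      then show ?thesis unfolding \<kappa>(2) True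
        by (rule LIMSEQ_le_const) (auto intro!: low exI[of _ 0] simp: inverse_le_1_iff)
    next
      case False
      then show ?thesis using low[of \<kappa>] \<kappa> by auto
    qed
  qed
qed

end

theorem theorem6:
  fixes M :: "'a measure" and X Z :: "'a \<Rightarrow> real" and p \<delta> \<epsilon> :: real
  assumes "prob_space M"
    and "X \<in> borel_measurable M"
    and "integrable M (\<lambda>\<omega>. (X \<omega>)\<^sup>2)"
    and "distributed M lborel Z std_normal_density"
    and "prob_space.indep_var M borel X borel Z"
    and "0 \<le> p" and "p < 1"
    and "0 < \<delta>" and "\<delta> < 1"
    and "measure M {\<omega> \<in> space M. X \<omega> \<noteq> 0} = \<epsilon>"
    and "\<epsilon> < \<delta>"
  shows "(\<forall>w\<ge>0. is_lowest_fixed_point (Psi_opt M X Z p \<delta> w) (sigma_low M X Z p \<delta> w)) \<and>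
    (\<exists>w0>0. continuous_on {0..<w0} (\<lambda>w. (sigma_low M X Z p \<delta> w)\<^sup>2)) \<and>
    ((\<lambda>w. (sigma_low M X Z p \<delta> w)\<^sup>2 / w) \<longlongrightarrow> 1 / (1 - \<epsilon> / \<delta>)) (at_right 0)"
proof -
  note p = \<open>0 \<le> p\<close> \<open>p < 1\<close>
  interpret shrinkage "shrink p" "threshold p" "p / (2 - p)"
    by (rule shrinkage_shrink[OF p])
  interpret prob_space M by fact
  interpret shrinkage_model "shrink p" "threshold p" "p / (2 - p)" M X Z
    by unfold_locales (use assms in auto)
  interpret penalized_model "shrink p" "threshold p" "p / (2 - p)" M X Z "\<lambda>y. \<bar>y\<bar> powr p" "2 - p"
  proof
    fix s u y :: real assume s: "0 < s"
    show "(scaled s u)\<^sup>2 / 2 + s powr (2 - p) * \<bar>u - scaled s u\<bar> powr p \<le> (u - y)\<^sup>2 / 2 + s powr (2 - p) * \<bar>y\<bar> powr p"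
      using eta_powr_arg_min[OF p s, of u] unfolding is_arg_min_iff_le lp_objective_def scaled_def by simp
  qed (use p in simp)
  have density: "density = \<epsilon>" using assms by (simp add: density_def)
  \<comment> \<open>The scale of the penalty \<open>l\<close> is
    \<open>s = l powr (1 / (2 - p))\<close>, and \<open>\<kappa> = 1 / (1 + s)\<close> inverts
    \<open>s = (1 - \<kappa>) / \<kappa>\<close>.\<close>
  have risk_eq: "eta_risk M X Z p \<sigma> l = risk \<sigma> (1 / (1 + l powr (1 / (2 - p))))" if l: "0 \<le> l" for \<sigma> l
  proof -
    let ?s = "l powr (1 / (2 - p))"
    have s: "0 \<le> ?s" by simp
    have s1: "1 + ?s \<noteq> 0" using s by linarith
    then have "(1 - 1 / (1 + ?s)) / (1 / (1 + ?s)) = ?s" by (simp add: field_simps)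
    then have "eta p (X \<omega> + \<sigma> * Z \<omega>) l - X \<omega> = err \<sigma> (1 / (1 + ?s)) \<omega>" for \<omega>
      unfolding eta_shrink[OF p l] err_def clip_def scaled_def using s1 by simp
    then show ?thesis unfolding eta_risk_def risk_def by simp
  qed
  have range: "(\<lambda>l. 1 / (1 + l powr (1 / (2 - p)))) ` {0..} = {0<..1}"
  proof (intro equalityI subsetI)
    fix k :: real assume k: "k \<in> {0<..1}"
    let ?l = "((1 - k) / k) powr (2 - p)"
    have l: "?l powr (1 / (2 - p)) = (1 - k) / k" using k p by (simp add: powr_powr)
    have "1 + (1 - k) / k = 1 / k" using k by (simp add: field_simps)
    then have "k = 1 / (1 + ?l powr (1 / (2 - p)))" unfolding l by simp
    then show "k \<in> (\<lambda>l. 1 / (1 + l powr (1 / (2 - p)))) ` {0..}" by (rule image_eqI) simp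
  qed (auto simp: add_pos_nonneg divide_simps)
  have inf: "(INF l\<in>{0..}. eta_risk M X Z p (sqrt v) l) = opt_risk (sqrt v)" if "0 \<le> v" for v
  proof -
    have "(INF l\<in>{0..}. eta_risk M X Z p (sqrt v) l) = (INF l\<in>{0..}. risk (sqrt v) (1 / (1 + l powr (1 / (2 - p)))))"
      by (intro INF_cong refl) (simp add: risk_eq)
    also have "\<dots> = (INF \<kappa>\<in>(\<lambda>l. 1 / (1 + l powr (1 / (2 - p)))) ` {0..}. risk (sqrt v) \<kappa>)"
      by (simp add: image_image)
    finally show ?thesis using cINF_positive_scale[of "sqrt v"] that by (simp add: range)
  qed
  \<comment> \<open>\<open>D\<close> has to exceed \<epsilon> for the growth bound and to stay below
    \<delta> for \<open>excess\<close> to increase strictly.\<close>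
  define D where "D = (\<epsilon> + \<delta>) / 2"
  have D: "\<epsilon> < D" "D < \<delta>" using \<open>\<epsilon> < \<delta>\<close> by (auto simp: D_def)
  have "\<epsilon> < 1" using assms by simp
  then obtain v0 where v0: "0 < v0"
    "\<And>v v'. 0 \<le> v \<Longrightarrow> v \<le> v' \<Longrightarrow> v' \<le> v0 \<Longrightarrow> opt_risk (sqrt v') - opt_risk (sqrt v) \<le> D * (v' - v)"
    using opt_risk_variance_growth[of D] D density by blast
  let ?R = "\<lambda>v. opt_risk (sqrt v)"
  let ?low = "lowest ?R \<delta>"
  have R0: "?R 0 = 0" by (simp add: opt_risk_0)
  note facts = continuous_on_opt_risk R0 opt_risk_le_bound \<open>0 < \<delta>\<close> D(2) v0 opt_risk_ratio[unfolded density] \<open>\<epsilon> < \<delta>\<close>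
  have Psi: "Psi_opt M X Z p \<delta> w v = w + 1 / \<delta> * ?R v" if "0 \<le> v" for w v
    unfolding Psi_opt_def inf[OF that] ..
  have low: "is_lowest_fixed_point (Psi_opt M X Z p \<delta> w) (sqrt (?low w))"
    "sigma_low M X Z p \<delta> w = sqrt (?low w)" if "0 \<le> w" for w
    using lowest_fixed_point[OF facts that Psi] unfolding sigma_low_def by blast+
  have sq: "(sigma_low M X Z p \<delta> w)\<^sup>2 = ?low w" if "0 \<le> w" for w
    using low(2)[OF that] lowest_nonneg[OF facts that] by simp
  show ?thesis
  proof (intro conjI allI impI)
    fix w :: real assume "0 \<le> w"
    then show "is_lowest_fixed_point (Psi_opt M X Z p \<delta> w) (sigma_low M X Z p \<delta> w)"
      using low by simp
  next
    have "continuous_on {0..<excess ?R \<delta> v0} (\<lambda>w. (sigma_low M X Z p \<delta> w)\<^sup>2)"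
      using lowest_continuous[OF facts] by (rule continuous_on_eq) (auto simp: sq)
    then show "\<exists>w0>0. continuous_on {0..<w0} (\<lambda>w. (sigma_low M X Z p \<delta> w)\<^sup>2)"
      using excess_v0_pos[OF facts] by blast
  next
    have "\<forall>\<^sub>F w in at_right 0. ?low w / w = (sigma_low M X Z p \<delta> w)\<^sup>2 / w"
      using eventually_at_right_less[of "0::real"] by eventually_elim (simp add: sq)
    then show "((\<lambda>w. (sigma_low M X Z p \<delta> w)\<^sup>2 / w) \<longlongrightarrow> 1 / (1 - \<epsilon> / \<delta>)) (at_right 0)"
      using lowest_ratio[OF facts] by (rule Lim_transform_eventually[rotated])
  qed
qed

end
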